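(* Let $K$ be a field of characteristic zero and $r\ge2$. Let $P(\underline{x},y)=\sum_{|\underline{i}|\le d_x,\ 0\le j\le d_y}a_{\underline{i},j}\underline{x}^{\underline{i}}y^j\in K[\underline{x},y]\setminus\{0\}$, and let $y_0=\sum_{\underline{n}\geq_{\mathrm{grlex}}(0,\ldots,0,1)}c_{\underline{n}}\underline{x}^{\underline{n}}\in K[[\underline{x}]]$, $c_{(0,\ldots,0,1)}\neq0$, be a simple root of $P$ which is not a polynomial. Let $S(\underline{k})$, $\underline{i}_{\underline{k}}$, $\omega_0$, ${}_{\underline{k}}Q$ and $\mu_{\underline{n}}$ be as defined in the context. Let $\underline{k}\in\mathbb{N}^r$ be such that $|\underline{k}|\geq 2d_xd_y+1$. For any $\underline{p}\in\mathbb{N}^r$, $\underline{p}>_{\mathrm{grlex}} S(\underline{k})$, consider $\underline{n}:=\underline{p}-S(\underline{k})$. Then $$c_{\underline{p}}=c_{S(\underline{k})+\underline{n}}=\sum_{q=1}^{\mu_{\underline{n}}} \frac{1}{q}\left(\frac{-1}{\omega_0}\right)^q\sum_{|\underline{S}|=q,\ \|\underline{S}\|\geq q-1}\underline{A}^{\underline{S}}\left(\sum_{\substack{|\underline{T}_{\underline{S}}|=\|\underline{S}\|-q+1 \\ G(\underline{T}_{\underline{S}})=\underline{n}+q\,\underline{i}_{\underline{k}}-(q-1)S(\underline{k})-G(\underline{S})}}e_{\underline{T}_{\underline{S}}}\,\underline{C}^{\underline{T}_{\underline{S}}}\right),$$ where $\underline{S}=(s_{\underline{i},j})_{|\underline{i}|\le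 d_x,\,0\le j\le d_y}$ and $\underline{T}_{\underline{S}}=(t_{\underline{S},\underline{i}})_{(0,\ldots,0,1)\leq_{\mathrm{grlex}}\underline{i}\leq_{\mathrm{grlex}}S(\underline{k})}$ are vectors of nonnegative integers, $\underline{A}^{\underline{S}}=\prod_{|\underline{i}|\le d_x,\ 0\le j\le d_y}a_{\underline{i},j}^{s_{\underline{i},j}}$, $\underline{C}^{\underline{T}_{\underline{S}}}=\prod_{\underline{i}=(0,\ldots,0,1)}^{S(\underline{k})}c_{\underline{i}}^{t_{\underline{S},\underline{i}}}$, and $e_{\underline{T}_{\underline{S}}}\in\mathbb{N}$ is of the form $$e_{\underline{T}_{\underline{S}}}=\sum_{\left(n^{\underline{l},m}_{\underline{i},j,\underline{L}}\right)} \frac{q!}{\displaystyle\prod_{\underline{l},m}\ \prod_{\underline{i},j}\ \prod_{\underline{L}}n^{\underline{l},m}_{\underline{i},j,\underline{L}}!}\ \prod_{\underline{l},m}\ \prod_{\underline{i},j}\ \prod_{\underline{L}}\left(\frac{j!}{m!\,\underline{L}!}\right)^{n^{\underline{l},m}_{\underline{i},j,\underline{L}}}.$$ Here, in all products: $\underline{l}$ ranges from $S(\underline{i}_{\underline{k}})-\underline{i}_{\underline{k}}$ to $d_yS(\underline{k})+(d_x,0,\ldots,0)-\underline{i}_{\underline{k}}$ and $m=0,\ldots,m_{\underline{l}}$, where $m_{\underline{l}}:=\min\left\{d_y,\ \max\{m\in\mathbb{N} : mS(\underline{k})\leq_{\mathrm{grlex}}\underline{l}+\underline{i}_{\underline{k}}\}\right\}$;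 $\underline{i}$ ranges over multi-indices in $\mathbb{N}^r$ with $|\underline{i}|=0,\ldots,d_x$ and $j=m,\ldots,d_y$; and $\underline{L}=(l_{(0,\ldots,0,1)},\ldots,l_{S(\underline{k})})$ ranges over vectors of nonnegative integers with $|\underline{L}|=j-m$ and $G(\underline{L})=\underline{l}+\underline{i}_{\underline{k}}-mS(\underline{k})-\underline{i}$. The sum is taken over the set of tuples of nonnegative integers $\left(n^{\underline{l},m}_{\underline{i},j,\underline{L}}\right)$, indexed by the same $\underline{l},m,\underline{i},j,\underline{L}$, such that $$\sum_{\underline{l},m}\sum_{\underline{L}} n^{\underline{l},m}_{\underline{i},j,\underline{L}}=s_{\underline{i},j}\ \text{ for all } \underline{i},j,\qquad \sum_{\underline{l},m}\sum_{\underline{i},j} \sum_{\underline{L}}n^{\underline{l},m}_{\underline{i},j,\underline{L}}=q,\qquad \sum_{\underline{l},m}\sum_{\underline{i},j} \sum_{\underline{L}}n^{\underline{l},m}_{\underline{i},j,\underline{L}}\,\underline{L}= \underline{T}_{\underline{S}}.$$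
   Context: For $\underline{n}\in\mathbb{Z}^r$ put $|\underline{n}|=n_1+\cdots+n_r$. Graded lexicographic order on $\mathbb{Z}^r$: $\underline{n}\leq_{\mathrm{grlex}}\underline{m}$ iff $|\underline{n}|<|\underline{m}|$, or $|\underline{n}|=|\underline{m}|$ and $\underline{n}\leq_{\mathrm{lex}}\underline{m}$ (comparing first coordinates first). $w$ sends a nonzero Laurent polynomial in $\underline{x}$ to the $\leq_{\mathrm{grlex}}$-minimum of its support ($w(0)=\infty$), and for $Q=\sum_j a_j(\underline{x})y^j$, $w(Q):=\min_j w(a_j)$. A simple root of $P$ is a $y_0$ with $P(\underline{x},y_0)=0$ and $\frac{\partial P}{\partial y}(\underline{x},y_0)\neq0$. For $\underline{k}\in\mathbb{N}^r$: $S(\underline{k})$ (not to be confused with the vectors $\underline{S}$) is the successor of $\underline{k}$ in $(\mathbb{N}^r,\leq_{\mathrm{grlex}})$; $z_{\underline{0}}:=0$ and $z_{\underline{k}}:=\sum_{(0,\ldots,0,1)\leq_{\mathrm{grlex}}\underline{n}\leq_{\mathrm{grlex}}\underline{k}}c_{\underline{n}}\underline{x}^{\underline{n}}$ for $\underline{k}\neq\underline{0}$; $$P_{\underline{k}}(\underline{x},y):=P(\underline{x},z_{\underline{k}}+\underline{x}^{S(\underline{k})}y)=\sum_{\underline{i}\geq_{\mathrm{grlex}}\underline{i}_{\underline{k}}}\pi^P_{\underline{k},\underline{i}}(y)\,\underline{x}^{\underline{i}},\qquad \underline{i}_{\underline{k}}:=w(P_{\underline{k}}).$$ $\underline{k}_0$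 is the $\leq_{\mathrm{grlex}}$-lowest multi-index in $\mathbb{N}^r$ such that $\underline{i}_{S(\underline{k}_0)}=\underline{i}_{\underline{k}_0}-S(\underline{k}_0)+S^2(\underline{k}_0)$ (it exists since $y_0$ is a simple root), and $\omega_0:=(\pi^P_{\underline{k}_0,\underline{i}_{\underline{k}_0}})'(c_{S(\underline{k}_0)})$, which is nonzero. The Laurent polynomial ${}_{\underline{k}}Q(\underline{x},y)\in K[x_1^{\pm1},\ldots,x_r^{\pm1}][y]$ is defined by $$\frac{P_{\underline{k}}(\underline{x},y+c_{S(\underline{k})})}{-\omega_0\underline{x}^{\underline{i}_{\underline{k}}}}=-y+{}_{\underline{k}}Q(\underline{x},y).$$ For $\underline{n}\in\mathbb{Z}^r$, $\underline{n}>_{\mathrm{grlex}}\underline{0}$, $\mu_{\underline{n}}$ is the greatest integer $m$ such that there is a vector $\underline{M}=(m_{\underline{i},j})$ of nonnegative integers indexed by the pairs $(\underline{i},j)\in\mathbb{Z}^r\times\mathbb{N}$ such that $\underline{x}^{\underline{i}}y^j$ occurs in ${}_{\underline{k}}Q$ with nonzero coefficient, satisfying $\sum m_{\underline{i},j}=m$, $\sum m_{\underline{i},j}j=m-1$ and $\sum m_{\underline{i},j}\underline{i}=\underline{n}$ (if there is none, the sum over $q$ is empty). Notation for vectors: for $\underline{S}=(s_{\underline{i},j})$: $|\underline{S}|=\sum s_{\underline{i},j}$, $\|\underline{S}\|=\sum s_{\underline{i},j}\,j$, $G(\underline{S})=\sum s_{\underline{i},j}\,\underline{i}$. For a vector $\underline{T}=(t_{\underline{i}})_{\underline{i}}$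 indexed by multi-indices $\underline{i}\in\mathbb{N}^r$: $|\underline{T}|=\sum t_{\underline{i}}$, $G(\underline{T})=\sum t_{\underline{i}}\,\underline{i}$, $\underline{T}!=\prod t_{\underline{i}}!$ (likewise for $\underline{L}$). Ranges of multi-indices "from $\underline{a}$ to $\underline{b}$" are for $\leq_{\mathrm{grlex}}$; the range for $\underline{l}$ means that $\hat{\underline{l}}=\underline{l}+\underline{i}_{\underline{k}}$ ranges over the elements of $\mathbb{N}^r$ with $S(\underline{i}_{\underline{k}})\leq_{\mathrm{grlex}}\hat{\underline{l}}\leq_{\mathrm{grlex}}d_yS(\underline{k})+(d_x,0,\ldots,0)$. Empty sums are $0$, empty products are $1$. *)

theory Defs
  imports
    "HOL-Library.Poly_Mapping"
    "HOL-Library.FuncSet"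
    "HOL-Library.Cardinality"
    "HOL-Computational_Algebra.Polynomial"
begin

section \<open>Multi-indices\<close>

text \<open>
  The coordinates are indexed by a finite linearly ordered type \<open>'r\<close> (so \<open>r = CARD('r)\<close>), and
  \<open>\<int>\<^sup>r\<close> is the type \<open>'r \<Rightarrow>\<^sub>0 int\<close>, with \<open>\<nat>\<^sup>r\<close> as a subset of it. The order \<open>\<le>\<close> that
  \<^theory>\<open>HOL-Library.Poly_Mapping\<close> puts on this type is the lexicographic one, in which the
  smallest coordinate index is compared first.
\<close>

type_synonym 'r mindex = "'r \<Rightarrow>\<^sub>0 int"

definition Nr :: "'r mindex set" where
  "Nr = {n. \<forall>c. 0 \<le> Poly_Mapping.lookup n c}"

definition tdeg :: "'r::finite mindex \<Rightarrow> int" where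
  "tdeg n = (\<Sum>c\<in>UNIV. Poly_Mapping.lookup n c)"

definition grlex_le :: "'r::{finite,linorder} mindex \<Rightarrow> 'r mindex \<Rightarrow> bool" where
  "grlex_le n m \<longleftrightarrow> tdeg n < tdeg m \<or> (tdeg n = tdeg m \<and> n \<le> m)"

definition grlex_less :: "'r::{finite,linorder} mindex \<Rightarrow> 'r mindex \<Rightarrow> bool" where
  "grlex_less n m \<longleftrightarrow> grlex_le n m \<and> n \<noteq> m"

lemma grlex_linorder: "class.linorder grlex_le grlex_less"
  by unfold_locales (auto simp: grlex_le_def grlex_less_def)

definition grlex_least :: "'r::{finite,linorder} mindex set \<Rightarrow> 'r mindex" where
  "grlex_least A = ord.Least grlex_le (\<lambda>n. n \<in> A)"

definition nscale :: "nat \<Rightarrow> 'r mindex \<Rightarrow> 'r mindex" where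
  "nscale t n = Poly_Mapping.map (\<lambda>v. int t * v) n"

text \<open>\<open>e_first = (1,0,\<dots>,0)\<close> and \<open>e_last = (0,\<dots>,0,1)\<close>.\<close>

definition e_first :: "'r::{finite,linorder} mindex" where
  "e_first = Poly_Mapping.single (Min UNIV) 1"

definition e_last :: "'r::{finite,linorder} mindex" where
  "e_last = Poly_Mapping.single (Max UNIV) 1"

definition grlex_succ :: "'r::{finite,linorder} mindex \<Rightarrow> 'r mindex" where
  "grlex_succ k = grlex_least {m \<in> Nr. grlex_less k m}"


section \<open>Polynomials, Laurent polynomials and power series\<close>

text \<open>
  With convolution as multiplication, \<open>'r mindex \<Rightarrow>\<^sub>0 'k\<close> is the ring of Laurent polynomials
  \<open>K[x\<^sub>1\<^sup>\<plusminus>\<^sup>1,\<dots>,x\<^sub>r\<^sup>\<plusminus>\<^sup>1]\<close>; the polynomials in \<open>y\<close> over it are of type \<open>('r mindex \<Rightarrow>\<^sub>0 'k) poly\<close>.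
\<close>

definition xpolys :: "('r mindex \<Rightarrow>\<^sub>0 'k::zero) set" where
  "xpolys = {a. Poly_Mapping.keys a \<subseteq> Nr}"

definition xmon :: "'r mindex \<Rightarrow> 'k \<Rightarrow> 'r mindex \<Rightarrow>\<^sub>0 'k::zero" where
  "xmon n a = Poly_Mapping.single n a"

text \<open>The ring \<open>K[[x]]\<close>; coefficients are indexed by all of \<open>\<int>\<^sup>r\<close> and vanish outside \<open>\<nat>\<^sup>r\<close>.\<close>

typedef (overloaded) ('r, 'k) mfps = "{f :: 'r mindex \<Rightarrow> 'k::zero. \<forall>n. n \<notin> Nr \<longrightarrow> f n = 0}"
  morphisms mfps_nth Abs_mfps
  by (rule exI[of _ "\<lambda>_. 0"]) simp

setup_lifting type_definition_mfps

lemma mfps_eqI: "(\<And>n. n \<in> Nr \<Longrightarrow> mfps_nth f n = mfps_nth g n) \<Longrightarrow> f = g"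
  by transfer (metis ext)

definition mfps_splits :: "'r mindex \<Rightarrow> 'r mindex set" where
  "mfps_splits n = {i \<in> Nr. n - i \<in> Nr}"

lemma Nr_0 [simp]: "0 \<in> Nr"
  by (simp add: Nr_def)

lemma Nr_add: "a \<in> Nr \<Longrightarrow> b \<in> Nr \<Longrightarrow> a + b \<in> Nr"
  by (simp add: Nr_def lookup_add)

lemma mfps_splits_empty: "n \<notin> Nr \<Longrightarrow> mfps_splits n = {}"
  using Nr_add[of _ "n - _"] by (fastforce simp: mfps_splits_def)

lemma finite_mfps_splits [simp]: "finite (mfps_splits (n :: 'r::finite mindex))"
proof -
  have "Poly_Mapping.lookup ` mfps_splits n \<subseteq> Pi\<^sub>E UNIV (\<lambda>c. {0..Poly_Mapping.lookup n c})"
    by (auto simp: mfps_splits_def Nr_def lookup_minus PiE_iff)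
  hence "finite (Poly_Mapping.lookup ` mfps_splits n)"
    by (rule finite_subset) (auto intro: finite_PiE)
  thus ?thesis
    by (rule finite_imageD) (auto simp: inj_on_def)
qed

instantiation mfps :: (type, comm_ring_1) ab_group_add
begin

lift_definition zero_mfps :: "('a, 'b) mfps" is "\<lambda>_. 0" by simp

lift_definition plus_mfps :: "('a, 'b) mfps \<Rightarrow> ('a, 'b) mfps \<Rightarrow> ('a, 'b) mfps"
  is "\<lambda>f g n. f n + g n" by simp

lift_definition uminus_mfps :: "('a, 'b) mfps \<Rightarrow> ('a, 'b) mfps"
  is "\<lambda>f n. - f n" by simp

lift_definition minus_mfps :: "('a, 'b) mfps \<Rightarrow> ('a, 'b) mfps \<Rightarrow> ('a, 'b) mfps"
  is "\<lambda>f g n. f n - g n" by simp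

instance
proof
  fix a b c :: "('a, 'b) mfps"
  show "a + b + c = a + (b + c)" "a + b = b + a" "0 + a = a" "- a + a = 0" "a - b = a + - b"
    by (transfer; simp add: fun_eq_iff add_ac)+
qed

end

instantiation mfps :: (finite, comm_ring_1) comm_ring_1
begin

lift_definition one_mfps :: "('a, 'b) mfps" is "\<lambda>n. if n = 0 then 1 else 0"
  by auto

lift_definition times_mfps :: "('a, 'b) mfps \<Rightarrow> ('a, 'b) mfps \<Rightarrow> ('a, 'b) mfps"
  is "\<lambda>f g n. \<Sum>i\<in>mfps_splits n. f i * g (n - i)"
  by (simp add: mfps_splits_empty)

instance
proof
  fix f g h :: "('a, 'b) mfps"
  show "f * g * h = f * (g * h)"
  proof (transfer, rule ext)
    fix f g h :: "'a mindex \<Rightarrow> 'b" and n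
    have "(\<Sum>j\<in>mfps_splits n. (\<Sum>i\<in>mfps_splits j. f i * g (j - i)) * h (n - j))
        = (\<Sum>(j,i)\<in>Sigma (mfps_splits n) mfps_splits. f i * g (j - i) * h (n - j))"
      by (simp add: sum_distrib_right sum.Sigma)
    also have "\<dots> = (\<Sum>(i,d)\<in>Sigma (mfps_splits n) (\<lambda>i. mfps_splits (n - i)).
                        f i * (g d * h (n - i - d)))"
    proof (rule sum.reindex_bij_witness[where i = "\<lambda>(i,d). (i + d, i)" and j = "\<lambda>(j,i). (i, j - i)"],
           goal_cases)
      case (2 x)
      obtain j i where x: "x = (j, i)" by (cases x)
      have "(j - i) + (n - j) \<in> Nr"
        using 2 by (intro Nr_add) (auto simp: x mfps_splits_def)
      thus ?case using 2 by (auto simp: x mfps_splits_def)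
    next
      case (4 x)
      thus ?case by (cases x) (auto simp: mfps_splits_def Nr_add diff_diff_eq)
    next
      case (5 x)
      thus ?case by (cases x) (auto simp: mult.assoc)
    qed auto
    also have "\<dots> = (\<Sum>i\<in>mfps_splits n. f i * (\<Sum>d\<in>mfps_splits (n - i). g d * h (n - i - d)))"
      by (simp add: sum_distrib_left sum.Sigma)
    finally show "(\<Sum>j\<in>mfps_splits n. (\<Sum>i\<in>mfps_splits j. f i * g (j - i)) * h (n - j))
        = (\<Sum>i\<in>mfps_splits n. f i * (\<Sum>d\<in>mfps_splits (n - i). g d * h (n - i - d)))" .
  qed
  show "f * g = g * f"
  proof (transfer, rule ext)
    fix f g :: "'a mindex \<Rightarrow> 'b" and n
    show "(\<Sum>i\<in>mfps_splits n. f i * g (n - i)) = (\<Sum>i\<in>mfps_splits n. g i * f (n - i))"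
      by (rule sum.reindex_bij_witness[where i = "\<lambda>i. n - i" and j = "\<lambda>i. n - i"])
         (auto simp: mfps_splits_def mult.commute)
  qed
  show "1 * f = f"
  proof (transfer, rule ext)
    fix f :: "'a mindex \<Rightarrow> 'b" and n
    assume f: "\<forall>n. n \<notin> Nr \<longrightarrow> f n = 0"
    have "(\<Sum>i\<in>mfps_splits n. (if i = 0 then 1 else 0) * f (n - i))
        = (\<Sum>i\<in>mfps_splits n. if i = 0 then f n else 0)"
      by (rule sum.cong) auto
    also have "\<dots> = f n"
      using f by (simp add: sum.delta) (auto simp: mfps_splits_def)
    finally show "(\<Sum>i\<in>mfps_splits n. (if i = 0 then 1 else 0) * f (n - i)) = f n" .
  qed
  show "(f + g) * h = f * h + g * h"
    by transfer (simp add: distrib_right sum.distrib fun_eq_iff)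
  show "(0 :: ('a, 'b) mfps) \<noteq> 1"
    by transfer (auto simp: fun_eq_iff)
qed

end

text \<open>The inclusion of \<open>K[x]\<close> into \<open>K[[x]]\<close>; only meaningful on \<^const>\<open>xpolys\<close>.\<close>

lift_definition mfps_of_xpoly :: "('r mindex \<Rightarrow>\<^sub>0 'k::zero) \<Rightarrow> ('r, 'k) mfps"
  is "\<lambda>a n. if n \<in> Nr then Poly_Mapping.lookup a n else 0"
  by simp

definition eval_y ::
  "('r::finite mindex \<Rightarrow>\<^sub>0 'k::comm_ring_1) poly \<Rightarrow> ('r, 'k) mfps \<Rightarrow> ('r, 'k) mfps" where
  "eval_y P f = poly (map_poly mfps_of_xpoly P) f"

definition simple_root ::
  "('r::{finite,linorder} mindex \<Rightarrow>\<^sub>0 'k::idom) poly \<Rightarrow> ('r, 'k) mfps \<Rightarrow> bool" where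
  "simple_root P f \<longleftrightarrow> eval_y P f = 0 \<and> eval_y (pderiv P) f \<noteq> 0"

text \<open>The value \<open>w(0) = \<infinity>\<close> is left out: \<open>wx\<close> and \<open>wy\<close> are meant for nonzero arguments only, and
  the zero coefficients of \<open>Q\<close>, having value \<open>\<infinity>\<close>, do not contribute to the minimum in \<open>wy Q\<close>.\<close>

definition wx :: "('r::{finite,linorder} mindex \<Rightarrow>\<^sub>0 'k::zero) \<Rightarrow> 'r mindex" where
  "wx a = grlex_least (Poly_Mapping.keys a)"

definition wy :: "('r::{finite,linorder} mindex \<Rightarrow>\<^sub>0 'k::zero) poly \<Rightarrow> 'r mindex" where
  "wy Q = grlex_least {wx (coeff Q j) |j. coeff Q j \<noteq> 0}"


section \<open>The polynomials attached to a root\<close>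

text \<open>\<open>{(0,\<dots>,0,1), \<dots>, k}\<close>, which is empty for \<open>k = 0\<close>; hence \<open>zpart f 0 = 0\<close>.\<close>

definition idxs_upto :: "'r::{finite,linorder} mindex \<Rightarrow> 'r mindex set" where
  "idxs_upto k = {n \<in> Nr. grlex_le e_last n \<and> grlex_le n k}"

definition zpart ::
  "('r::{finite,linorder}, 'k::comm_ring_1) mfps \<Rightarrow> 'r mindex \<Rightarrow> 'r mindex \<Rightarrow>\<^sub>0 'k" where
  "zpart f k = (\<Sum>n\<in>idxs_upto k. xmon n (mfps_nth f n))"

definition P_sub ::
  "('r::{finite,linorder} mindex \<Rightarrow>\<^sub>0 'k::idom) poly \<Rightarrow> ('r, 'k) mfps \<Rightarrow> 'r mindex
     \<Rightarrow> ('r mindex \<Rightarrow>\<^sub>0 'k) poly" where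
  "P_sub P f k = pcompose P [:zpart f k, xmon (grlex_succ k) 1:]"

definition i_sub ::
  "('r::{finite,linorder} mindex \<Rightarrow>\<^sub>0 'k::idom) poly \<Rightarrow> ('r, 'k) mfps \<Rightarrow> 'r mindex \<Rightarrow> 'r mindex" where
  "i_sub P f k = wy (P_sub P f k)"

definition piP ::
  "('r::{finite,linorder} mindex \<Rightarrow>\<^sub>0 'k::idom) poly \<Rightarrow> ('r, 'k) mfps \<Rightarrow> 'r mindex \<Rightarrow> 'r mindex
     \<Rightarrow> 'k poly" where
  "piP P f k i = map_poly (\<lambda>a. Poly_Mapping.lookup a i) (P_sub P f k)"

definition k_zero ::
  "('r::{finite,linorder} mindex \<Rightarrow>\<^sub>0 'k::idom) poly \<Rightarrow> ('r, 'k) mfps \<Rightarrow> 'r mindex" where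
  "k_zero P f = grlex_least {k \<in> Nr.
     i_sub P f (grlex_succ k) = i_sub P f k - grlex_succ k + grlex_succ (grlex_succ k)}"

definition omega0 ::
  "('r::{finite,linorder} mindex \<Rightarrow>\<^sub>0 'k::idom) poly \<Rightarrow> ('r, 'k) mfps \<Rightarrow> 'k" where
  "omega0 P f =
     poly (pderiv (piP P f (k_zero P f) (i_sub P f (k_zero P f)))) (mfps_nth f (grlex_succ (k_zero P f)))"

text \<open>\<open>Q_sub P f k\<close> is the Laurent polynomial \<open>Q = \<^sub>kQ\<close> with
  \<open>P\<^sub>k(x, y + c\<^bsub>S(k)\<^esub>) / (- \<omega>\<^sub>0 x\<^bsup>i\<^sub>k\<^esup>) = - y + Q(x,y)\<close>.\<close>

definition Q_sub ::
  "('r::{finite,linorder} mindex \<Rightarrow>\<^sub>0 'k::field) poly \<Rightarrow> ('r, 'k) mfps \<Rightarrow> 'r mindex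
     \<Rightarrow> ('r mindex \<Rightarrow>\<^sub>0 'k) poly" where
  "Q_sub P f k =
     smult (xmon (- i_sub P f k) (1 / (- omega0 P f)))
       (pcompose (P_sub P f k) [:xmon 0 (mfps_nth f (grlex_succ k)), 1:])
     + [:0, 1:]"


section \<open>Vectors of nonnegative integers\<close>

text \<open>
  A vector of nonnegative integers indexed by a set \<open>I\<close> is a \<open>v :: 'a \<Rightarrow>\<^sub>0 nat\<close> with \<open>keys v \<subseteq> I\<close>.
\<close>

definition vecs :: "'a set \<Rightarrow> ('a \<Rightarrow>\<^sub>0 nat) set" where
  "vecs I = {v. Poly_Mapping.keys v \<subseteq> I}"

definition vsize :: "('a \<Rightarrow>\<^sub>0 nat) \<Rightarrow> nat" where
  "vsize v = (\<Sum>a\<in>Poly_Mapping.keys v. Poly_Mapping.lookup v a)"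

definition vnorm :: "('r mindex \<times> nat \<Rightarrow>\<^sub>0 nat) \<Rightarrow> nat" where
  "vnorm v = (\<Sum>(i,j)\<in>Poly_Mapping.keys v. Poly_Mapping.lookup v (i,j) * j)"

definition G2 :: "('r mindex \<times> nat \<Rightarrow>\<^sub>0 nat) \<Rightarrow> 'r mindex" where
  "G2 v = (\<Sum>(i,j)\<in>Poly_Mapping.keys v. nscale (Poly_Mapping.lookup v (i,j)) i)"

definition G1 :: "('r mindex \<Rightarrow>\<^sub>0 nat) \<Rightarrow> 'r mindex" where
  "G1 v = (\<Sum>i\<in>Poly_Mapping.keys v. nscale (Poly_Mapping.lookup v i) i)"

definition vfact :: "('a \<Rightarrow>\<^sub>0 nat) \<Rightarrow> nat" where
  "vfact v = (\<Prod>a\<in>Poly_Mapping.keys v. fact (Poly_Mapping.lookup v a))"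

definition occurring :: "('r mindex \<Rightarrow>\<^sub>0 'k::zero) poly \<Rightarrow> ('r mindex \<times> nat) set" where
  "occurring Q = {(i,j). Poly_Mapping.lookup (coeff Q j) i \<noteq> 0}"

text \<open>\<open>\<mu_max>\<^sub>n\<close>, with value \<open>0\<close> (so that the sum over \<open>q\<close> is empty) if there is no vector \<open>M\<close> at all.
  The condition \<open>\<parallel>M\<parallel> = m - 1\<close> is written without truncated subtraction.\<close>

definition mu_max :: "('r mindex \<Rightarrow>\<^sub>0 'k::zero) poly \<Rightarrow> 'r mindex \<Rightarrow> nat" where
  "mu_max Q n =
     (let ok = (\<lambda>m. \<exists>M \<in> vecs (occurring Q). vsize M = m \<and> vnorm M + 1 = m \<and> G2 M = n)
      in if \<exists>m. ok m then GREATEST m. ok m else 0)"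


section \<open>The closed formula\<close>

definition abox :: "nat \<Rightarrow> nat \<Rightarrow> ('r::finite mindex \<times> nat) set" where
  "abox dx dy = {(i,j). i \<in> Nr \<and> tdeg i \<le> int dx \<and> j \<le> dy}"

text \<open>The argument \<open>h\<close> is \<open>l + i\<^sub>k\<close>.\<close>

definition m_max :: "nat \<Rightarrow> 'r::{finite,linorder} mindex \<Rightarrow> 'r mindex \<Rightarrow> nat" where
  "m_max dy k h = min dy (Max {m. grlex_le (nscale m (grlex_succ k)) h})"

text \<open>The set of all indices \<open>(l,m,i,j,L)\<close>; the argument \<open>u\<close> is \<open>i\<^sub>k\<close>.\<close>

definition idx_set ::
  "nat \<Rightarrow> nat \<Rightarrow> 'r::{finite,linorder} mindex \<Rightarrow> 'r mindex
     \<Rightarrow> ('r mindex \<times> nat \<times> 'r mindex \<times> nat \<times> ('r mindex \<Rightarrow>\<^sub>0 nat)) set" where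
  "idx_set dx dy k u = {(l,m,i,j,L).
      l + u \<in> Nr \<and> grlex_le (grlex_succ u) (l + u)
    \<and> grlex_le (l + u) (nscale dy (grlex_succ k) + nscale dx e_first)
    \<and> m \<le> m_max dy k (l + u)
    \<and> i \<in> Nr \<and> tdeg i \<le> int dx \<and> m \<le> j \<and> j \<le> dy
    \<and> L \<in> vecs (idxs_upto (grlex_succ k)) \<and> vsize L = j - m
    \<and> G1 L = l + u - nscale m (grlex_succ k) - i}"

definition tuples ::
  "nat \<Rightarrow> nat \<Rightarrow> 'r::{finite,linorder} mindex \<Rightarrow> 'r mindex \<Rightarrow> nat
     \<Rightarrow> ('r mindex \<times> nat \<Rightarrow>\<^sub>0 nat) \<Rightarrow> ('r mindex \<Rightarrow>\<^sub>0 nat)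
     \<Rightarrow> ('r mindex \<times> nat \<times> 'r mindex \<times> nat \<times> ('r mindex \<Rightarrow>\<^sub>0 nat) \<Rightarrow>\<^sub>0 nat) set" where
  "tuples dx dy k u q S T = {N \<in> vecs (idx_set dx dy k u).
      (\<forall>(i,j) \<in> abox dx dy.
         (\<Sum>t \<in> {t \<in> idx_set dx dy k u. \<exists>l m L. t = (l,m,i,j,L)}. Poly_Mapping.lookup N t) = Poly_Mapping.lookup S (i,j))
    \<and> (\<Sum>t \<in> idx_set dx dy k u. Poly_Mapping.lookup N t) = q
    \<and> (\<forall>v \<in> idxs_upto (grlex_succ k).
         (\<Sum>(l,m,i,j,L) \<in> idx_set dx dy k u. Poly_Mapping.lookup N (l,m,i,j,L) * Poly_Mapping.lookup L v) = Poly_Mapping.lookup T v)}"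

definition eT ::
  "nat \<Rightarrow> nat \<Rightarrow> 'r::{finite,linorder} mindex \<Rightarrow> 'r mindex \<Rightarrow> nat
     \<Rightarrow> ('r mindex \<times> nat \<Rightarrow>\<^sub>0 nat) \<Rightarrow> ('r mindex \<Rightarrow>\<^sub>0 nat) \<Rightarrow> rat" where
  "eT dx dy k u q S T = (\<Sum>N \<in> tuples dx dy k u q S T.
      fact q / (\<Prod>t \<in> idx_set dx dy k u. fact (Poly_Mapping.lookup N t))
    * (\<Prod>(l,m,i,j,L) \<in> idx_set dx dy k u.
         (fact j / (fact m * of_nat (vfact L))) ^ Poly_Mapping.lookup N (l,m,i,j,L)))"

text \<open>The ranges of the vectors \<open>S\<close> and \<open>T\<^sub>S\<close>; the inequality \<open>\<parallel>S\<parallel> \<ge> q - 1\<close> and the equation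
  \<open>|T| = \<parallel>S\<parallel> - q + 1\<close> are written without truncated subtraction.\<close>

definition Svecs :: "nat \<Rightarrow> nat \<Rightarrow> nat \<Rightarrow> ('r::finite mindex \<times> nat \<Rightarrow>\<^sub>0 nat) set" where
  "Svecs dx dy q = {S \<in> vecs (abox dx dy). vsize S = q \<and> vnorm S + 1 \<ge> q}"

definition Tvecs ::
  "'r::{finite,linorder} mindex \<Rightarrow> 'r mindex \<Rightarrow> 'r mindex \<Rightarrow> nat
     \<Rightarrow> ('r mindex \<times> nat \<Rightarrow>\<^sub>0 nat) \<Rightarrow> ('r mindex \<Rightarrow>\<^sub>0 nat) set" where
  "Tvecs k u n q S = {T \<in> vecs (idxs_upto (grlex_succ k)).
      vsize T + q = vnorm S + 1
    \<and> G1 T = n + nscale q u - nscale (q - 1) (grlex_succ k) - G2 S}"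

end

theory Submission
  imports Defs "HOL-Computational_Algebra.Polynomial_FPS" "HOL-Computational_Algebra.Polynomial_Factorial"
begin

text \<open>
  Let \<open>g\<close> be the lowest exponent of \<open>\<partial>P/\<partial>y(x, y\<^sub>0)\<close>, with coefficient \<open>\<omega>\<close>. Expanding \<open>P\<close> around \<open>y\<^sub>0\<close>
  shows that \<open>i\<^sub>k = g + S(k)\<close> and \<open>\<pi>\<^sub>k(y) = \<omega> (y - c\<^bsub>S(k)\<^esub>)\<close> as soon as \<open>S(k) > g\<close>, and that \<open>\<omega>\<^sub>0 = \<omega>\<close>.
  The bound on \<open>|k|\<close> enforces \<open>S(k) > g\<close>: after a monomial substitution \<open>x\<^sub>i = t\<^bsup>w\<^sub>i\<^esup>\<close> with nearly
  equal weights, eliminating \<open>y\<close> between \<open>\<partial>P/\<partial>y\<close> and the minimal polynomial of \<open>y\<^sub>0\<close> yields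
  \<open>|g| \<le> 2 d\<^sub>x d\<^sub>y\<close>. Then \<open>Q\<close> has only exponents \<open>> 0\<close>, the tail of \<open>y\<^sub>0\<close> solves \<open>y = Q(x, y)\<close>, and
  Lagrange inversion expresses its coefficients by those of \<open>Q\<^sup>q\<close>; the formula results from expanding
  \<open>Q\<^sup>q\<close> with the multinomial theorem and grouping the terms.
\<close>

section \<open>Multi-indices and the graded lexicographic order\<close>

text \<open>The constant 2 d_x d_y is the size of a resultant: for two polynomials of degree at most
  d in t and e in y, eliminating y leaves a polynomial of degree at most 2 d e in t. P itself may
  share a factor with its derivative although y_0 is a simple root. The minimal polynomial of y_0
  divides P, so it obeys the same degree bounds, and no nonzero polynomial of smaller y-degree
  vanishes at y_0, so the elimination cannot degenerate. In the weights
  \<open>\<Lambda> + \<epsilon> c\<close>, the perturbation \<open>\<epsilon>\<close> singles out g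
  among the exponents of the derivative, so that its term does not cancel. A large
  \<open>\<Lambda>\<close> makes d about \<open>\<Lambda>\<close> d_x, and division by
  \<open>\<Lambda>\<close> recovers the bound on |g| up to an error below 1. The second obstacle is
  that the exponents of Q, though > 0 for grlex, may have negative coordinates, so Q does not live
  in a power series ring in x. Weights of the same kind, positive on these exponents, supply one
  variable t in which Lagrange inversion makes sense; the weight disappears from the final
  formula.\<close>

interpretation grlex: linorder grlex_le grlex_less
  by (rule grlex_linorder)

lemma tdeg_add: "tdeg (a + b) = tdeg a + tdeg b"
  by (simp add: tdeg_def lookup_add sum.distrib)

lemma tdeg_0 [simp]: "tdeg 0 = 0"
  by (simp add: tdeg_def)

lemma lookup_nscale: "Poly_Mapping.lookup (nscale t n) c = int t * Poly_Mapping.lookup n c"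
  by (simp add: nscale_def Poly_Mapping.map.rep_eq when_def)

lemma nscale_0 [simp]: "nscale 0 n = 0"
  by (rule poly_mapping_eqI) (simp add: lookup_nscale)

lemma nscale_zero [simp]: "nscale t 0 = 0"
  by (rule poly_mapping_eqI) (simp add: lookup_nscale)

lemma nscale_1 [simp]: "nscale (Suc 0) n = n"
  by (rule poly_mapping_eqI) (simp add: lookup_nscale)

lemma nscale_Suc: "nscale (Suc t) n = n + nscale t n"
  by (rule poly_mapping_eqI) (simp add: lookup_nscale lookup_add algebra_simps)

lemma nscale_add_left: "nscale (s + t) n = nscale s n + nscale t n"
  by (rule poly_mapping_eqI) (simp add: lookup_nscale lookup_add algebra_simps)

lemma nscale_add_right: "nscale t (m + n) = nscale t m + nscale t n"
  by (rule poly_mapping_eqI) (simp add: lookup_nscale lookup_add algebra_simps)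

lemma nscale_minus_right: "nscale t (m - n) = nscale t m - nscale t n"
  by (rule poly_mapping_eqI) (simp add: lookup_nscale lookup_minus algebra_simps)

lemma nscale_mult: "nscale (s * t) n = nscale s (nscale t n)"
  by (rule poly_mapping_eqI) (simp add: lookup_nscale)

lemma nscale_sum_left: "nscale (sum f A) n = (\<Sum>x\<in>A. nscale (f x) n)"
  by (induction A rule: infinite_finite_induct) (simp_all add: nscale_add_left)

lemma tdeg_nscale: "tdeg (nscale t n) = int t * tdeg n"
  by (simp add: tdeg_def lookup_nscale sum_distrib_left)

lemma grlex_less_iff: "grlex_less n m \<longleftrightarrow> tdeg n < tdeg m \<or> tdeg n = tdeg m \<and> n < m"
  by (auto simp: grlex_less_def grlex_le_def)

lemma grlex_less_add_right [simp]: "grlex_less (a + c) (b + c) \<longleftrightarrow> grlex_less a b"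
  by (simp add: grlex_less_iff tdeg_add)

lemma grlex_less_add_left [simp]: "grlex_less (c + a) (c + b) \<longleftrightarrow> grlex_less a b"
  by (simp add: grlex_less_iff tdeg_add)

lemma grlex_le_add_right [simp]: "grlex_le (a + c) (b + c) \<longleftrightarrow> grlex_le a b"
  by (simp add: grlex_le_def tdeg_add)

lemma grlex_le_add_left [simp]: "grlex_le (c + a) (c + b) \<longleftrightarrow> grlex_le a b"
  by (simp add: grlex_le_def tdeg_add)

lemma grlex_less_diff_iff: "grlex_less a (b - c) \<longleftrightarrow> grlex_less (a + c) b"
  using grlex_less_add_right[of a c "b - c"] by simp

lemma grlex_less_diff_right [simp]: "grlex_less (a - c) (b - c) \<longleftrightarrow> grlex_less a b"
  using grlex_less_add_right[of a "- c" b] by (simp del: grlex_less_add_right)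

lemma grlex_less_diff_left [simp]: "grlex_less (a - b) (a - c) \<longleftrightarrow> grlex_less c b"
proof -
  have "grlex_less (a - b) (a - c) \<longleftrightarrow> grlex_less (a - b + (b + c - a)) (a - c + (b + c - a))"
    by (simp only: grlex_less_add_right)
  thus ?thesis by simp
qed

lemma grlex_add_mono: "grlex_le a b \<Longrightarrow> grlex_le c d \<Longrightarrow> grlex_le (a + c) (b + d)"
  by (rule grlex.order_trans[of _ "b + c"]) simp_all

lemma grlex_nscale_mono: "grlex_le a b \<Longrightarrow> grlex_le (nscale t a) (nscale t b)"
  by (induction t) (simp_all add: nscale_Suc grlex_add_mono)

lemma grlex_nscale_mono_left: "grlex_le 0 a \<Longrightarrow> s \<le> t \<Longrightarrow> grlex_le (nscale s a) (nscale t a)"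
  using grlex_add_mono[of 0 "nscale (t - s) a" "nscale s a" "nscale s a"]
        grlex_nscale_mono[of 0 a "t - s"]
  by (simp flip: nscale_add_left)

lemma tdeg_pos: "n \<noteq> 0 \<Longrightarrow> n \<in> Nr \<Longrightarrow> 0 < tdeg (n :: 'r::finite mindex)"
proof -
  assume "n \<noteq> 0" "n \<in> Nr"
  then obtain c where "0 < Poly_Mapping.lookup n c" "\<forall>c. 0 \<le> Poly_Mapping.lookup n c"
    by (metis Nr_def mem_Collect_eq order_le_less poly_mapping_eqI lookup_zero)
  thus ?thesis
    unfolding tdeg_def by (intro sum_pos2[of _ c]) auto
qed

lemma tdeg_nonneg: "n \<in> Nr \<Longrightarrow> 0 \<le> tdeg (n :: 'r::finite mindex)"
  by (auto simp: tdeg_def Nr_def intro!: sum_nonneg)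

lemma Nr_grlex_nonneg: "n \<in> Nr \<Longrightarrow> grlex_le 0 n"
  using tdeg_pos[of n] by (cases "n = 0") (auto simp: grlex_le_def)

lemma lookup_le_tdeg: "n \<in> Nr \<Longrightarrow> Poly_Mapping.lookup n c \<le> tdeg (n :: 'r::finite mindex)"
  unfolding tdeg_def by (rule member_le_sum) (auto simp: Nr_def)

lemma Nr_nscale: "n \<in> Nr \<Longrightarrow> nscale t n \<in> Nr"
  by (simp add: Nr_def lookup_nscale)

lemma Nr_sum: "(\<And>x. x \<in> A \<Longrightarrow> f x \<in> Nr) \<Longrightarrow> sum f A \<in> Nr"
  by (induction A rule: infinite_finite_induct) (auto intro: Nr_add)

lemma finite_bounded_mindex:
  "finite {n :: 'r::finite mindex. \<forall>c. lo c \<le> Poly_Mapping.lookup n c \<and> Poly_Mapping.lookup n c \<le> hi c}"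
    (is "finite ?A")
proof -
  have "Poly_Mapping.lookup ` ?A \<subseteq> Pi\<^sub>E UNIV (\<lambda>c. {lo c..hi c})"
    by (auto simp: PiE_iff)
  hence "finite (Poly_Mapping.lookup ` ?A)"
    by (rule finite_subset) (auto intro: finite_PiE)
  thus ?thesis
    by (rule finite_imageD) (auto simp: inj_on_def)
qed

lemma finite_Nr_tdeg_le: "finite {n :: 'r::finite mindex. n \<in> Nr \<and> tdeg n \<le> d}"
  by (rule finite_subset[OF _ finite_bounded_mindex[of "\<lambda>_. 0" "\<lambda>_. d"]])
     (auto simp: Nr_def intro: order_trans[OF lookup_le_tdeg[unfolded Nr_def]])

lemma finite_Nr_grlex_le: "finite {n \<in> Nr. grlex_le n k}"
  by (rule finite_subset[OF _ finite_Nr_tdeg_le[of "tdeg k"]]) (auto simp: grlex_le_def)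

lemma finite_idxs_upto [simp]: "finite (idxs_upto k)"
  by (rule finite_subset[OF _ finite_Nr_grlex_le[of k]]) (auto simp: idxs_upto_def)

lemma grlex_least_eqI: "x \<in> A \<Longrightarrow> (\<And>y. y \<in> A \<Longrightarrow> grlex_le x y) \<Longrightarrow> grlex_least A = x"
  unfolding grlex_least_def by (rule grlex.Least_equality) auto

lemma grlex_least_finite:
  assumes "finite A" "A \<noteq> {}"
  shows "grlex_least A \<in> A" "\<And>y. y \<in> A \<Longrightarrow> grlex_le (grlex_least A) y"
proof -
  have "\<exists>x\<in>A. \<forall>y\<in>A. grlex_le x y"
    using assms
  proof (induction rule: finite_ne_induct)
    case (insert a A)
    then obtain x where "x \<in> A" "\<forall>y\<in>A. grlex_le x y" by blast
    thus ?case by (metis grlex.order_trans grlex.linear insert_iff)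
  qed auto
  then obtain x where x: "x \<in> A" "\<And>y. y \<in> A \<Longrightarrow> grlex_le x y" by blast
  have "grlex_least A = x"
    using x by (rule grlex_least_eqI)
  with x show "grlex_least A \<in> A" "\<And>y. y \<in> A \<Longrightarrow> grlex_le (grlex_least A) y"
    by auto
qed

text \<open>Total degrees are compared first, so initial segments of N^r are finite and N^r is
  well-ordered. This makes \<open>grlex_succ\<close>, \<open>k_zero\<close> and \<open>g\<close>
  meaningful.\<close>

lemma grlex_least_Nr:
  assumes "A \<subseteq> Nr" "A \<noteq> {}"
  shows "grlex_least A \<in> A" "\<And>y. y \<in> A \<Longrightarrow> grlex_le (grlex_least A) y"
proof -
  obtain a where a: "a \<in> A" using assms by auto
  define B where "B = {n \<in> A. grlex_le n a}"
  have "finite B"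
    using assms unfolding B_def by (intro finite_subset[OF _ finite_Nr_grlex_le[of a]]) auto
  moreover have "B \<noteq> {}" using a by (auto simp: B_def)
  ultimately have *: "grlex_least B \<in> B" "\<And>y. y \<in> B \<Longrightarrow> grlex_le (grlex_least B) y"
    using grlex_least_finite[of B] by auto
  have **: "grlex_le (grlex_least B) y" if "y \<in> A" for y
  proof (cases "grlex_le y a")
    case True
    thus ?thesis using that by (intro *(2)) (auto simp: B_def)
  next
    case False
    hence "grlex_le a y" by simp
    thus ?thesis using *(1) by (auto simp: B_def)
  qed
  have "grlex_least A = grlex_least B"
    using *(1) ** by (intro grlex_least_eqI) (auto simp: B_def)
  thus "grlex_least A \<in> A" "\<And>y. y \<in> A \<Longrightarrow> grlex_le (grlex_least A) y"
    using *(1) ** by (auto simp: B_def)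
qed

lemma tdeg_single: "tdeg (Poly_Mapping.single c v) = v"
  by (simp add: tdeg_def lookup_single when_def)

lemma grlex_succ:
  fixes k :: "'r::{finite,linorder} mindex"
  assumes "k \<in> Nr"
  shows "grlex_succ k \<in> Nr" "grlex_less k (grlex_succ k)"
    and "\<And>m. m \<in> Nr \<Longrightarrow> grlex_less k m \<Longrightarrow> grlex_le (grlex_succ k) m"
proof -
  have "e_last \<in> (Nr :: 'r mindex set)"
    by (auto simp: Nr_def e_last_def lookup_single when_def)
  hence "k + e_last \<in> {m \<in> Nr. grlex_less k m}"
    using assms by (auto intro!: Nr_add simp: grlex_less_iff tdeg_add e_last_def tdeg_single)
  hence ne: "{m \<in> Nr. grlex_less k m} \<noteq> {}" by blast
  show "grlex_succ k \<in> Nr" "grlex_less k (grlex_succ k)"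
    using grlex_least_Nr(1)[OF _ ne] unfolding grlex_succ_def by auto
  show "grlex_le (grlex_succ k) m" if "m \<in> Nr" "grlex_less k m" for m
    using grlex_least_Nr(2)[OF _ ne] that unfolding grlex_succ_def by auto
qed

lemma grlex_succ_le_iff:
  assumes "k \<in> Nr" "m \<in> Nr"
  shows "grlex_le (grlex_succ k) m \<longleftrightarrow> grlex_less k m"
  using grlex_succ[OF assms(1)] assms(2) by (meson grlex.less_le_trans)

lemma tdeg_grlex_succ: "k \<in> Nr \<Longrightarrow> tdeg k \<le> tdeg (grlex_succ k)"
  using grlex_succ(2)[of k] by (auto simp: grlex_less_iff)

lemma idxs_upto_subset_Nr: "idxs_upto k \<subseteq> Nr"
  by (auto simp: idxs_upto_def)


section \<open>Leading coefficients and change of the expansion point\<close>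

text \<open>The value \<open>v\<close> = 0 is allowed, so the predicate survives cancellation and is
  closed under sums at a fixed \<open>h\<close>. Also \<open>h\<close> may lie outside N^r, which
  forces \<open>v\<close> = 0.\<close>

definition mlead :: "('r::{finite,linorder}, 'k::zero) mfps \<Rightarrow> 'r mindex \<Rightarrow> 'k \<Rightarrow> bool" where
  "mlead f h v \<longleftrightarrow> (\<forall>n. grlex_less n h \<longrightarrow> mfps_nth f n = 0) \<and> mfps_nth f h = v"

lemma mfps_nth_outside: "n \<notin> Nr \<Longrightarrow> mfps_nth f n = 0"
  using mfps_nth[of f] by auto

lemma mfps_nth_add [simp]: "mfps_nth (f + g) n = mfps_nth f n + mfps_nth g n"
  by transfer simp

lemma mfps_nth_diff [simp]: "mfps_nth (f - g) n = mfps_nth f n - mfps_nth g n"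
  by transfer simp

lemma mfps_nth_uminus [simp]: "mfps_nth (- f) n = - mfps_nth f n"
  by transfer simp

lemma mfps_nth_0 [simp]: "mfps_nth 0 n = 0"
  by transfer simp

lemma mfps_nth_mult: "mfps_nth (f * g) n = (\<Sum>i\<in>mfps_splits n. mfps_nth f i * mfps_nth g (n - i))"
  by transfer simp

lemma mlead_add: "mlead f h v \<Longrightarrow> mlead g h w \<Longrightarrow> mlead (f + g) h (v + w)"
  by (simp add: mlead_def)

lemma mlead_uminus: "mlead f h v \<Longrightarrow> mlead (- f) h (- v)"
  by (simp add: mlead_def)

lemma mlead_0: "mlead 0 h 0"
  by (simp add: mlead_def)

lemma mlead_unique: "mlead f h v \<Longrightarrow> mlead f h w \<Longrightarrow> v = w"
  by (simp add: mlead_def)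

lemma mlead_0_iff: "mlead 0 h v \<longleftrightarrow> v = 0"
  by (auto simp: mlead_def)

text \<open>If neither i < h nor n - i < h', then n >= h + h', and equality leaves only i = h. So a
  single product can contribute at h + h', and none below.\<close>

lemma mlead_mult:
  assumes f: "mlead f h v" and g: "mlead g h' v'"
  shows "mlead (f * g) (h + h') (v * v')"
proof -
  have zero: "mfps_nth f i * mfps_nth g (n - i) = 0"
    if "grlex_less n (h + h') \<or> n = h + h' \<and> i \<noteq> h" for n i
  proof -
    have "grlex_less i h \<or> grlex_less (n - i) h'"
    proof (rule ccontr)
      assume "\<not> ?thesis"
      hence 1: "grlex_le h i" "grlex_le h' (n - i)" by auto
      hence 2: "grlex_le (h + h') (i + (n - i))" by (rule grlex_add_mono)
      hence "n = h + h'" "i \<noteq> h" using that by auto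
      hence "grlex_less h i" using 1 by (auto simp: grlex_less_def)
      hence "grlex_less (h + (n - i)) (i + (n - i))" by (simp only: grlex_less_add_right)
      moreover have "grlex_le (h + h') (h + (n - i))" using 1 by (simp only: grlex_le_add_left)
      ultimately have "grlex_less (h + h') (i + (n - i))" using grlex.le_less_trans by blast
      thus False using \<open>n = h + h'\<close> by simp
    qed
    thus ?thesis using f g by (auto simp: mlead_def)
  qed
  have "mfps_nth (f * g) n = 0" if "grlex_less n (h + h')" for n
    unfolding mfps_nth_mult by (rule sum.neutral) (use that zero in blast)
  moreover have "mfps_nth (f * g) (h + h') = v * v'"
  proof (cases "h \<in> mfps_splits (h + h')")
    case True
    have "mfps_nth (f * g) (h + h') = (\<Sum>i\<in>{h}. mfps_nth f i * mfps_nth g (h + h' - i))"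
      unfolding mfps_nth_mult using True
      by (intro sum.mono_neutral_right) (use zero in auto)
    thus ?thesis using f g by (simp add: mlead_def)
  next
    case False
    have "mfps_nth (f * g) (h + h') = 0"
      unfolding mfps_nth_mult
    proof (rule sum.neutral, rule ballI)
      fix i assume "i \<in> mfps_splits (h + h')"
      with False have "i \<noteq> h" by auto
      thus "mfps_nth f i * mfps_nth g (h + h' - i) = 0" by (intro zero) auto
    qed
    \<comment> \<open>Here \<open>h\<close> or \<open>h'\<close> lies outside N^r, where all
      coefficients are 0.\<close>
    moreover have "v * v' = 0"
      using False f g mfps_nth_outside[of h f] mfps_nth_outside[of h' g]
      by (auto simp: mfps_splits_def mlead_def)
    ultimately show ?thesis by simp
  qed
  ultimately show ?thesis by (simp add: mlead_def)
qed

text \<open>That is, \<open>F(x, x\<^sup>\<sigma> y)\<close> has lowest exponent \<open>h\<close> with coefficient \<open>\<pi>(y)\<close>; dividing the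
  \<open>m\<close>-th coefficient by \<open>x\<^bsup>m\<sigma>\<^esup>\<close> keeps everything inside \<open>K[[x]]\<close>, so that \<open>h - m\<sigma>\<close> may leave
  \<open>\<nat>\<^sup>r\<close>.\<close>

definition plead ::
  "('r::{finite,linorder}, 'k::comm_ring_1) mfps poly \<Rightarrow> 'r mindex \<Rightarrow> 'r mindex \<Rightarrow> 'k poly \<Rightarrow> bool" where
  "plead F \<sigma> h \<pi> \<longleftrightarrow> (\<forall>m. mlead (coeff F m) (h - nscale m \<sigma>) (coeff \<pi> m))"

text \<open>After y is replaced by x^\<open>\<sigma>\<close> y, adding \<open>d\<close> to the old
  variable adds \<open>d\<close> / x^\<open>\<sigma>\<close>, with lowest coefficient
  \<open>\<gamma>\<close>, to the new one; hence y becomes y + \<open>\<gamma>\<close> in the lowest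
  part. The induction is Horner's scheme, each factor lowering the exponent by
  \<open>\<sigma>\<close>.\<close>

lemma plead_shift:
  assumes "plead F \<sigma> h \<pi>" "mlead d \<sigma> \<gamma>"
  shows "plead (pcompose F [:d, 1:]) \<sigma> h (pcompose \<pi> [:\<gamma>, 1:])"
  using assms(1)
proof (induction F arbitrary: h \<pi>)
  case 0
  hence "coeff \<pi> m = 0" for m by (auto simp: plead_def mlead_0_iff)
  hence "\<pi> = 0" by (simp add: poly_eq_iff)
  thus ?case by (simp add: plead_def mlead_0)
next
  case (pCons f G)
  obtain p0 \<pi>' where \<pi>: "\<pi> = pCons p0 \<pi>'" by (cases \<pi>)
  have f: "mlead f h p0"
    using pCons.prems[unfolded plead_def, rule_format, of 0] by (simp add: \<pi>)
  have "plead G \<sigma> (h - \<sigma>) \<pi>'"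
    unfolding plead_def
  proof
    fix m
    show "mlead (coeff G m) (h - \<sigma> - nscale m \<sigma>) (coeff \<pi>' m)"
      using pCons.prems[unfolded plead_def, rule_format, of "Suc m"]
      by (simp add: \<pi> nscale_Suc diff_diff_eq)
  qed
  note IH = pCons.IH[OF this, unfolded plead_def, rule_format]
  define X where "X = pcompose G [:d, 1:]"
  define \<xi> where "\<xi> = pcompose \<pi>' [:\<gamma>, 1:]"
  have X: "mlead (coeff X m) (h - \<sigma> - nscale m \<sigma>) (coeff \<xi> m)" for m
    using IH unfolding X_def \<xi>_def .
  have dX: "mlead (d * coeff X m) (h - nscale m \<sigma>) (\<gamma> * coeff \<xi> m)" for m
    using mlead_mult[OF assms(2) X[of m]] by (simp add: algebra_simps)
  show ?case
    unfolding plead_def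
  proof
    fix m
    show "mlead (coeff (pcompose (pCons f G) [:d, 1:]) m) (h - nscale m \<sigma>)
            (coeff (pcompose \<pi> [:\<gamma>, 1:]) m)"
    proof (cases m)
      case 0
      thus ?thesis
        using mlead_add[OF f dX[of 0, simplified]]
        by (simp add: \<pi> pcompose_pCons X_def [symmetric] \<xi>_def [symmetric])
    next
      case (Suc m')
      have "mlead (coeff X m') (h - nscale m \<sigma>) (coeff \<xi> m')"
        using X[of m'] by (simp add: Suc nscale_Suc diff_diff_eq)
      from mlead_add[OF dX[of m] this] show ?thesis
        by (simp add: \<pi> pcompose_pCons X_def [symmetric] \<xi>_def [symmetric] Suc)
    qed
  qed
qed

section \<open>Laurent polynomials as power series\<close>

lemma lookup_mult_sum:
  fixes f g :: "'r mindex \<Rightarrow>\<^sub>0 'k::comm_ring_1"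
  assumes "finite A" "Poly_Mapping.keys f \<subseteq> A"
  shows "Poly_Mapping.lookup (f * g) n = (\<Sum>i\<in>A. Poly_Mapping.lookup f i * Poly_Mapping.lookup g (n - i))"
proof -
  have "(\<Sum>q. Poly_Mapping.lookup g q when n = l + q) = Poly_Mapping.lookup g (n - l)" for l
  proof -
    have "(\<lambda>q. Poly_Mapping.lookup g q when n = l + q) = (\<lambda>q. Poly_Mapping.lookup g q when q = n - l)"
      by (auto simp: when_def fun_eq_iff)
    thus ?thesis by (simp only: Sum_any_when_equal)
  qed
  hence "Poly_Mapping.lookup (f * g) n = (\<Sum>l. Poly_Mapping.lookup f l * Poly_Mapping.lookup g (n - l))"
    by (simp add: lookup_mult)
  also have "\<dots> = (\<Sum>i\<in>A. Poly_Mapping.lookup f i * Poly_Mapping.lookup g (n - i))"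
    using assms by (intro Sum_any.expand_superset) (auto simp: keys.rep_eq)
  finally show ?thesis .
qed

lemma lookup_xmon_mult:
  "Poly_Mapping.lookup (xmon s v * (f :: 'r mindex \<Rightarrow>\<^sub>0 'k::comm_ring_1)) n = v * Poly_Mapping.lookup f (n - s)"
  by (subst lookup_mult_sum[of "{s}"]) (auto simp: xmon_def)

lemma mfps_nth_of_xpoly:
  "a \<in> xpolys \<Longrightarrow> mfps_nth (mfps_of_xpoly a) n = Poly_Mapping.lookup a n"
  by transfer (auto simp: xpolys_def in_keys_iff)

lemma mfps_of_xpoly_0 [simp]: "mfps_of_xpoly 0 = 0"
  by transfer (simp add: fun_eq_iff)

lemma mfps_of_xpoly_add: "mfps_of_xpoly (a + b) = mfps_of_xpoly a + mfps_of_xpoly b"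
  by transfer (simp add: fun_eq_iff lookup_add)

text \<open>Horner step for \<open>lookup_coeff_pcompose\<close>: \<open>X\<close> is x^t F read as
  a Laurent polynomial.\<close>

lemma lookup_xpoly_mult_shift:
  fixes z X :: "'r::finite mindex \<Rightarrow>\<^sub>0 'k::comm_ring_1"
  assumes z: "z \<in> xpolys" and X: "\<And>n. Poly_Mapping.lookup X n = mfps_nth F (n - t)"
  shows "Poly_Mapping.lookup (z * X) n = mfps_nth (mfps_of_xpoly z * F) (n - t)"
proof -
  let ?A = "Poly_Mapping.keys z \<union> mfps_splits (n - t)"
  have "Poly_Mapping.lookup (z * X) n = (\<Sum>i\<in>?A. Poly_Mapping.lookup z i * Poly_Mapping.lookup X (n - i))"
    by (rule lookup_mult_sum) auto
  also have "\<dots> = (\<Sum>i\<in>?A. mfps_nth (mfps_of_xpoly z) i * mfps_nth F (n - t - i))"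
    by (simp add: X mfps_nth_of_xpoly[OF z] algebra_simps)
  also have "\<dots> = (\<Sum>i\<in>mfps_splits (n - t). mfps_nth (mfps_of_xpoly z) i * mfps_nth F (n - t - i))"
  proof (rule sum.mono_neutral_right)
    show "\<forall>i\<in>?A - mfps_splits (n - t). mfps_nth (mfps_of_xpoly z) i * mfps_nth F (n - t - i) = 0"
    proof
      fix i assume "i \<in> ?A - mfps_splits (n - t)"
      hence "i \<notin> Nr \<or> n - t - i \<notin> Nr" by (auto simp: mfps_splits_def)
      thus "mfps_nth (mfps_of_xpoly z) i * mfps_nth F (n - t - i) = 0"
        using mfps_nth_outside by (metis mult_zero_left mult_zero_right)
    qed
  qed auto
  finally show ?thesis by (simp add: mfps_nth_mult)
qed

text \<open>Bridge between the Laurent polynomials of the definitions and power series: the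
  y^m-coefficient of P(x, z + x^s y) is x^(ms) times that of P(x, z + y), and the latter lies in
  K[[x]].\<close>

lemma lookup_coeff_pcompose:
  fixes P :: "('r::finite mindex \<Rightarrow>\<^sub>0 'k::comm_ring_1) poly"
  assumes "\<And>j. coeff P j \<in> xpolys" "z \<in> xpolys"
  shows "Poly_Mapping.lookup (coeff (pcompose P [:z, xmon s 1:]) m) n =
           mfps_nth (coeff (pcompose (map_poly mfps_of_xpoly P) [:mfps_of_xpoly z, 1:]) m)
             (n - nscale m s)"
  using assms(1)
proof (induction P arbitrary: m n)
  case 0
  thus ?case by simp
next
  case (pCons a P)
  have a: "a \<in> xpolys" using pCons.prems[of 0] by simp
  have P: "coeff P j \<in> xpolys" for j using pCons.prems[of "Suc j"] by simp
  define X where "X = pcompose P [:z, xmon s 1:]"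
  define F where "F = pcompose (map_poly mfps_of_xpoly P) [:mfps_of_xpoly z, 1:]"
  have IH: "Poly_Mapping.lookup (coeff X m) n = mfps_nth (coeff F m) (n - nscale m s)" for m n
    using pCons.IH[OF P] by (simp add: X_def F_def)
  note zX = lookup_xpoly_mult_shift[OF assms(2) IH]
  have sX: "Poly_Mapping.lookup (xmon s 1 * coeff X m) n = mfps_nth (coeff F m) (n - nscale (Suc m) s)" for m
    by (simp add: lookup_xmon_mult IH nscale_Suc algebra_simps)
  show ?case
    using pCons.hyps
    by (cases m)
       (simp_all add: map_poly_pCons pcompose_pCons X_def [symmetric] F_def [symmetric]
          lookup_add zX sX mfps_nth_of_xpoly[OF a])
qed

lemma wy_props:
  assumes "Q \<noteq> 0"
  shows "grlex_less n (wy Q) \<Longrightarrow> Poly_Mapping.lookup (coeff Q m) n = 0"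
    and "\<exists>m. Poly_Mapping.lookup (coeff Q m) (wy Q) \<noteq> 0"
proof -
  have wx: "wx a \<in> Poly_Mapping.keys a" "\<And>y. y \<in> Poly_Mapping.keys a \<Longrightarrow> grlex_le (wx a) y"
    if "a \<noteq> 0" for a :: "'a mindex \<Rightarrow>\<^sub>0 'b"
    using grlex_least_finite[of "Poly_Mapping.keys a"] that by (auto simp: wx_def)
  let ?A = "{wx (coeff Q j) |j. coeff Q j \<noteq> 0}"
  have "?A \<subseteq> (\<lambda>j. wx (coeff Q j)) ` {..degree Q}"
    by (auto intro!: le_degree)
  hence "finite ?A" by (rule finite_subset) auto
  moreover have "?A \<noteq> {}" using assms by (auto simp: poly_eq_iff)
  ultimately have A: "wy Q \<in> ?A" "\<And>y. y \<in> ?A \<Longrightarrow> grlex_le (wy Q) y"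
    using grlex_least_finite[of ?A] unfolding wy_def by auto
  show "\<exists>m. Poly_Mapping.lookup (coeff Q m) (wy Q) \<noteq> 0"
  proof -
    obtain j where "wy Q = wx (coeff Q j)" "coeff Q j \<noteq> 0" using A(1) by blast
    thus ?thesis using wx(1)[of "coeff Q j"] by (auto simp: in_keys_iff)
  qed
  show "Poly_Mapping.lookup (coeff Q m) n = 0" if "grlex_less n (wy Q)"
  proof (rule ccontr)
    assume *: "Poly_Mapping.lookup (coeff Q m) n \<noteq> 0"
    hence nz: "coeff Q m \<noteq> 0" by auto
    hence "grlex_le (wy Q) (wx (coeff Q m))" by (intro A(2)) auto
    moreover have "grlex_le (wx (coeff Q m)) n" using * nz by (intro wx(2)) (auto simp: in_keys_iff)
    ultimately show False using that by (meson grlex.not_less grlex.order_trans)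
  qed
qed

lemma wy_eqI:
  assumes "\<And>m n. grlex_less n h \<Longrightarrow> Poly_Mapping.lookup (coeff Q m) n = 0"
    and "Poly_Mapping.lookup (coeff Q m) h \<noteq> 0"
  shows "wy Q = h"
proof -
  have "Q \<noteq> 0" using assms(2) by auto
  from wy_props[OF this] show ?thesis
    using assms by (metis grlex.less_linear)
qed

lemma map_poly_mfps_of_xpoly_add:
  "map_poly mfps_of_xpoly (p + q) = map_poly mfps_of_xpoly p + map_poly mfps_of_xpoly q"
  by (intro poly_eqI) (simp add: coeff_map_poly mfps_of_xpoly_add)

lemma coeff_Suc_0_pcompose_linear:
  fixes P :: "('r::{finite,linorder} mindex \<Rightarrow>\<^sub>0 'k::idom) poly"
  shows "coeff (pcompose (map_poly mfps_of_xpoly P) [:f, 1:]) (Suc 0) = eval_y (pderiv P) f"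
proof (induction P)
  case (pCons a P)
  thus ?case
    by (simp add: map_poly_pCons pcompose_pCons pcompose_coeff_0 eval_y_def pderiv_pCons
          map_poly_mfps_of_xpoly_add)
qed (simp add: eval_y_def)


section \<open>The lowest exponent of the polynomials attached to a simple root\<close>

lemma xmon_in_xpolys: "n \<in> Nr \<Longrightarrow> xmon n v \<in> xpolys"
  by (auto simp: xmon_def xpolys_def)

lemma sum_in_xpolys: "(\<And>x. x \<in> A \<Longrightarrow> f x \<in> xpolys) \<Longrightarrow> sum f A \<in> xpolys"
  using keys_sum[of f A] unfolding xpolys_def by blast

lemma zpart_in_xpolys: "zpart f k \<in> xpolys"
  unfolding zpart_def by (intro sum_in_xpolys xmon_in_xpolys) (use idxs_upto_subset_Nr in auto)

lemma lookup_zpart: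
  "Poly_Mapping.lookup (zpart f k) n = (if n \<in> idxs_upto k then mfps_nth f n else 0)"
  by (simp add: zpart_def lookup_sum xmon_def lookup_single when_def sum.delta)

locale simple_root_expansion =
  fixes P :: "('r::{finite,linorder} mindex \<Rightarrow>\<^sub>0 'k::field_char_0) poly"
    and y0 :: "('r, 'k) mfps"
  assumes coeff_P: "\<And>j. coeff P j \<in> xpolys"
    and y0_ge: "\<And>m. \<not> grlex_le e_last m \<Longrightarrow> mfps_nth y0 m = 0"
    and root: "simple_root P y0"
begin

text \<open>The Taylor expansion of P at \<open>f\<close> in the variable y. Its first two
  coefficients at y_0 are 0 and the y-derivative of P at y_0.\<close>

definition expn :: "('r, 'k) mfps \<Rightarrow> ('r, 'k) mfps poly" where
  "expn f = pcompose (map_poly mfps_of_xpoly P) [:f, 1:]"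

abbreviation z where "z k \<equiv> mfps_of_xpoly (zpart y0 k)"

lemma pcompose_expn: "pcompose (expn g) [:d, 1:] = expn (g + d)"
  by (simp add: expn_def pcompose_assoc [symmetric] pcompose_pCons add.commute)

lemma coeff_at_root_0 [simp]: "coeff (expn y0) 0 = 0"
  using root by (simp add: expn_def pcompose_coeff_0 simple_root_def eval_y_def)

lemma coeff_at_root_1: "coeff (expn y0) (Suc 0) = eval_y (pderiv P) y0"
  by (simp add: expn_def coeff_Suc_0_pcompose_linear)

definition g where "g = grlex_least {n. mfps_nth (eval_y (pderiv P) y0) n \<noteq> 0}"

definition \<omega> where "\<omega> = mfps_nth (eval_y (pderiv P) y0) g"

lemma mlead_pderiv: "mlead (eval_y (pderiv P) y0) g \<omega>"
  and \<omega>_nonzero: "\<omega> \<noteq> 0"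
  and g_Nr: "g \<in> Nr"
proof -
  let ?A = "{n. mfps_nth (eval_y (pderiv P) y0) n \<noteq> 0}"
  have sub: "?A \<subseteq> Nr" using mfps_nth_outside by blast
  have "?A \<noteq> {}"
  proof
    assume "?A = {}"
    hence "eval_y (pderiv P) y0 = 0" by (intro mfps_eqI) auto
    thus False using root by (simp add: simple_root_def)
  qed
  note * = grlex_least_Nr[OF sub this]
  show "\<omega> \<noteq> 0" "g \<in> Nr"
    using *(1) sub by (auto simp: \<omega>_def g_def)
  show "mlead (eval_y (pderiv P) y0) g \<omega>"
    using *(2) unfolding mlead_def g_def [symmetric] \<omega>_def
    by (metis (mono_tags, lifting) grlex.not_less mem_Collect_eq)
qed

lemma mfps_nth_z: "mfps_nth (z k) n = (if n \<in> idxs_upto k then mfps_nth y0 n else 0)"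
  by (simp add: mfps_nth_of_xpoly[OF zpart_in_xpolys] lookup_zpart)

lemma mfps_nth_diff_z:
  "mfps_nth (y0 - z k) n = (if grlex_le n k then 0 else mfps_nth y0 n)"
  using y0_ge[of n] mfps_nth_outside[of n y0] by (auto simp: mfps_nth_z idxs_upto_def)

lemma mlead_diff_z:
  assumes "k \<in> Nr"
  shows "mlead (y0 - z k) (grlex_succ k) (mfps_nth y0 (grlex_succ k))"
proof -
  have "grlex_le n k" if "n \<in> Nr" "grlex_less n (grlex_succ k)" for n
    using grlex_succ(3)[OF assms, of n] that by force
  hence "mfps_nth (y0 - z k) n = 0" if "grlex_less n (grlex_succ k)" for n
    using that mfps_nth_outside[of n] by (auto simp: mfps_nth_diff_z simp del: mfps_nth_diff)
  thus ?thesis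
    using grlex_succ(2)[OF assms]
    by (auto simp: mlead_def mfps_nth_diff_z simp del: mfps_nth_diff)
qed

text \<open>Used at S(k): between y_0 and z_{S(k)} nothing changes at order S(k), so the lowest part
  is translated by 0.\<close>

lemma mlead_diff_z_self: "mlead (y0 - z k) k 0"
  by (auto simp: mlead_def mfps_nth_diff_z simp del: mfps_nth_diff)

lemma lookup_coeff_P_sub:
  "Poly_Mapping.lookup (coeff (P_sub P y0 k) m) n = mfps_nth (coeff (expn (z k)) m) (n - nscale m (grlex_succ k))"
  unfolding P_sub_def expn_def by (rule lookup_coeff_pcompose) (rule coeff_P zpart_in_xpolys)+

lemma coeff_piP: "coeff (piP P y0 k i) m = Poly_Mapping.lookup (coeff (P_sub P y0 k) m) i"
  by (simp add: piP_def coeff_map_poly)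

text \<open>A translate of the expansion at y_0, whose linear coefficient is nonzero because the
  root is simple.\<close>

lemma P_sub_nonzero: "P_sub P y0 k \<noteq> 0"
proof
  assume *: "P_sub P y0 k = 0"
  have "expn (z k) = 0"
  proof (intro poly_eqI mfps_eqI)
    fix m n
    show "mfps_nth (coeff (expn (z k)) m) n = mfps_nth (coeff 0 m) n"
      using lookup_coeff_P_sub[of k m "n + nscale m (grlex_succ k)"] * by simp
  qed
  hence "expn y0 = 0" using pcompose_expn[of "z k" "y0 - z k"] by simp
  thus False using coeff_at_root_1 root by (simp add: simple_root_def)
qed

lemma plead_i_sub:
  "plead (expn (z k)) (grlex_succ k) (i_sub P y0 k) (piP P y0 k (i_sub P y0 k))"
  unfolding plead_def mlead_def
proof (intro allI conjI impI)
  fix m n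
  assume "grlex_less n (i_sub P y0 k - nscale m (grlex_succ k))"
  hence "grlex_less (n + nscale m (grlex_succ k)) (wy (P_sub P y0 k))"
    by (simp add: i_sub_def grlex_less_diff_iff)
  from wy_props(1)[OF P_sub_nonzero this, of m]
  show "mfps_nth (coeff (expn (z k)) m) n = 0" by (simp add: lookup_coeff_P_sub)
qed (simp add: coeff_piP lookup_coeff_P_sub)

lemma piP_nonzero: "piP P y0 k (i_sub P y0 k) \<noteq> 0"
  using wy_props(2)[OF P_sub_nonzero, of k] coeff_piP[of k "i_sub P y0 k"]
  by (auto simp: i_sub_def)

lemma i_sub_eqI:
  assumes "plead (expn (z k)) (grlex_succ k) h \<pi>" "\<pi> \<noteq> 0"
  shows "i_sub P y0 k = h"
proof -
  obtain m where m: "coeff \<pi> m \<noteq> 0" using assms(2) by (auto simp: poly_eq_iff)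
  show ?thesis
    unfolding i_sub_def
  proof (rule wy_eqI)
    show "Poly_Mapping.lookup (coeff (P_sub P y0 k) m) n = 0" if "grlex_less n h" for m n
      using assms(1) that
      by (simp add: lookup_coeff_P_sub plead_def mlead_def)
    show "Poly_Mapping.lookup (coeff (P_sub P y0 k) m) h \<noteq> 0"
      using assms(1) m by (auto simp: lookup_coeff_P_sub plead_def mlead_def)
  qed
qed

section \<open>Lowest parts of the expansion at the root, and the value of omega_0\<close>

lemma plead_at_root:
  assumes "k \<in> Nr"
  shows "plead (expn y0) (grlex_succ k) (i_sub P y0 k)
           (pcompose (piP P y0 k (i_sub P y0 k)) [:mfps_nth y0 (grlex_succ k), 1:])"
  using plead_shift[OF plead_i_sub mlead_diff_z[OF assms]] by (simp add: pcompose_expn)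

lemma poly_piP_root:
  assumes "k \<in> Nr"
  shows "poly (piP P y0 k (i_sub P y0 k)) (mfps_nth y0 (grlex_succ k)) = 0"
  using plead_at_root[OF assms, unfolded plead_def, rule_format, of 0]
  by (simp add: mlead_0_iff pcompose_coeff_0)

lemma coeff_Suc_0_pcompose: "coeff (pcompose p [:c, 1:]) (Suc 0) = poly (pderiv p) (c :: 'k)"
  by (induction p) (simp_all add: pcompose_pCons pderiv_pCons pcompose_coeff_0)

text \<open>The linear coefficient of \<open>plead_at_root\<close>. It ties the derivative that
  defines omega_0 to the lowest term of the y-derivative of P at y_0.\<close>

lemma mlead_pderiv_i_sub:
  assumes "k \<in> Nr"
  shows "mlead (eval_y (pderiv P) y0) (i_sub P y0 k - grlex_succ k)
           (poly (pderiv (piP P y0 k (i_sub P y0 k))) (mfps_nth y0 (grlex_succ k)))"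
  using plead_at_root[OF assms, unfolded plead_def, rule_format, of "Suc 0"]
  by (simp add: coeff_at_root_1 coeff_Suc_0_pcompose)

text \<open>The constant coefficient vanishes and the linear one starts at g. For m >= 2 the
  exponent g + \<open>\<sigma>\<close> - m \<open>\<sigma>\<close> is < 0, below all of N^r.\<close>

lemma plead_at_root_large:
  assumes "grlex_less g \<sigma>"
  shows "plead (expn y0) \<sigma> (g + \<sigma>) [:0, \<omega>:]"
  unfolding plead_def
proof
  fix m
  consider "m = 0" | "m = Suc 0" | m' where "m = Suc (Suc m')" by (metis not0_implies_Suc)
  thus "mlead (coeff (expn y0) m) (g + \<sigma> - nscale m \<sigma>) (coeff [:0, \<omega>:] m)"
  proof cases
    case 1
    thus ?thesis by (simp add: mlead_0)
  next
    case 2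
    thus ?thesis using mlead_pderiv by (simp add: coeff_at_root_1)
  next
    case 3
    have "grlex_le 0 \<sigma>" using assms Nr_grlex_nonneg[OF g_Nr] by force
    hence "grlex_le 0 (nscale m' \<sigma>)"
      using grlex_nscale_mono[of 0 \<sigma> m'] by simp
    hence "grlex_less (0 + g) (nscale m' \<sigma> + \<sigma>)"
      using grlex.le_less_trans[of "0 + g" "nscale m' \<sigma> + g" "nscale m' \<sigma> + \<sigma>"] assms
      by (simp only: grlex_le_add_right grlex_less_add_left)
    hence "grlex_less (g - (nscale m' \<sigma> + \<sigma>)) (g - g)"
      by (simp only: grlex_less_diff_left add_0_left)
    hence "grlex_less (g + \<sigma> - nscale m \<sigma>) 0"
      by (simp add: 3 nscale_Suc add.commute)
    hence "mfps_nth (coeff (expn y0) m) n = 0" if "grlex_le n (g + \<sigma> - nscale m \<sigma>)" for n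
      using that Nr_grlex_nonneg[of n] mfps_nth_outside[of n] by force
    thus ?thesis using 3 by (auto simp: mlead_def)
  qed
qed

lemma plead_at_z_large:
  assumes "k \<in> Nr" "grlex_less g (grlex_succ k)"
  shows "plead (expn (z k)) (grlex_succ k) (g + grlex_succ k)
           (pcompose [:0, \<omega>:] [:- mfps_nth y0 (grlex_succ k), 1:])"
  using plead_shift[OF plead_at_root_large[OF assms(2)] mlead_uminus[OF mlead_diff_z[OF assms(1)]]]
  by (simp add: pcompose_expn)

lemma i_sub_large:
  assumes "k \<in> Nr" "grlex_less g (grlex_succ k)"
  shows "i_sub P y0 k = g + grlex_succ k"
proof (rule i_sub_eqI[OF plead_at_z_large[OF assms]])
  show "pcompose [:0, \<omega>:] [:- mfps_nth y0 (grlex_succ k), 1:] \<noteq> 0"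
    using \<omega>_nonzero by (simp add: pcompose_pCons)
qed

text \<open>The expansion point is z_{S(k)}, but y is still scaled by x^S(k) and not by the next
  monomial: this is P_k(x, y + c_{S(k)}), the polynomial from which Q is built.\<close>

lemma plead_at_z_succ_large:
  assumes "grlex_less g (grlex_succ k)"
  shows "plead (expn (z (grlex_succ k))) (grlex_succ k) (g + grlex_succ k) [:0, \<omega>:]"
  using plead_shift[OF plead_at_root_large[OF assms] mlead_uminus[OF mlead_diff_z_self]]
  by (simp add: pcompose_expn)

text \<open>At an index as in the definition of \<open>k\<^sub>0\<close>, a multiple root of \<open>\<pi>\<close> would make the next
  \<open>\<pi>\<close> a nonzero constant, although it has a root.\<close>

lemma pderiv_piP_nonzero:
  assumes k: "k \<in> Nr"
    and rel: "i_sub P y0 (grlex_succ k) = i_sub P y0 k - grlex_succ k + grlex_succ (grlex_succ k)"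
  shows "poly (pderiv (piP P y0 k (i_sub P y0 k))) (mfps_nth y0 (grlex_succ k)) \<noteq> 0"
proof
  assume zero: "poly (pderiv (piP P y0 k (i_sub P y0 k))) (mfps_nth y0 (grlex_succ k)) = 0"
  define \<sigma> where "\<sigma> = grlex_succ k"
  define \<tau> where "\<tau> = grlex_succ \<sigma>"
  define \<rho> where "\<rho> = pcompose (piP P y0 k (i_sub P y0 k)) [:mfps_nth y0 \<sigma>, 1:]"
  have \<sigma>: "\<sigma> \<in> Nr" "grlex_less \<sigma> \<tau>"
    using grlex_succ(1)[OF k] grlex_succ(2)[of \<sigma>] by (auto simp: \<sigma>_def \<tau>_def)
  have "z \<sigma> - z k = (y0 - z k) - (y0 - z \<sigma>)" by simp
  moreover have "mlead ((y0 - z k) + - (y0 - z \<sigma>)) \<sigma> (mfps_nth y0 \<sigma> + - 0)"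
    unfolding \<sigma>_def by (intro mlead_add mlead_uminus mlead_diff_z mlead_diff_z_self k)
  ultimately have "mlead (z \<sigma> - z k) \<sigma> (mfps_nth y0 \<sigma>)" by simp
  from plead_shift[OF plead_i_sub[of k, folded \<sigma>_def] this]
  have \<rho>: "plead (expn (z \<sigma>)) \<sigma> (i_sub P y0 k) \<rho>"
    by (simp add: \<rho>_def pcompose_expn)
  have "coeff \<rho> (Suc 0) = 0"
    using zero by (simp add: \<rho>_def coeff_Suc_0_pcompose \<sigma>_def)
  hence 1: "mlead (coeff (expn (z \<sigma>)) (Suc 0)) (i_sub P y0 k - \<sigma>) 0"
    using \<rho>[unfolded plead_def, rule_format, of "Suc 0"] by simp
  define \<pi> where "\<pi> = piP P y0 \<sigma> (i_sub P y0 \<sigma>)"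
  have \<pi>: "mlead (coeff (expn (z \<sigma>)) m) (i_sub P y0 k - \<sigma> + \<tau> - nscale m \<tau>) (coeff \<pi> m)" for m
    using plead_i_sub[of \<sigma>] rel unfolding plead_def \<pi>_def \<tau>_def \<sigma>_def by auto
  \<comment> \<open>For m = 1 both scalings give the exponent i_k - \<open>\<sigma>\<close>, where
    the coefficient was just shown to be 0. For m >= 2, passing from \<open>\<sigma>\<close> to the
    larger \<open>\<tau>\<close> moves the exponent below i_k - m \<open>\<sigma>\<close>, where no
    term exists.\<close>
  have "coeff \<pi> m = 0" if "m > 0" for m
  proof (cases "m = Suc 0")
    case True
    thus ?thesis using \<pi>[of m] 1 by (auto intro: mlead_unique)
  next
    case False
    with that obtain m' where m: "m = Suc (Suc m')" by (metis Suc_pred neq0_conv)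
    have "grlex_le (nscale m' \<sigma>) (nscale m' \<tau>)"
      using \<sigma>(2) by (intro grlex_nscale_mono) simp
    hence "grlex_less (nscale m' \<sigma> + \<sigma>) (nscale m' \<tau> + \<tau>)"
      using grlex.le_less_trans[of "nscale m' \<sigma> + \<sigma>" "nscale m' \<tau> + \<sigma>" "nscale m' \<tau> + \<tau>"] \<sigma>(2)
      by (simp only: grlex_le_add_right grlex_less_add_left)
    hence "grlex_less (i_sub P y0 k - \<sigma> - (nscale m' \<tau> + \<tau>)) (i_sub P y0 k - \<sigma> - (nscale m' \<sigma> + \<sigma>))"
      by (simp only: grlex_less_diff_left)
    hence "grlex_less (i_sub P y0 k - \<sigma> + \<tau> - nscale m \<tau>) (i_sub P y0 k - nscale m \<sigma>)"
      by (simp add: m nscale_Suc algebra_simps)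
    hence "mfps_nth (coeff (expn (z \<sigma>)) m) (i_sub P y0 k - \<sigma> + \<tau> - nscale m \<tau>) = 0"
      using \<rho> by (auto simp: plead_def mlead_def)
    thus ?thesis using \<pi>[of m] by (simp add: mlead_def)
  qed
  hence "\<pi> = [:coeff \<pi> 0:]"
    by (intro poly_eqI) (auto simp: coeff_pCons split: nat.splits)
  moreover have "poly \<pi> (mfps_nth y0 \<tau>) = 0"
    using poly_piP_root[OF \<sigma>(1)] by (simp add: \<pi>_def \<tau>_def)
  ultimately have "coeff \<pi> 0 = 0" by (metis poly_pCons poly_0 mult_zero_right add.right_neutral)
  with \<open>\<pi> = [:coeff \<pi> 0:]\<close> have "\<pi> = 0" by simp
  thus False using piP_nonzero[of \<sigma>] by (simp add: \<pi>_def)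
qed

text \<open>The given \<open>k\<close> satisfies the condition defining k_0, so k_0 exists. At k_0
  the derivative is nonzero and is a coefficient of the y-derivative of P at y_0 with nothing below
  it; the lowest term being unique, it is \<open>\<omega>\<close>. The relation between k_0 and g
  need not be known beforehand.\<close>

lemma omega0_eq:
  assumes "k \<in> Nr" "grlex_less g (grlex_succ k)"
  shows "omega0 P y0 = \<omega>"
proof -
  let ?A = "{k \<in> Nr. i_sub P y0 (grlex_succ k) = i_sub P y0 k - grlex_succ k + grlex_succ (grlex_succ k)}"
  have "grlex_less g (grlex_succ (grlex_succ k))"
    using assms grlex_succ[of k] grlex_succ(2)[of "grlex_succ k"] by (meson grlex.less_trans)
  hence "k \<in> ?A"
    using assms grlex_succ(1)[OF assms(1)] by (simp add: i_sub_large)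
  hence k0: "k_zero P y0 \<in> ?A"
    unfolding k_zero_def by (intro grlex_least_Nr(1)) auto
  let ?\<omega> = "omega0 P y0" and ?h = "i_sub P y0 (k_zero P y0) - grlex_succ (k_zero P y0)"
  have 1: "mlead (eval_y (pderiv P) y0) ?h ?\<omega>"
    unfolding omega0_def using k0 by (intro mlead_pderiv_i_sub) auto
  moreover have 2: "?\<omega> \<noteq> 0"
    unfolding omega0_def using k0 by (intro pderiv_piP_nonzero) auto
  ultimately have "?h = g"
    using mlead_pderiv \<omega>_nonzero unfolding mlead_def by (metis grlex.less_linear)
  thus ?thesis using 1 mlead_pderiv by (auto intro: mlead_unique)
qed

end

section \<open>The order of the derivative at a root of a polynomial over \<open>K[t]\<close>\<close>

text \<open>The counting argument behind the elimination of y. One equation is solved for a pivot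
  unknown \<open>v\<close>, which is eliminated from the others.\<close>

lemma underdetermined_system:
  fixes A :: "'e \<Rightarrow> 'u \<Rightarrow> 'k::field"
  assumes "finite E" "finite U" "card E < card U"
  shows "\<exists>x. (\<exists>u\<in>U. x u \<noteq> 0) \<and> (\<forall>e\<in>E. (\<Sum>u\<in>U. A e u * x u) = 0)"
  using assms
proof (induction E arbitrary: U A rule: finite_induct)
  case empty
  then obtain u where "u \<in> U" by (metis card_0_eq card.empty equals0I less_nat_zero_code)
  thus ?case by (intro exI[of _ "\<lambda>_. 1"]) auto
next
  case (insert e E)
  show ?case
  proof (cases "\<exists>u\<in>U. A e u \<noteq> 0")
    case False
    have "card E < card U" using insert by simp
    with insert.IH[of U A] insert.prems obtain x
      where "\<exists>u\<in>U. x u \<noteq> 0" "\<forall>e\<in>E. (\<Sum>u\<in>U. A e u * x u) = 0" by blast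
    with False show ?thesis by (intro exI[of _ x]) auto
  next
    case True
    then obtain v where v: "v \<in> U" "A e v \<noteq> 0" by blast
    let ?U = "U - {v}"
    have "card E < card ?U" using insert v by simp
    with insert.IH[of ?U "\<lambda>e' u. A e' u - A e' v / A e v * A e u"] insert.prems obtain x
      where x: "\<exists>u\<in>?U. x u \<noteq> 0"
        "\<forall>e'\<in>E. (\<Sum>u\<in>?U. (A e' u - A e' v / A e v * A e u) * x u) = 0" by blast
    define s where "s = (\<Sum>u\<in>?U. A e u * x u)"
    define y where "y = x(v := - s / A e v)"
    have y: "(\<Sum>u\<in>U. A e' u * y u) = A e' v * (- s / A e v) + (\<Sum>u\<in>?U. A e' u * x u)" for e'
    proof -
      have "(\<Sum>u\<in>U. A e' u * y u) = A e' v * y v + (\<Sum>u\<in>?U. A e' u * y u)"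
        using insert.prems v by (intro sum.remove) auto
      also have "(\<Sum>u\<in>?U. A e' u * y u) = (\<Sum>u\<in>?U. A e' u * x u)"
        by (intro sum.cong) (auto simp: y_def)
      finally show ?thesis by (simp add: y_def)
    qed
    have "(\<Sum>u\<in>U. A e u * y u) = 0"
      using v by (simp add: y s_def)
    moreover have "(\<Sum>u\<in>U. A e' u * y u) = 0" if "e' \<in> E" for e'
    proof -
      have "0 = (\<Sum>u\<in>?U. A e' u * x u) - A e' v / A e v * s"
        using x(2) that by (simp add: left_diff_distrib sum_subtractf s_def sum_distrib_left mult.assoc)
      thus ?thesis by (simp add: y)
    qed
    moreover have "\<exists>u\<in>U. y u \<noteq> 0"
      using x(1) by (auto simp: y_def)
    ultimately show ?thesis by blast
  qed
qed

section \<open>Evaluation of K[t][y] at a power series, and divisibility in K[t][y]\<close>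

lemma fps_of_poly_eq_0: "fps_of_poly p = 0 \<longleftrightarrow> p = 0"
  by (metis fps_of_poly_0 fps_of_poly_eq_iff)

definition ev_fps :: "'k::field poly poly \<Rightarrow> 'k fps \<Rightarrow> 'k fps" where
  "ev_fps F y = poly (map_poly fps_of_poly F) y"

lemma ev_fps_0 [simp]: "ev_fps 0 y = 0"
  by (simp add: ev_fps_def)

lemma ev_fps_pCons: "ev_fps (pCons a F) y = fps_of_poly a + y * ev_fps F y"
  by (cases "a = 0 \<and> F = 0") (auto simp: ev_fps_def map_poly_pCons)

lemma ev_fps_add: "ev_fps (F + G) y = ev_fps F y + ev_fps G y"
proof (induction F arbitrary: G)
  case (pCons a F)
  thus ?case by (cases G) (simp add: ev_fps_pCons fps_of_poly_add algebra_simps)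
qed simp

lemma ev_fps_smult: "ev_fps (smult c F) y = fps_of_poly c * ev_fps F y"
  by (induction F) (simp_all add: ev_fps_pCons fps_of_poly_mult algebra_simps)

lemma ev_fps_mult: "ev_fps (F * G) y = ev_fps F y * ev_fps G y"
  by (induction F) (simp_all add: ev_fps_pCons ev_fps_add ev_fps_smult algebra_simps)

text \<open>The maps \<open>map_poly (\<lambda>c. coeff c a)\<close> extract the coefficient of t^a
  as a polynomial in y; at the degree bounds these top parts multiply.\<close>

lemma coeff_coeff_mult_bound:
  fixes p q :: "'k::idom poly poly"
  assumes p: "\<And>j. degree (coeff p j) \<le> a" and q: "\<And>j. degree (coeff q j) \<le> b"
  shows "coeff (coeff (p * q) n) (a + b) =
           coeff (map_poly (\<lambda>c. coeff c a) p * map_poly (\<lambda>c. coeff c b) q) n"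
proof -
  have *: "coeff (x * y) (a + b) = coeff x a * coeff y b"
    if x: "degree x \<le> a" and y: "degree y \<le> b" for x y :: "'k poly"
  proof -
    have "coeff (x * y) (a + b) = (\<Sum>i\<le>a + b. coeff x i * coeff y (a + b - i))"
      by (simp add: coeff_mult)
    also have "\<dots> = (\<Sum>i\<in>{a}. coeff x i * coeff y (a + b - i))"
    proof (rule sum.mono_neutral_right)
      show "\<forall>i\<in>{..a + b} - {a}. coeff x i * coeff y (a + b - i) = 0"
      proof
        fix i assume "i \<in> {..a + b} - {a}"
        hence "degree x < i \<or> degree y < a + b - i" using x y by auto
        thus "coeff x i * coeff y (a + b - i) = 0" by (auto simp: coeff_eq_0)
      qed
    qed auto
    finally show ?thesis by simp
  qed
  show ?thesis
    unfolding coeff_mult[of p q] coeff_mult[of "map_poly _ p" "map_poly _ q"] coeff_sum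
    by (simp add: * p q coeff_map_poly)
qed

text \<open>The top parts in t of both factors are nonzero polynomials in y over a domain, so their
  product is nonzero. Hence degrees in t add up, and a factor cannot exceed the product.\<close>

lemma degree_coeff_factor_le:
  fixes R M :: "'k::idom poly poly"
  assumes "R \<noteq> 0" "M \<noteq> 0" and bound: "\<And>j. degree (coeff (R * M) j) \<le> d"
  shows "degree (coeff R j) \<le> d"
proof -
  have top: "\<exists>a. (\<forall>j. degree (coeff R j) \<le> a) \<and> map_poly (\<lambda>c. coeff c a) R \<noteq> 0"
    if "R \<noteq> 0" for R :: "'k poly poly"
  proof -
    let ?J = "{j. coeff R j \<noteq> 0}"
    have "finite ?J" by (rule finite_subset[of _ "{..degree R}"]) (auto intro: le_degree)
    moreover have "?J \<noteq> {}" using that by (auto simp: poly_eq_iff)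
    ultimately obtain j where j: "j \<in> ?J" "degree (coeff R j) = Max ((\<lambda>j. degree (coeff R j)) ` ?J)"
      by (metis (mono_tags, lifting) Max_in finite_imageI image_iff image_is_empty)
    have "degree (coeff R i) \<le> degree (coeff R j)" for i
      using \<open>finite ?J\<close> unfolding j(2) by (cases "coeff R i = 0") (auto intro!: Max_ge)
    moreover have "coeff (map_poly (\<lambda>c. coeff c (degree (coeff R j))) R) j \<noteq> 0"
      using j(1) by (simp add: coeff_map_poly)
    ultimately show ?thesis by (metis coeff_0)
  qed
  obtain a b where a: "\<forall>j. degree (coeff R j) \<le> a" "map_poly (\<lambda>c. coeff c a) R \<noteq> 0"
    and b: "\<forall>j. degree (coeff M j) \<le> b" "map_poly (\<lambda>c. coeff c b) M \<noteq> 0"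
    using top assms by meson
  hence "map_poly (\<lambda>c. coeff c a) R * map_poly (\<lambda>c. coeff c b) M \<noteq> 0" by simp
  then obtain n where "coeff (map_poly (\<lambda>c. coeff c a) R * map_poly (\<lambda>c. coeff c b) M) n \<noteq> 0"
    by (auto simp: poly_eq_iff)
  hence "coeff (coeff (R * M) n) (a + b) \<noteq> 0"
    using a b by (subst coeff_coeff_mult_bound) auto
  hence "a + b \<le> degree (coeff (R * M) n)" by (rule le_degree)
  with bound[of n] a(1) show ?thesis by (meson add_leD1 le_trans)
qed

lemma exists_prime_factor_poly:
  fixes c :: "'k::field poly"
  assumes "degree c > 0"
  shows "\<exists>p. p dvd c \<and> prime_elem p"
proof -
  define p where "p = arg_min degree (\<lambda>p. p dvd c \<and> degree p > 0)"
  have p: "p dvd c" "degree p > 0" and min: "\<And>q. q dvd c \<Longrightarrow> degree q > 0 \<Longrightarrow> degree p \<le> degree q"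
    using arg_min_nat_lemma[of "\<lambda>p. p dvd c \<and> degree p > 0" c degree] assms
    unfolding p_def by auto
  have "irreducible p"
  proof (rule irreducibleI)
    show "p \<noteq> 0" using p(2) by auto
    thus "\<not> p dvd 1" using p(2) by (simp add: is_unit_iff_degree)
    fix a b assume ab: "p = a * b"
    hence nz: "a \<noteq> 0" "b \<noteq> 0" using p(2) by auto
    have "degree p = degree a + degree b" using ab nz by (simp add: degree_mult_eq)
    moreover have "degree a > 0 \<Longrightarrow> degree p \<le> degree a" using p(1) ab by (intro min) auto
    ultimately show "a dvd 1 \<or> b dvd 1"
      using nz by (cases "degree a = 0") (auto simp: is_unit_iff_degree)
  qed
  hence "prime_elem p" by (rule field_poly_irreducible_imp_prime)
  with p show ?thesis by blast
qed

text \<open>Gauss' lemma for the minimal polynomial of \<open>y\<close>, made primitive by minimising the degree of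
  its leading coefficient.\<close>

lemma exists_minimal_divisor:
  fixes P :: "'k::field poly poly" and y :: "'k fps"
  assumes "P \<noteq> 0" "ev_fps P y = 0"
  obtains R where "R dvd P" "ev_fps R y = 0"
    "\<And>B. B \<noteq> 0 \<Longrightarrow> ev_fps B y = 0 \<Longrightarrow> degree R \<le> degree B"
proof -
  let ?I = "\<lambda>F. F \<noteq> 0 \<and> ev_fps F y = 0"
  let ?J = "\<lambda>F. ?I F \<and> (\<forall>B. ?I B \<longrightarrow> degree F \<le> degree B)"
  define R0 where "R0 = arg_min degree ?I"
  have R0: "?J R0"
    using arg_min_nat_lemma[of ?I P degree] assms unfolding R0_def by auto
  define R where "R = arg_min (\<lambda>F. degree (lead_coeff F)) ?J"
  have R: "?J R" and Rmin: "\<And>F. ?J F \<Longrightarrow> degree (lead_coeff R) \<le> degree (lead_coeff F)"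
    using arg_min_nat_lemma[of ?J R0 "\<lambda>F. degree (lead_coeff F)"] R0 unfolding R_def by auto
  \<comment> \<open>Prime factors p of c are removed one at a time. By Gauss, p divides
    \<open>R\<close> or \<open>q\<close>; in the first case R / p still vanishes at y and has a
    leading coefficient of smaller degree, against the choice of \<open>R\<close>.\<close>
  have cancel: "R dvd P" if "c \<noteq> 0" "smult c P = R * q" for c q
    using that
  proof (induction "degree c" arbitrary: c q rule: less_induct)
    case less
    show ?case
    proof (cases "degree c = 0")
      case True
      then obtain c0 where c0: "c = [:c0:]" "c0 \<noteq> 0" using less.prems(1) by (metis degree_eq_zeroE pCons_0_0)
      have "P = smult [:1 / c0:] (smult c P)" using c0 by (simp add: pCons_one)
      also have "\<dots> = R * smult [:1 / c0:] q" using less.prems(2) by simp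
      finally show ?thesis by (rule dvdI)
    next
      case False
      then obtain p where p: "p dvd c" "prime_elem p" using exists_prime_factor_poly by blast
      then obtain c' where c': "c = p * c'" by (elim dvdE)
      have pnz: "p \<noteq> 0" using p(2) by auto
      have pdeg: "degree p > 0"
        using p(2) pnz is_unit_iff_degree[OF pnz] by (auto simp: prime_elem_def)
      have "[:p:] dvd smult c P" by (simp add: const_poly_dvd_iff c')
      hence "[:p:] dvd R * q" by (simp only: less.prems(2))
      with lift_prime_elem_poly[OF p(2)] consider "[:p:] dvd R" | "[:p:] dvd q"
        by (auto simp: prime_elem_dvd_mult_iff)
      thus ?thesis
      proof cases
        case 1
        then obtain R' where R': "R = smult p R'" by (auto elim!: dvdE)
        have "fps_of_poly p \<noteq> 0" using pnz by (simp add: fps_of_poly_eq_0)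
        hence "?J R'" using R R' pnz by (auto simp: ev_fps_smult)
        moreover have "degree (lead_coeff R') < degree (lead_coeff R)"
          using R R' pdeg pnz by (auto simp: degree_mult_eq)
        ultimately show ?thesis using Rmin[of R'] by simp
      next
        case 2
        then obtain q' where q': "q = smult p q'" by (auto elim!: dvdE)
        have "smult p (smult c' P) = smult p (R * q')"
          using less.prems(2) by (simp add: c' q')
        hence "smult c' P = R * q'" using pnz by (simp add: smult_cancel)
        moreover have "degree c' < degree c" "c' \<noteq> 0"
          using less.prems(1) pdeg pnz by (auto simp: c' degree_mult_eq)
        ultimately show ?thesis using less.hyps[of c' q'] by blast
      qed
    qed
  qed
  \<comment> \<open>Pseudo-division replaces P by a multiple c P with c in K[t]. The remainder
    vanishes at y and has smaller y-degree than \<open>R\<close>, so it is 0.\<close>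
  obtain q r where qr: "pseudo_divmod P R = (q, r)" by fastforce
  define c where "c = lead_coeff R ^ (Suc (degree P) - degree R)"
  have *: "smult c P = R * q + r" "r = 0 \<or> degree r < degree R"
    using pseudo_divmod[OF _ qr] R unfolding c_def by auto
  have "ev_fps r y = 0"
    using arg_cong[OF *(1), of "\<lambda>F. ev_fps F y"] R assms
    by (simp add: ev_fps_add ev_fps_mult ev_fps_smult)
  hence "r = 0" using R *(2) by (meson not_le)
  moreover have "c \<noteq> 0" using R by (simp add: c_def)
  ultimately have "R dvd P" using *(1) by (intro cancel) auto
  thus ?thesis using R that[of R] by blast
qed

lemma coeff_monom_monom_mult:
  "coeff (coeff (monom (monom 1 i) j * F) m) n =
     (if i \<le> n \<and> j \<le> m then coeff (coeff F (m - j)) (n - i) else (0 :: 'k::comm_ring_1))"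
  by (simp add: coeff_monom_mult)

text \<open>A polynomial \<open>h \<in> K[t]\<close> with \<open>h = A R + B G\<close> is found by counting coefficients.\<close>

lemma subdegree_ev_fps_le:
  fixes P G :: "'k::field poly poly" and y :: "'k fps"
  assumes P: "P \<noteq> 0" "ev_fps P y = 0" "\<And>j. degree (coeff P j) \<le> d" "degree P \<le> e"
    and G: "ev_fps G y \<noteq> 0" "\<And>j. degree (coeff G j) \<le> d" "degree G \<le> e"
  shows "subdegree (ev_fps G y) \<le> 2 * d * e"
proof -
  obtain R where R: "R dvd P" "ev_fps R y = 0"
    and Rmin: "\<And>B. B \<noteq> 0 \<Longrightarrow> ev_fps B y = 0 \<Longrightarrow> degree R \<le> degree B"
    using exists_minimal_divisor[OF P(1,2)] by metis
  then obtain M where M: "P = R * M" by (elim dvdE)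
  have nz: "R \<noteq> 0" "M \<noteq> 0" using P(1) M by auto
  have Rd: "degree (coeff R j) \<le> d" for j
    using degree_coeff_factor_le[OF nz] P(3) M by simp
  define r where "r = degree R"
  have re: "r \<le> e" using P(4) nz by (simp add: M degree_mult_eq r_def)
  \<comment> \<open>With t-degrees up to \<open>N\<close> there are (N + 1)(e + r + 1) unknowns
    against (N + d + 1)(e + r) equations. The surplus is N + 1 - d (e + r), so this is the least
    \<open>N\<close> for which the count succeeds.\<close>
  define N where "N = d * (e + r)"
  \<comment> \<open>In an index (s, i, j) the tag s = 0, 1, 2 selects the cofactor of
    \<open>R\<close>, the cofactor of \<open>G\<close>, or the polynomial \<open>h\<close>; i and j
    are the exponents of t and y.\<close>
  define UA UB UH where "UA = {0::nat} \<times> {..N} \<times> {..<e}" and "UB = {1::nat} \<times> {..N} \<times> {..<r}"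
    and "UH = {2::nat} \<times> {..N} \<times> {0::nat}"
  define U where "U = UA \<union> UB \<union> UH"
  define E where "E = {..N + d} \<times> {..<e + r}"
  define b :: "nat \<times> nat \<times> nat \<Rightarrow> 'k poly poly" where
    "b = (\<lambda>(s, i, j). monom (monom 1 i) j * (if s = 0 then R else if s = 1 then G else 1))"
  have fin: "finite UA" "finite UB" "finite UH" by (auto simp: UA_def UB_def UH_def)
  have disj: "UA \<inter> UB = {}" "(UA \<union> UB) \<inter> UH = {}" by (auto simp: UA_def UB_def UH_def)
  have "card U = (N + 1) * e + (N + 1) * r + (N + 1)"
    unfolding U_def using fin disj
    by (simp add: card_Un_disjoint) (simp add: UA_def UB_def UH_def card_cartesian_product)
  moreover have "card E = (N + d + 1) * (e + r)"
    by (simp add: E_def card_cartesian_product)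
  ultimately have "card E < card U" by (simp add: N_def algebra_simps)
  then obtain x where x: "\<exists>u\<in>U. x u \<noteq> 0"
    and sys: "\<forall>v\<in>E. (\<Sum>u\<in>U. coeff (coeff (b u) (snd v)) (fst v) * x u) = 0"
    using underdetermined_system[of E U "\<lambda>v u. coeff (coeff (b u) (snd v)) (fst v)"]
    by (auto simp: E_def U_def fin)
  define comb where "comb V = (\<Sum>u\<in>V. smult [:x u:] (b u))" for V
  have coeff_comb: "coeff (coeff (comb V) m) n = (\<Sum>u\<in>V. coeff (coeff (b u) m) n * x u)" for V m n
    by (simp add: comb_def coeff_sum mult.commute)
  have "comb U = 0"
  proof (intro poly_eqI)
    fix m n
    show "coeff (coeff (comb U) m) n = coeff (coeff 0 m) n"
    proof (cases "(n, m) \<in> E")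
      case True
      thus ?thesis using sys by (auto simp: coeff_comb)
    next
      case False
      have "coeff (coeff (b u) m) n = 0" if "u \<in> U" for u
      proof (rule ccontr)
        assume *: "coeff (coeff (b u) m) n \<noteq> 0"
        obtain s i j where u: "u = (s, i, j)" by (cases u) auto
        define F where "F = (if s = 0 then R else if s = 1 then G else 1)"
        have le: "i \<le> n" "j \<le> m" and nzF: "coeff (coeff F (m - j)) (n - i) \<noteq> 0"
          using * unfolding b_def u prod.case coeff_monom_monom_mult F_def [symmetric]
          by (auto split: if_splits)
        have Fd: "degree (coeff F (m - j)) \<le> d"
          using Rd G(2) by (auto simp: F_def coeff_1)
        have "n - i \<le> d" using le_degree[OF nzF] Fd by simp
        moreover have "i \<le> N" using that by (auto simp: u U_def UA_def UB_def UH_def)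
        moreover have "m - j \<le> degree F" using nzF by (intro le_degree) auto
        \<comment> \<open>The exception is the constant 1 when the range of y-exponents is empty.
          Then P would be a nonzero element of K[t] and could not vanish at y.\<close>
        moreover have "j + degree F < e + r \<or> e + r = 0 \<and> j = 0 \<and> F = 1"
          using that G(3) re by (auto simp: u U_def UA_def UB_def UH_def F_def r_def)
        ultimately have "e + r = 0"
          using False le by (auto simp: E_def)
        hence "degree P = 0" using P(4) by simp
        then obtain p where "P = [:p:]" by (metis degree_eq_zeroE)
        thus False using P by (simp add: ev_fps_pCons fps_of_poly_eq_0)
      qed
      thus ?thesis by (simp add: coeff_comb)
    qed
  qed
  moreover have "comb U = comb UA + comb UB + comb UH"
    unfolding comb_def U_def using fin disj by (simp add: sum.union_disjoint)
  ultimately have sum0: "comb UA + comb UB + comb UH = 0" by simp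
  define pl where "pl V = (\<Sum>(s, i, j)\<in>V. monom (monom (x (s, i, j)) i) j)" for V :: "(nat \<times> nat \<times> nat) set"
  have comb_pl: "comb V = pl V * F"
    if "\<And>s i j. (s, i, j) \<in> V \<Longrightarrow> (if s = 0 then R else if s = 1 then G else 1) = F" for V F
    unfolding comb_def pl_def sum_distrib_right
  proof (rule sum.cong, goal_cases)
    case (2 u)
    obtain s i j where u: "u = (s, i, j)" by (cases u) auto
    have "smult [:x u:] (monom (monom 1 i) j) = monom (monom (x u) i) j"
      by (simp add: smult_monom)
    thus ?case using that[of s i j] 2 by (simp add: u b_def mult_smult_left [symmetric] del: mult_smult_left)
  qed simp
  have A: "comb UA = pl UA * R" and B: "comb UB = pl UB * G" and H: "comb UH = pl UH * 1"
    by (rule comb_pl; force simp: UA_def UB_def UH_def)+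
  have coeff_pl: "coeff (coeff (pl V) j) i = x (s, i, j)"
    if "finite V" "V \<subseteq> {s} \<times> UNIV" "(s, i, j) \<in> V" for V s i j
  proof -
    have "coeff (coeff (pl V) j) i = (\<Sum>u\<in>V. if u = (s, i, j) then x u else 0)"
      unfolding pl_def coeff_sum using that(2)
      by (intro sum.cong) (auto split: if_splits)
    thus ?thesis using that by (simp add: sum.delta)
  qed
  have "\<not> (pl UA = 0 \<and> pl UB = 0 \<and> pl UH = 0)"
  proof
    assume "pl UA = 0 \<and> pl UB = 0 \<and> pl UH = 0"
    hence "x (s, i, j) = 0" if "(s, i, j) \<in> U" for s i j
      using that coeff_pl[of UA s i j] coeff_pl[of UB s i j] coeff_pl[of UH s i j] fin
      by (fastforce simp: U_def UA_def UB_def UH_def)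
    thus False using x by auto
  qed
  have degB: "pl UB = 0 \<or> degree (pl UB) < r"
  proof (cases "r = 0")
    case True
    thus ?thesis by (simp add: pl_def UB_def)
  next
    case False
    have "degree (pl UB) \<le> r - 1"
      unfolding pl_def using False
      by (intro degree_sum_le) (auto simp: UB_def intro!: order_trans[OF degree_monom_le])
    with False show ?thesis by auto
  qed
  define h where "h = coeff (pl UH) 0"
  have plH: "pl UH = [:h:]"
    by (intro poly_eqI) (auto simp: h_def coeff_pCons pl_def UH_def coeff_sum intro!: sum.neutral split: nat.splits)
  have "degree h \<le> N"
    unfolding h_def pl_def coeff_sum
    by (intro degree_sum_le) (auto simp: UH_def intro!: order_trans[OF degree_monom_le])
  have ev: "ev_fps (pl UB) y * ev_fps G y + fps_of_poly h = 0"
    using arg_cong[OF sum0, of "\<lambda>F. ev_fps F y"] R(2)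
    by (simp add: A B H ev_fps_add ev_fps_mult plH ev_fps_pCons)
  \<comment> \<open>Otherwise the cofactor of \<open>G\<close> vanishes at y and has degree below
    that of the minimal polynomial \<open>R\<close>, so it is 0; then the cofactor of
    \<open>R\<close> is 0 too, and the solution of the system would be trivial.\<close>
  have "h \<noteq> 0"
  proof
    assume "h = 0"
    with ev G(1) have "ev_fps (pl UB) y = 0" by simp
    with degB Rmin[of "pl UB"] have B0: "pl UB = 0"
      by (cases "pl UB = 0") (auto simp: r_def)
    with sum0 \<open>h = 0\<close> nz have "pl UA = 0" by (simp add: A B H plH)
    with B0 \<open>h = 0\<close> \<open>\<not> (pl UA = 0 \<and> pl UB = 0 \<and> pl UH = 0)\<close> show False by (simp add: plH)
  qed
  hence hnz: "fps_of_poly h \<noteq> 0" by (simp add: fps_of_poly_eq_0)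
  have eq: "ev_fps (pl UB) y * ev_fps G y = - fps_of_poly h" using ev by (simp add: eq_neg_iff_add_eq_0)
  with hnz have "ev_fps (pl UB) y \<noteq> 0" by auto
  hence "subdegree (ev_fps (pl UB) y) + subdegree (ev_fps G y) = subdegree (fps_of_poly h)"
    using arg_cong[OF eq, of subdegree] G(1) by simp
  also have "\<dots> \<le> degree h" using \<open>h \<noteq> 0\<close> by (intro subdegree_leI) simp
  also note \<open>degree h \<le> N\<close>
  also have "N \<le> 2 * d * e" using re by (simp add: N_def mult.assoc algebra_simps mult_le_mono)
  finally show ?thesis by simp
qed

section \<open>Weights and the induced homomorphisms into univariate series\<close>

definition edot :: "('r \<Rightarrow> int) \<Rightarrow> 'r::finite mindex \<Rightarrow> int" where
  "edot \<epsilon> n = (\<Sum>c\<in>UNIV. \<epsilon> c * Poly_Mapping.lookup n c)"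

text \<open>Coordinate c has weight \<open>\<Lambda> + \<epsilon> c\<close>. A large
  \<open>\<Lambda>\<close> lets the total degree decide, as grlex does, and
  \<open>\<epsilon>\<close> imitates the lexicographic tie-break on finitely many exponents.\<close>

definition wt :: "int \<Rightarrow> ('r \<Rightarrow> int) \<Rightarrow> 'r::finite mindex \<Rightarrow> int" where
  "wt \<Lambda> \<epsilon> n = \<Lambda> * tdeg n + edot \<epsilon> n"

lemma edot_add: "edot \<epsilon> (m + n) = edot \<epsilon> m + edot \<epsilon> n"
  by (simp add: edot_def lookup_add algebra_simps sum.distrib)

lemma edot_nonneg: "(\<And>c. 0 \<le> \<epsilon> c) \<Longrightarrow> n \<in> Nr \<Longrightarrow> 0 \<le> edot \<epsilon> n"
  by (auto simp: edot_def Nr_def intro!: sum_nonneg)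

lemma wt_add: "wt \<Lambda> \<epsilon> (m + n) = wt \<Lambda> \<epsilon> m + wt \<Lambda> \<epsilon> n"
  by (simp add: wt_def edot_add tdeg_add algebra_simps)

lemma lex_pos_leading:
  assumes "0 < (n :: 'r::linorder mindex)"
  obtains c where "0 < Poly_Mapping.lookup n c" "\<And>c'. c' < c \<Longrightarrow> Poly_Mapping.lookup n c' = 0"
  using assms by (auto simp: less_poly_mapping.rep_eq less_fun_def)

text \<open>Coordinates are added from the last to the first. The new weight \<open>B\<close>
  exceeds every value that the later coordinates produce on \<open>F\<close>, so the first nonzero
  coordinate, which is positive, decides the sign.\<close>

lemma exists_lex_weights:
  fixes F :: "'r::{finite,linorder} mindex set"
  assumes "finite F" and pos: "\<And>n. n \<in> F \<Longrightarrow> 0 < n"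
  shows "\<exists>\<epsilon>. (\<forall>c. 0 \<le> \<epsilon> c) \<and> (\<forall>n\<in>F. 0 < edot \<epsilon> n)"
proof -
  have "\<exists>\<epsilon>. (\<forall>c. 0 \<le> \<epsilon> c) \<and> (\<forall>c. c \<notin> U \<longrightarrow> \<epsilon> c = 0) \<and>
          (\<forall>n\<in>F. Poly_Mapping.keys n \<subseteq> U \<longrightarrow> 0 < edot \<epsilon> n)" if "finite U" for U
    using that
  proof (induction U rule: finite_linorder_min_induct)
    case empty
    show ?case using pos by (intro exI[of _ "\<lambda>_. 0"]) auto
  next
    case (insert b U)
    then obtain \<epsilon> where \<epsilon>: "\<forall>c. 0 \<le> \<epsilon> c" "\<forall>c. c \<notin> U \<longrightarrow> \<epsilon> c = 0"
      "\<forall>n\<in>F. Poly_Mapping.keys n \<subseteq> U \<longrightarrow> 0 < edot \<epsilon> n" by blast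
    have b: "\<epsilon> b = 0" using insert \<epsilon>(2) by auto
    define B where "B = (\<Sum>n\<in>F. \<bar>edot \<epsilon> n\<bar>) + 1"
    have B: "\<bar>edot \<epsilon> n\<bar> < B" if "n \<in> F" for n
      using member_le_sum[of n F "\<lambda>n. \<bar>edot \<epsilon> n\<bar>"] that assms(1) by (simp add: B_def)
    have "0 \<le> B" by (simp add: B_def sum_nonneg add_nonneg_nonneg)
    have upd: "edot (\<epsilon>(b := B)) n = B * Poly_Mapping.lookup n b + edot \<epsilon> n" for n
      unfolding edot_def by (simp add: sum.remove[of UNIV b] b)
    show ?case
    proof (intro exI[of _ "\<epsilon>(b := B)"] conjI ballI impI allI)
      fix n assume n: "n \<in> F" "Poly_Mapping.keys n \<subseteq> insert b U"
      show "0 < edot (\<epsilon>(b := B)) n"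
      proof (cases "Poly_Mapping.lookup n b = 0")
        case True
        hence "Poly_Mapping.keys n \<subseteq> U" using n by (auto simp: in_keys_iff)
        thus ?thesis using \<epsilon>(3) n True by (simp add: upd)
      next
        case False
        from pos[OF n(1)] obtain c where c: "0 < Poly_Mapping.lookup n c"
          "\<And>c'. c' < c \<Longrightarrow> Poly_Mapping.lookup n c' = 0" by (rule lex_pos_leading) blast
        have "c \<in> Poly_Mapping.keys n" using c(1) by (simp add: in_keys_iff)
        hence "c \<in> insert b U" using n(2) by blast
        moreover have "\<not> b < c" using c(2) False by auto
        ultimately have "c = b" using insert.hyps(2) by auto
        hence "B * 1 \<le> B * Poly_Mapping.lookup n b" using c(1) \<open>0 \<le> B\<close> by (intro mult_left_mono) auto
        thus ?thesis using B[OF n(1)] by (simp add: upd)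
      qed
    qed (use \<epsilon> \<open>0 \<le> B\<close> in auto)
  qed
  from this[of UNIV] show ?thesis by auto
qed

text \<open>In total degree 0 only finitely many n satisfy n + s in N^r, and
  \<open>\<epsilon>\<close> is chosen for them and for the degree-0 part of \<open>F\<close>. In
  positive degree \<open>\<Lambda>\<close> wins, since the perturbation is bounded on
  \<open>F\<close> and at least -\<open>edot \<epsilon> s\<close> on the rest. The bound on g needs
  all large \<open>\<Lambda>\<close>, not just one.\<close>

lemma exists_weights:
  fixes F :: "'r::{finite,linorder} mindex set"
  assumes F: "finite F" "\<And>n. n \<in> F \<Longrightarrow> grlex_less 0 n"
  shows "\<exists>\<epsilon>. (\<forall>c. 0 \<le> \<epsilon> c) \<and> (\<exists>\<Lambda>0. \<forall>\<Lambda>\<ge>\<Lambda>0. (\<forall>n\<in>F. 0 < wt \<Lambda> \<epsilon> n) \<and>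
           (\<forall>n. n + s \<in> Nr \<longrightarrow> grlex_less 0 n \<longrightarrow> 0 < wt \<Lambda> \<epsilon> n))"
proof -
  define F1 where "F1 = {n. n + s \<in> Nr \<and> tdeg n = 0 \<and> 0 < n}"
  have "F1 \<subseteq> (\<lambda>m. m - s) ` {m \<in> Nr. tdeg m \<le> tdeg s}"
  proof
    fix n assume n: "n \<in> F1"
    show "n \<in> (\<lambda>m. m - s) ` {m \<in> Nr. tdeg m \<le> tdeg s}"
      by (rule image_eqI[of _ _ "n + s"]) (use n in \<open>auto simp: F1_def tdeg_add\<close>)
  qed
  hence finF1: "finite F1"
    by (rule finite_subset) (intro finite_imageI finite_Nr_tdeg_le)
  define F2 where "F2 = F1 \<union> {n \<in> F. tdeg n = 0}"
  have "finite F2" "\<And>n. n \<in> F2 \<Longrightarrow> 0 < n"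
    using F finF1 by (force simp: F2_def F1_def grlex_less_iff)+
  from exists_lex_weights[OF this] obtain \<epsilon> where
    \<epsilon>: "\<forall>c. 0 \<le> \<epsilon> c" "\<forall>n\<in>F2. 0 < edot \<epsilon> n" by blast
  define \<Lambda>0 where "\<Lambda>0 = (\<Sum>n\<in>F. \<bar>edot \<epsilon> n\<bar>) + \<bar>edot \<epsilon> s\<bar> + 1"
  have "0 < wt \<Lambda> \<epsilon> n" if \<Lambda>: "\<Lambda> \<ge> \<Lambda>0" and n: "n \<in> F" for \<Lambda> n
  proof (cases "tdeg n = 0")
    case True
    thus ?thesis using \<epsilon>(2) n by (simp add: wt_def F2_def)
  next
    case False
    hence "1 \<le> tdeg n" using F(2)[OF n] by (auto simp: grlex_less_iff)
    moreover have "\<bar>edot \<epsilon> n\<bar> < \<Lambda>"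
      using member_le_sum[of n F "\<lambda>n. \<bar>edot \<epsilon> n\<bar>"] F(1) n \<Lambda> by (simp add: \<Lambda>0_def)
    ultimately have "\<Lambda> * 1 \<le> \<Lambda> * tdeg n" by (intro mult_left_mono) auto
    thus ?thesis using \<open>\<bar>edot \<epsilon> n\<bar> < \<Lambda>\<close> by (simp add: wt_def)
  qed
  moreover have "0 < wt \<Lambda> \<epsilon> n" if \<Lambda>: "\<Lambda> \<ge> \<Lambda>0" and n: "n + s \<in> Nr" "grlex_less 0 n" for \<Lambda> n
  proof (cases "tdeg n = 0")
    case True
    thus ?thesis using \<epsilon>(2) n by (auto simp: wt_def F2_def F1_def grlex_less_iff)
  next
    case False
    hence "1 \<le> tdeg n" using n(2) by (auto simp: grlex_less_iff)
    moreover have "\<bar>edot \<epsilon> s\<bar> < \<Lambda>"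
    proof -
      have "0 \<le> (\<Sum>n\<in>F. \<bar>edot \<epsilon> n\<bar>)" by (intro sum_nonneg) auto
      thus ?thesis using \<Lambda> unfolding \<Lambda>0_def by linarith
    qed
    moreover have "0 \<le> edot \<epsilon> n + edot \<epsilon> s"
      using edot_nonneg[of \<epsilon>, OF _ n(1)] \<epsilon>(1) by (simp add: edot_add)
    ultimately have "\<Lambda> * 1 \<le> \<Lambda> * tdeg n" by (intro mult_left_mono) auto
    thus ?thesis using \<open>\<bar>edot \<epsilon> s\<bar> < \<Lambda>\<close> \<open>0 \<le> edot \<epsilon> n + edot \<epsilon> s\<close> by (simp add: wt_def)
  qed
  ultimately show ?thesis using \<epsilon>(1) by blast
qed

lemma tdeg_le_wt:
  assumes "1 \<le> \<Lambda>" "\<And>c. 0 \<le> \<epsilon> c" "n \<in> Nr"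
  shows "tdeg n \<le> wt \<Lambda> \<epsilon> n"
proof -
  have "1 * tdeg n \<le> \<Lambda> * tdeg n" using assms tdeg_nonneg by (intro mult_right_mono) auto
  thus ?thesis using edot_nonneg[of \<epsilon>, OF assms(2,3)] by (simp add: wt_def)
qed

text \<open>Used twice. With \<open>\<theta>\<close> forgetting n, \<open>hom\<close> is the
  substitution x_i = t^w_i; with \<open>\<theta>\<close> n x the monomial x^n of coefficient x, it
  adjoins t as a tag and loses nothing. The bound by the total degree makes the fibres
  finite.\<close>

locale weight_hom =
  fixes wgt :: "'r::finite mindex \<Rightarrow> int" and \<theta> :: "'r mindex \<Rightarrow> 'k::comm_ring_1 \<Rightarrow> 'a::comm_ring_1"
  assumes weight_add: "wgt (m + n) = wgt m + wgt n"
    and tdeg_le_weight: "n \<in> Nr \<Longrightarrow> tdeg n \<le> wgt n"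
    and \<theta>_add: "\<theta> n (x + y) = \<theta> n x + \<theta> n y"
    and \<theta>_mult: "\<theta> m x * \<theta> n y = \<theta> (m + n) (x * y)"
begin

definition fib :: "nat \<Rightarrow> 'r mindex set" where
  "fib N = {n \<in> Nr. wgt n = int N}"

definition hom :: "('r, 'k) mfps \<Rightarrow> 'a fps" where
  "hom f = Abs_fps (\<lambda>N. \<Sum>n\<in>fib N. \<theta> n (mfps_nth f n))"

lemma finite_fib [simp]: "finite (fib N)"
  by (rule finite_subset[OF _ finite_Nr_tdeg_le[of "int N"]])
     (auto simp: fib_def dest: tdeg_le_weight)

lemma weight_0 [simp]: "wgt 0 = 0"
  using weight_add[of 0 0] by simp

lemma weight_diff: "wgt (m - n) = wgt m - wgt n"
  using weight_add[of "m - n" n] by simp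

lemma weight_nonneg: "n \<in> Nr \<Longrightarrow> 0 \<le> wgt n"
  using tdeg_le_weight tdeg_nonneg by (meson order_trans)

lemma \<theta>_0: "\<theta> n 0 = 0"
  using \<theta>_add[of n 0 0] by simp

lemma \<theta>_sum: "\<theta> n (sum f A) = (\<Sum>x\<in>A. \<theta> n (f x))"
  by (induction A rule: infinite_finite_induct) (simp_all add: \<theta>_add \<theta>_0)

lemma hom_nth: "fps_nth (hom f) N = (\<Sum>n\<in>fib N. \<theta> n (mfps_nth f n))"
  by (simp add: hom_def)

lemma hom_0 [simp]: "hom 0 = 0"
  by (rule fps_ext) (simp add: hom_nth \<theta>_0)

lemma hom_add: "hom (f + g) = hom f + hom g"
  by (rule fps_ext) (simp add: hom_nth \<theta>_add sum.distrib)

lemma hom_mult: "hom (f * g) = hom f * hom g"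
proof (rule fps_ext)
  fix N
  have "fps_nth (hom (f * g)) N =
          (\<Sum>p\<in>fib N. \<Sum>n\<in>mfps_splits p. \<theta> n (mfps_nth f n) * \<theta> (p - n) (mfps_nth g (p - n)))"
    by (simp add: hom_nth mfps_nth_mult \<theta>_sum \<theta>_mult)
  also have "\<dots> = (\<Sum>(p, n)\<in>Sigma (fib N) mfps_splits.
                  \<theta> n (mfps_nth f n) * \<theta> (p - n) (mfps_nth g (p - n)))"
    by (simp add: sum.Sigma)
  also have "\<dots> = (\<Sum>(i, n, m)\<in>Sigma {..N} (\<lambda>i. fib i \<times> fib (N - i)).
                  \<theta> n (mfps_nth f n) * \<theta> m (mfps_nth g m))"
  proof (rule sum.reindex_bij_witness[where i = "\<lambda>(i, n, m). (n + m, n)"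
            and j = "\<lambda>(p, n). (nat (wgt n), n, p - n)"], goal_cases)
    case (2 x)
    obtain p n where x: "x = (p, n)" by (cases x)
    have *: "n \<in> Nr" "p - n \<in> Nr" "wgt p = int N" using 2 by (auto simp: x fib_def mfps_splits_def)
    hence "0 \<le> wgt n" "0 \<le> wgt (p - n)" by (auto intro: weight_nonneg)
    thus ?case using * by (auto simp: x fib_def weight_diff)
  next
    case (4 x)
    thus ?case by (auto simp: fib_def mfps_splits_def weight_add Nr_add)
  qed (auto simp: fib_def)
  also have "\<dots> = (\<Sum>i\<le>N. fps_nth (hom f) i * fps_nth (hom g) (N - i))"
    by (simp add: hom_nth sum_product sum.Sigma sum.cartesian_product)
  finally show "fps_nth (hom (f * g)) N = fps_nth (hom f * hom g) N"
    by (simp add: fps_mult_nth atLeast0AtMost)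
qed

lemma hom_poly: "hom (poly F y) = poly (map_poly hom F) (hom y)"
  by (induction F) (simp_all add: map_poly_pCons hom_add hom_mult)

lemma hom_mfps_of_xpoly:
  assumes a: "a \<in> xpolys"
  shows "hom (mfps_of_xpoly a) =
           (\<Sum>i\<in>Poly_Mapping.keys a. fps_const (\<theta> i (Poly_Mapping.lookup a i)) * fps_X ^ nat (wgt i))"
proof (rule fps_ext)
  fix N
  have "fps_nth (\<Sum>i\<in>Poly_Mapping.keys a. fps_const (\<theta> i (Poly_Mapping.lookup a i)) * fps_X ^ nat (wgt i)) N =
          (\<Sum>i\<in>Poly_Mapping.keys a. if N = nat (wgt i) then \<theta> i (Poly_Mapping.lookup a i) else 0)"
    unfolding fps_sum_nth by (intro sum.cong) (simp_all add: fps_X_power_nth)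
  also have "\<dots> = (\<Sum>i\<in>Poly_Mapping.keys a. if i \<in> fib N then \<theta> i (Poly_Mapping.lookup a i) else 0)"
  proof (rule sum.cong)
    fix i assume "i \<in> Poly_Mapping.keys a"
    hence i: "i \<in> Nr" using a unfolding xpolys_def by blast
    have "N = nat (wgt i) \<longleftrightarrow> i \<in> fib N"
      unfolding fib_def using i weight_nonneg[OF i] by auto
    thus "(if N = nat (wgt i) then \<theta> i (Poly_Mapping.lookup a i) else 0) =
            (if i \<in> fib N then \<theta> i (Poly_Mapping.lookup a i) else 0)" by (simp only:)
  qed simp
  also have "\<dots> = (\<Sum>i\<in>Poly_Mapping.keys a \<inter> fib N. \<theta> i (Poly_Mapping.lookup a i))"
    by (simp only: sum.inter_restrict[OF finite_keys])
  also have "\<dots> = (\<Sum>i\<in>fib N. \<theta> i (Poly_Mapping.lookup a i))"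
    by (rule sum.mono_neutral_left) (auto simp: in_keys_iff \<theta>_0)
  finally show "fps_nth (hom (mfps_of_xpoly a)) N = fps_nth (\<Sum>i\<in>Poly_Mapping.keys a.
      fps_const (\<theta> i (Poly_Mapping.lookup a i)) * fps_X ^ nat (wgt i)) N"
    by (simp only: hom_nth mfps_nth_of_xpoly[OF a])
qed

end

section \<open>The bound on the total degree of g\<close>

context simple_root_expansion
begin

lemma tdeg_g_le:
  assumes dx: "\<And>j n. n \<in> Poly_Mapping.keys (coeff P j) \<Longrightarrow> tdeg n \<le> int dx" and dy: "degree P \<le> dy"
  shows "tdeg g \<le> 2 * int dx * int dy"
proof -
  let ?D = "eval_y (pderiv P) y0"
  \<comment> \<open>Translating by \<open>g\<close> turns this into: every exponent in N^r above
    \<open>g\<close> is strictly heavier than \<open>g\<close>.\<close>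
  have "\<exists>\<epsilon>. (\<forall>c. 0 \<le> \<epsilon> c) \<and> (\<exists>\<Lambda>0. \<forall>\<Lambda>\<ge>\<Lambda>0. (\<forall>n\<in>{}. 0 < wt \<Lambda> \<epsilon> n) \<and>
           (\<forall>n. n + g \<in> Nr \<longrightarrow> grlex_less 0 n \<longrightarrow> 0 < wt \<Lambda> \<epsilon> n))"
    by (rule exists_weights) auto
  then obtain \<epsilon> :: "'r \<Rightarrow> int" and \<Lambda>0 where \<epsilon>: "\<And>c. 0 \<le> \<epsilon> c"
    and \<Lambda>0: "\<And>\<Lambda> n. \<Lambda> \<ge> \<Lambda>0 \<Longrightarrow> n + g \<in> Nr \<Longrightarrow> grlex_less 0 n \<Longrightarrow> 0 < wt \<Lambda> \<epsilon> n" by blast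
  define B where "B = (\<Sum>c\<in>UNIV. \<epsilon> c)"
  have "0 \<le> B" unfolding B_def by (intro sum_nonneg \<epsilon>)
  \<comment> \<open>The elimination yields \<open>\<Lambda>\<close> |g| <= 2
    (\<open>\<Lambda>\<close> + B) d_x d_y. Once 2 d_x d_y B < \<open>\<Lambda>\<close>, the right
    side is below \<open>\<Lambda>\<close> (2 d_x d_y + 1), and integrality removes the
    error.\<close>
  define \<Lambda> where "\<Lambda> = max (max \<Lambda>0 1) (2 * int dx * int dy * B + 1)"
  have \<Lambda>: "\<Lambda> \<ge> \<Lambda>0" "1 \<le> \<Lambda>" "2 * int dx * int dy * B < \<Lambda>" by (auto simp: \<Lambda>_def)
  define l where "l = wt \<Lambda> \<epsilon>"
  interpret weight_hom l "\<lambda>_ (x::'k). x"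
    by unfold_locales (auto simp: l_def wt_add intro: tdeg_le_wt[OF \<Lambda>(2) \<epsilon>])
  define \<tau> :: "('r mindex \<Rightarrow>\<^sub>0 'k) \<Rightarrow> 'k poly" where
    "\<tau> a = (\<Sum>i\<in>Poly_Mapping.keys a. monom (Poly_Mapping.lookup a i) (nat (l i)))" for a
  have fps_\<tau>: "fps_of_poly (\<tau> a) = hom (mfps_of_xpoly a)" if "a \<in> xpolys" for a
  proof -
    have "fps_of_poly (\<tau> a) = (\<Sum>i\<in>Poly_Mapping.keys a.
            fps_const (Poly_Mapping.lookup a i) * fps_X ^ nat (l i))"
      unfolding \<tau>_def fps_of_poly_sum fps_of_poly_monom ..
    also have "\<dots> = hom (mfps_of_xpoly a)"
      by (rule hom_mfps_of_xpoly[OF that, symmetric])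
    finally show ?thesis .
  qed
  have \<tau>_0 [simp]: "\<tau> 0 = 0" by (simp add: \<tau>_def)
  have of_nat_lookup: "Poly_Mapping.lookup (of_nat m * a) i = of_nat m * Poly_Mapping.lookup a i"
    for m i and a :: "'r mindex \<Rightarrow>\<^sub>0 'k"
    by (induction m) (simp_all add: lookup_add algebra_simps)
  \<comment> \<open>In characteristic 0 the factor does not shrink the support. Hence the
    substitution commutes with the y-derivative.\<close>
  have \<tau>_of_nat: "\<tau> (of_nat (Suc m) * a) = of_nat (Suc m) * \<tau> a" for m a
  proof -
    have "Poly_Mapping.keys (of_nat (Suc m) * a) = Poly_Mapping.keys a"
      using of_nat_neq_0[where 'a = 'k]
      by (simp add: set_eq_iff in_keys_iff of_nat_lookup del: of_nat_Suc)
    thus ?thesis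
      unfolding \<tau>_def sum_distrib_left
      by (intro sum.cong) (simp_all add: of_nat_lookup of_nat_poly smult_monom del: of_nat_Suc)
  qed
  define R where "R = map_poly \<tau> P"
  have coeff_R: "coeff R j = \<tau> (coeff P j)" for j by (simp add: R_def coeff_map_poly)
  have dR: "pderiv R = map_poly \<tau> (pderiv P)"
    by (intro poly_eqI) (simp add: coeff_pderiv coeff_R coeff_map_poly \<tau>_of_nat del: of_nat_Suc)
  have xp: "coeff (pderiv P) j \<in> xpolys" for j
    using coeff_P[of "Suc j"]
    by (simp add: coeff_pderiv xpolys_def subset_iff in_keys_iff of_nat_lookup del: of_nat_Suc)
  have ev: "ev_fps (map_poly \<tau> F) (hom y0) = hom (eval_y F y0)" if "\<And>j. coeff F j \<in> xpolys" for F
  proof -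
    have "map_poly fps_of_poly (map_poly \<tau> F) = map_poly hom (map_poly mfps_of_xpoly F)"
      by (intro poly_eqI) (simp add: coeff_map_poly fps_\<tau>[OF that])
    thus ?thesis by (simp add: ev_fps_def eval_y_def hom_poly)
  qed
  \<comment> \<open>A support exponent other than \<open>g\<close> lies above \<open>g\<close> and
    is therefore heavier; and as \<open>\<epsilon>\<close> is nonnegative, no support exponent
    weighs less than \<open>\<Lambda>\<close> |g|.\<close>
  have nz_at: "mfps_nth ?D n = 0" if "n \<in> Nr" "l n < l g \<or> l n = l g \<and> n \<noteq> g \<or> l n < \<Lambda> * tdeg g" for n
  proof (rule ccontr)
    assume "mfps_nth ?D n \<noteq> 0"
    hence le: "grlex_le g n" using mlead_pderiv unfolding mlead_def by (metis grlex.not_less)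
    show False
    proof (cases "n = g")
      case True
      thus ?thesis using that edot_nonneg[of \<epsilon>, OF \<epsilon> g_Nr] by (simp add: l_def wt_def)
    next
      case False
      with le have less: "grlex_less (0 + g) (n - g + g)" by (simp add: grlex_less_def)
      hence "grlex_less 0 (n - g)" by (simp only: grlex_less_add_right)
      with \<Lambda>0[of \<Lambda> "n - g"] \<Lambda>(1) that have "0 < l (n - g)" by (simp add: l_def)
      moreover have "\<Lambda> * tdeg g \<le> \<Lambda> * tdeg n"
        using \<Lambda>(2) le by (intro mult_left_mono) (auto simp: grlex_le_def)
      hence "\<Lambda> * tdeg g \<le> l n"
        using edot_nonneg[of \<epsilon>, OF \<epsilon> that(1)] by (simp add: l_def wt_def)
      ultimately show ?thesis using that by (simp add: weight_diff)
    qed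
  qed
  \<comment> \<open>No other support exponent has the weight of \<open>g\<close>, so
    \<open>\<omega>\<close> survives as a coefficient.\<close>
  have "fps_nth (hom ?D) (nat (l g)) = (\<Sum>n\<in>{g}. mfps_nth ?D n)"
    unfolding hom_nth
  proof (rule sum.mono_neutral_right[OF finite_fib])
    show "{g} \<subseteq> fib (nat (l g))" using g_Nr weight_nonneg[OF g_Nr] by (simp add: fib_def)
    show "\<forall>n\<in>fib (nat (l g)) - {g}. mfps_nth ?D n = 0"
      using weight_nonneg[OF g_Nr] by (intro ballI nz_at) (auto simp: fib_def)
  qed
  hence "fps_nth (hom ?D) (nat (l g)) \<noteq> 0" using \<omega>_nonzero by (simp add: \<omega>_def)
  hence Dnz: "hom ?D \<noteq> 0" by auto
  have lower: "\<Lambda> * tdeg g \<le> int (subdegree (hom ?D))"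
  proof (rule ccontr)
    assume *: "\<not> ?thesis"
    have "fps_nth (hom ?D) (subdegree (hom ?D)) = 0"
      unfolding hom_nth using * by (intro sum.neutral ballI nz_at) (auto simp: fib_def)
    thus False using Dnz by simp
  qed
  \<comment> \<open>The perturbation adds at most B |i| to the weight of x^i, so this bounds the
    t-degree of every substituted coefficient of P.\<close>
  define d where "d = nat ((\<Lambda> + B) * int dx)"
  have dR_le: "degree (coeff R j) \<le> d" for j
    unfolding coeff_R \<tau>_def
  proof (rule degree_sum_le)
    fix i assume i: "i \<in> Poly_Mapping.keys (coeff P j)"
    hence iN: "i \<in> Nr" using coeff_P[of j] unfolding xpolys_def by blast
    have "edot \<epsilon> i \<le> (\<Sum>c\<in>UNIV. \<epsilon> c * tdeg i)"
      unfolding edot_def using \<epsilon> lookup_le_tdeg[OF iN] by (intro sum_mono mult_left_mono) auto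
    also have "\<dots> = B * tdeg i" by (simp add: B_def sum_distrib_right)
    finally have "l i \<le> (\<Lambda> + B) * tdeg i" by (simp add: l_def wt_def algebra_simps)
    also have "\<dots> \<le> (\<Lambda> + B) * int dx"
      using dx[OF i] \<Lambda>(2) \<open>0 \<le> B\<close> by (intro mult_left_mono) auto
    finally have "nat (l i) \<le> d" by (simp add: d_def nat_mono)
    thus "degree (monom (Poly_Mapping.lookup (coeff P j) i) (nat (l i))) \<le> d"
      using degree_monom_le le_trans by blast
  qed simp
  have "subdegree (ev_fps (pderiv R) (hom y0)) \<le> 2 * d * dy"
  proof (rule subdegree_ev_fps_le)
    show "ev_fps R (hom y0) = 0"
      using root ev[of P] coeff_P by (simp add: R_def simple_root_def)
    show evd: "ev_fps (pderiv R) (hom y0) \<noteq> 0"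
      using ev[OF xp] Dnz by (simp add: dR)
    show "R \<noteq> 0" using evd by auto
    show "degree R \<le> dy" using dy by (intro degree_le) (auto simp: coeff_R coeff_eq_0)
    thus "degree (pderiv R) \<le> dy" by (simp add: degree_pderiv)
    show "degree (coeff R j) \<le> d" for j by (rule dR_le)
    show "degree (coeff (pderiv R) j) \<le> d" for j
      using dR_le[of "Suc j"] degree_smult_le[of "of_nat (Suc j)" "coeff R (Suc j)"]
      by (simp add: coeff_pderiv of_nat_poly del: of_nat_Suc)
  qed
  hence "subdegree (hom ?D) \<le> 2 * d * dy" using ev[OF xp] by (simp add: dR)
  with lower have "\<Lambda> * tdeg g \<le> int (2 * d * dy)" by linarith
  also have "\<dots> = 2 * ((\<Lambda> + B) * int dx) * int dy" using \<Lambda>(2) \<open>0 \<le> B\<close> by (simp add: d_def)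
  also have "\<dots> = \<Lambda> * (2 * int dx * int dy) + 2 * int dx * int dy * B" by (simp add: algebra_simps)
  also have "\<dots> < \<Lambda> * (2 * int dx * int dy + 1)" using \<Lambda>(3) by (simp add: algebra_simps)
  finally show ?thesis using \<Lambda>(2) by (simp add: mult_less_cancel_left)
qed

end

section \<open>Lagrange inversion\<close>

text \<open>The derivation d/dt with y held constant; the logarithmic derivatives below are taken
  with respect to it.\<close>

definition cderiv :: "'a::idom fps poly \<Rightarrow> 'a fps poly" where
  "cderiv p = map_poly fps_deriv p"

lemma coeff_cderiv [simp]: "coeff (cderiv p) j = fps_deriv (coeff p j)"
  by (simp add: cderiv_def coeff_map_poly)

lemma cderiv_diff: "cderiv (p - q) = cderiv p - cderiv q"
  by (rule poly_eqI) simp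

lemma cderiv_mult: "cderiv (p * q) = cderiv p * q + p * cderiv q"
  by (rule poly_eqI) (simp add: coeff_mult fps_deriv_sum sum.distrib add.commute)

lemma cderiv_1 [simp]: "cderiv 1 = 0"
  by (rule poly_eqI) (simp add: coeff_1)

lemma cderiv_power: "cderiv (p ^ Suc n) = of_nat (Suc n) * p ^ n * cderiv p"
  by (induction n) (simp_all add: cderiv_mult algebra_simps)

text \<open>Writing \<open>y - Q(y) = (y - Y) (1 - V(y))\<close>, the logarithmic derivatives of both sides are
  compared; after multiplication with \<open>y\<^sup>N\<close> this becomes an identity of polynomials modulo \<open>t\<^sup>N\<close>.\<close>

lemma lagrange_inversion_deriv:
  fixes Q Q1 :: "'a::idom fps poly" and Y :: "'a fps"
  assumes Q: "Q = smult fps_X Q1" and Y: "poly Q Y = Y" and N: "N > 0"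
  shows "of_nat N * fps_nth Y N = (\<Sum>q<N. fps_nth (coeff (Q ^ q * cderiv Q) q) (N - 1))"
proof -
  define y :: "'a fps poly" where "y = [:0, 1:]"
  define C where "C = [:Y:]"
  \<comment> \<open>The synthetic quotient is (Q1(y) - Q1(Y)) / (y - Y), so \<open>V\<close> is
    (Q(y) - Y) / (y - Y).\<close>
  define V where "V = smult fps_X (synthetic_div Q1 Y)"
  \<comment> \<open>Polynomial substitutes for y^N / (y - a) and 1 / (1 - V): the quotients (y^N -
    a^N) / (y - a) and (1 - V^N) / (1 - V).\<close>
  define H where "H a = (\<Sum>q<N. y ^ (N - Suc q) * a ^ q)" for a
  define W where "W = (\<Sum>q<N. V ^ q)"
  define I where "I = [:fps_X ^ N :: 'a fps:]"
  have "[:- Y, 1:] * smult fps_X (synthetic_div Q1 Y) = smult fps_X (Q1 - [:poly Q1 Y:])"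
    using synthetic_div_correct'[of Y Q1] unfolding mult_smult_right by (metis eq_diff_eq)
  hence "(y - C) * V = Q - C"
    using Y by (simp add: y_def C_def V_def Q smult_diff_right)
  hence fac: "y - Q = (y - C) * (1 - V)" by (simp add: algebra_simps)
  have y': "cderiv y = 0"
    by (rule poly_eqI) (simp add: y_def coeff_pCons split: nat.splits)
  have "Q = y - (y - C) * (1 - V)" unfolding fac [symmetric] by simp
  hence "cderiv Q = cderiv (y - (y - C) * (1 - V))" by (rule arg_cong)
  hence "cderiv Q = - ((cderiv y - cderiv C) * (1 - V) + (y - C) * (cderiv 1 - cderiv V)) + cderiv y"
    by (simp add: cderiv_diff cderiv_mult)
  hence Q': "cderiv Q = cderiv C * (1 - V) + (y - C) * cderiv V"
    by (simp add: y' algebra_simps)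
  have H: "(y - a) * H a = y ^ N - a ^ N" for a
    using power_diff_sumr2[of a N y] by (simp add: H_def algebra_simps)
  have W: "(1 - V) * W = 1 - V ^ N"
    using power_diff_sumr2[of V N 1] by (simp add: W_def algebra_simps)
  \<comment> \<open>Logarithmic derivation of y - Q = (y - C)(1 - V) gives Q' / (y - Q) = C' / (y -
    C) + V' / (1 - V). \<open>Z\<close> is y^N times the difference of the two sides, with the
    substitutes inserted.\<close>
  define Z where "Z = H Q * cderiv Q - H C * cderiv C - y ^ N * W * cderiv V"
  have alg: "a * (h1 * q' - h2 * c' - u * w * v') =
      (a * h1) * q' - d * (c * h2) * c' - u * c * (d * w) * v'"
    if "a = c * d" for a c d h1 h2 q' c' u w v' :: "'a fps poly"
    unfolding that by (simp add: algebra_simps)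
  have "(y - Q) * Z = ((y - Q) * H Q) * cderiv Q - (1 - V) * ((y - C) * H C) * cderiv C
          - y ^ N * (y - C) * ((1 - V) * W) * cderiv V"
    unfolding Z_def by (rule alg[OF fac])
  also have "\<dots> = (y ^ N - Q ^ N) * cderiv Q - (1 - V) * (y ^ N - C ^ N) * cderiv C
          - y ^ N * (y - C) * (1 - V ^ N) * cderiv V"
    by (simp only: H W)
  also have "\<dots> = (1 - V) * cderiv C * C ^ N + y ^ N * (y - C) * cderiv V * V ^ N - cderiv Q * Q ^ N"
    by (simp add: Q' algebra_simps)
  finally have 1: "(y - Q) * Z = \<dots>" .
  have pow: "I dvd p ^ N" if "[:fps_X:] dvd p" for p
  proof -
    have "[:fps_X :: 'a fps:] ^ N = I" by (simp add: I_def poly_const_pow)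
    thus ?thesis using dvd_power_same[OF that, of N] by simp
  qed
  have X_smult: "[:fps_X:] dvd smult fps_X p" for p :: "'a fps poly"
    by (simp add: const_poly_dvd_iff)
  have "Y = fps_X * poly Q1 Y" using Y by (simp add: Q)
  hence "C = smult fps_X [:poly Q1 Y:]" by (simp add: C_def)
  hence "I dvd C ^ N" by (metis pow X_smult)
  moreover have IQ: "I dvd Q ^ N" and "I dvd V ^ N"
    by (auto intro: pow X_smult simp: Q V_def)
  ultimately have "I dvd (y - Q) * Z"
    unfolding 1 by (intro dvd_diff dvd_add dvd_mult)
  \<comment> \<open>The factor y - Q is removed by means of (y - Q) H(Q) = y^N - Q^N: here Q^N is
    divisible by t^N, and y^N only shifts coefficients.\<close>
  hence "I dvd H Q * ((y - Q) * Z) + Q ^ N * Z"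
    by (rule dvd_add[OF dvd_mult dvd_mult2[OF IQ]])
  also have "H Q * ((y - Q) * Z) + Q ^ N * Z = ((y - Q) * H Q) * Z + Q ^ N * Z"
    by (simp add: mult_ac)
  also have "\<dots> = y ^ N * Z" unfolding H by (simp add: algebra_simps)
  finally have "I dvd monom 1 N * Z" by (simp add: y_def monom_altdef)
  hence "fps_X ^ N dvd coeff (monom 1 N * Z) (N - 1 + N)"
    unfolding I_def const_poly_dvd_iff by blast
  hence "fps_X ^ N dvd coeff Z (N - 1)" by (simp add: coeff_monom_mult)
  then obtain r where "coeff Z (N - 1) = fps_X ^ N * r" by (elim dvdE)
  hence Z0: "fps_nth (coeff Z (N - 1)) (N - 1) = 0"
    using N by (simp add: fps_X_power_mult_nth)
  have ypow: "coeff (y ^ i * p) j = (if i \<le> j then coeff p (j - i) else 0)" for i j p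
  proof -
    have "y ^ i = monom 1 i" by (simp add: y_def monom_altdef)
    thus ?thesis by (simp add: coeff_monom_mult)
  qed
  \<comment> \<open>At y^(N-1) the q-th summand yields the y^q-coefficient of Q^q Q'. For the
    constant C only q = 0 remains, and the multiple of y^N contributes nothing.\<close>
  have "coeff (H Q * cderiv Q) (N - 1) = (\<Sum>q<N. coeff (Q ^ q * cderiv Q) q)"
    unfolding H_def sum_distrib_right coeff_sum mult.assoc ypow
    by (intro sum.cong) auto
  moreover have "coeff (H C * cderiv C) (N - 1) = fps_deriv Y"
  proof -
    have "C ^ q * cderiv C = [:Y ^ q * fps_deriv Y:]" for q
      by (intro poly_eqI) (simp add: C_def poly_const_pow coeff_pCons split: nat.splits)
    hence "coeff (H C * cderiv C) (N - 1) = (\<Sum>q<N. if q = 0 then fps_deriv Y else 0)"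
      unfolding H_def sum_distrib_right coeff_sum mult.assoc ypow
      by (intro sum.cong) (auto simp: coeff_pCons C_def split: nat.splits)
    thus ?thesis using N by (simp add: sum.delta)
  qed
  moreover have "coeff (y ^ N * W * cderiv V) (N - 1) = 0"
    using N by (simp add: mult.assoc ypow)
  ultimately have "coeff Z (N - 1) = (\<Sum>q<N. coeff (Q ^ q * cderiv Q) q) - fps_deriv Y"
    by (simp add: Z_def)
  with Z0 N show ?thesis by (simp add: fps_sum_nth)
qed

text \<open>Q^q Q' is the derivative of Q^(q+1) divided by q + 1. The division takes place in the
  field \<open>'k\<close>, after an additive \<open>\<phi>\<close>; later \<open>\<phi>\<close>
  reads off the coefficient of one monomial x^n.\<close>

lemma lagrange_inversion:
  fixes Q Q1 :: "'a::idom fps poly" and \<phi> :: "'a \<Rightarrow> 'k::field_char_0"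
  assumes Q: "Q = smult fps_X Q1" and Y: "poly Q Y = Y" and N: "N > 0"
    and \<phi>: "\<And>x y. \<phi> (x + y) = \<phi> x + \<phi> y"
  shows "\<phi> (fps_nth Y N) = (\<Sum>q = 1..N. 1 / of_nat q * \<phi> (fps_nth (coeff (Q ^ q) (q - 1)) N))"
proof -
  have \<phi>0: "\<phi> 0 = 0" using \<phi>[of 0 0] by simp
  have \<phi>_of_nat: "\<phi> (of_nat m * x) = of_nat m * \<phi> x" for m x
    by (induction m) (simp_all add: \<phi>0 \<phi> algebra_simps)
  have \<phi>_sum: "\<phi> (sum f A) = (\<Sum>x\<in>A. \<phi> (f x))" for f and A :: "nat set"
    by (induction A rule: infinite_finite_induct) (simp_all add: \<phi>0 \<phi>)
  have *: "\<phi> (fps_nth (coeff (Q ^ q * cderiv Q) q) (N - 1)) =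
          of_nat N * (1 / of_nat (Suc q) * \<phi> (fps_nth (coeff (Q ^ Suc q) q) N))" for q
  proof -
    have "of_nat (Suc q) * fps_nth (coeff (Q ^ q * cderiv Q) q) (N - 1) =
            fps_nth (coeff (cderiv (Q ^ Suc q)) q) (N - 1)"
      unfolding cderiv_power
      by (simp add: of_nat_poly fps_of_nat[symmetric] mult.assoc del: of_nat_Suc)
    also have "\<dots> = of_nat N * fps_nth (coeff (Q ^ Suc q) q) N"
      using N by simp
    finally have "of_nat (Suc q) * \<phi> (fps_nth (coeff (Q ^ q * cderiv Q) q) (N - 1)) =
                    of_nat N * \<phi> (fps_nth (coeff (Q ^ Suc q) q) N)"
      by (metis \<phi>_of_nat)
    thus ?thesis by (simp add: field_simps del: of_nat_Suc power_Suc)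
  qed
  have "of_nat N * \<phi> (fps_nth Y N) = (\<Sum>q<N. \<phi> (fps_nth (coeff (Q ^ q * cderiv Q) q) (N - 1)))"
    by (metis \<phi>_of_nat \<phi>_sum lagrange_inversion_deriv[OF Q Y N])
  also have "\<dots> = of_nat N * (\<Sum>q<N. 1 / of_nat (Suc q) * \<phi> (fps_nth (coeff (Q ^ Suc q) q) N))"
    by (simp only: * sum_distrib_left)
  also have "(\<Sum>q<N. 1 / of_nat (Suc q) * \<phi> (fps_nth (coeff (Q ^ Suc q) q) N)) =
               (\<Sum>q = 1..N. 1 / of_nat q * \<phi> (fps_nth (coeff (Q ^ q) (q - 1)) N))"
    by (rule sum.reindex_bij_witness[where i = "\<lambda>q. q - 1" and j = Suc]) auto
  finally show ?thesis using N by simp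
qed


section \<open>The multinomial theorem\<close>

lemma vsize_eq: "finite I \<Longrightarrow> v \<in> vecs I \<Longrightarrow> vsize v = (\<Sum>t\<in>I. Poly_Mapping.lookup v t)"
  unfolding vsize_def by (rule sum.mono_neutral_left) (auto simp: vecs_def in_keys_iff)

lemma vfact_eq: "finite I \<Longrightarrow> v \<in> vecs I \<Longrightarrow> vfact v = (\<Prod>t\<in>I. fact (Poly_Mapping.lookup v t))"
  unfolding vfact_def by (rule prod.mono_neutral_left) (auto simp: vecs_def in_keys_iff)

lemma prod_fact_dvd_fact_sum: "(\<Prod>t\<in>I. fact (f t)) dvd (fact (\<Sum>t\<in>I. f t) :: nat)"
proof (induction I rule: infinite_finite_induct)
  case (insert a I)
  have "fact (f a) * (\<Prod>t\<in>I. fact (f t)) dvd fact (f a) * (fact (\<Sum>t\<in>I. f t) :: nat)"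
    using insert.IH by (rule mult_dvd_mono[OF dvd_refl])
  also have "\<dots> dvd fact (f a + (\<Sum>t\<in>I. f t))" by (rule fact_fact_dvd_fact)
  finally show ?case using insert.hyps by simp
qed auto

text \<open>The multinomial coefficient, with exact division. Staying in \<open>nat\<close> here and
  in \<open>bcoef\<close> makes the integrality of e_T visible.\<close>

definition mcoef :: "('a \<Rightarrow>\<^sub>0 nat) \<Rightarrow> nat" where
  "mcoef v = fact (vsize v) div vfact v"

lemma mcoef_vfact: "mcoef v * vfact v = fact (vsize v)"
  unfolding mcoef_def vsize_def vfact_def
  by (rule dvd_div_mult_self) (rule prod_fact_dvd_fact_sum)

lemma vfact_pos: "vfact v > 0"
  by (simp add: vfact_def)

lemma vecs_empty: "vecs {} = {0}"
  by (auto simp: vecs_def)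

lemma vecs_lookup: "v \<in> vecs I \<Longrightarrow> t \<notin> I \<Longrightarrow> Poly_Mapping.lookup v t = 0"
  by (auto simp: vecs_def in_keys_iff)

lemma vecsI: "(\<And>t. t \<notin> I \<Longrightarrow> Poly_Mapping.lookup v t = 0) \<Longrightarrow> v \<in> vecs I"
  by (force simp: vecs_def in_keys_iff)

lemma finite_vecs_vsize:
  assumes "finite I"
  shows "finite {v \<in> vecs I. vsize v = q}"
proof -
  have "Poly_Mapping.lookup ` {v \<in> vecs I. vsize v = q} \<subseteq>
          {f. \<forall>t. (t \<in> I \<longrightarrow> f t \<in> {..q}) \<and> (t \<notin> I \<longrightarrow> f t = 0)}"
  proof safe
    fix v t assume "v \<in> vecs I" "q = vsize v" "t \<in> I"
    thus "Poly_Mapping.lookup v t \<le> vsize v"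
      using assms member_le_sum[of t I "Poly_Mapping.lookup v"] by (simp add: vsize_eq)
  qed (auto dest: vecs_lookup)
  moreover have "finite {f. \<forall>t. (t \<in> I \<longrightarrow> f t \<in> {..q}) \<and> (t \<notin> I \<longrightarrow> f t = (0::nat))}"
    by (rule finite_set_of_finite_funs[OF assms]) auto
  ultimately have "finite (Poly_Mapping.lookup ` {v \<in> vecs I. vsize v = q})" by (rule finite_subset)
  thus ?thesis by (rule finite_imageD) (auto simp: inj_on_def)
qed

lemma multinomial:
  fixes f :: "'i \<Rightarrow> 'a::comm_semiring_1"
  assumes "finite I"
  shows "(\<Sum>t\<in>I. f t) ^ q =
           (\<Sum>v | v \<in> vecs I \<and> vsize v = q. of_nat (mcoef v) * (\<Prod>t\<in>I. f t ^ Poly_Mapping.lookup v t))"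
  using assms
proof (induction I arbitrary: q rule: finite_induct)
  case empty
  have "{v :: 'i \<Rightarrow>\<^sub>0 nat. v \<in> vecs {} \<and> vsize v = q} = (if q = 0 then {0} else {})"
    by (auto simp: vecs_empty vsize_def)
  thus ?case by (simp add: mcoef_def vsize_def vfact_def zero_power)
next
  case (insert a I)
  let ?V = "\<lambda>q. {v. v \<in> vecs I \<and> vsize v = q}"
  let ?W = "{v. v \<in> vecs (insert a I) \<and> vsize v = q}"
  let ?F = "\<lambda>v. \<Prod>t\<in>I. f t ^ Poly_Mapping.lookup v t"
  let ?s = "\<lambda>k. Poly_Mapping.single a (k::nat)"
  have "(\<Sum>t\<in>insert a I. f t) ^ q = (\<Sum>k\<le>q. of_nat (q choose k) * f a ^ k * (\<Sum>t\<in>I. f t) ^ (q - k))"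
    using insert.hyps by (simp add: binomial_ring)
  also have "\<dots> = (\<Sum>k\<le>q. \<Sum>v\<in>?V (q - k). of_nat ((q choose k) * mcoef v) * (f a ^ k * ?F v))"
    by (simp add: insert.IH sum_distrib_left mult_ac)
  also have "\<dots> = (\<Sum>(k, v)\<in>Sigma {..q} (\<lambda>k. ?V (q - k)). of_nat ((q choose k) * mcoef v) * (f a ^ k * ?F v))"
    using finite_vecs_vsize[OF insert.hyps(1)] by (intro sum.Sigma) auto
  also have "\<dots> = (\<Sum>v\<in>?W. of_nat (mcoef v) * (\<Prod>t\<in>insert a I. f t ^ Poly_Mapping.lookup v t))"
  proof (rule sum.reindex_bij_witness[where j = "\<lambda>(k, v). v + ?s k"
          and i = "\<lambda>v. (Poly_Mapping.lookup v a, v - ?s (Poly_Mapping.lookup v a))"], goal_cases)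
    case (1 x)
    then obtain k v where x: "x = (k, v)" and v: "k \<le> q" "v \<in> vecs I" "vsize v = q - k" by auto
    have "Poly_Mapping.lookup v a = 0" using v(2) insert.hyps(2) by (rule vecs_lookup)
    thus ?case by (simp add: x lookup_add)
  next
    case (2 x)
    then obtain k v where x: "x = (k, v)" and v: "k \<le> q" "v \<in> vecs I" "vsize v = q - k" by auto
    have va: "Poly_Mapping.lookup v a = 0" using v(2) insert.hyps(2) by (rule vecs_lookup)
    have mem: "v + ?s k \<in> vecs (insert a I)"
      using v(2) by (intro vecsI) (auto simp: lookup_add lookup_single when_def dest: vecs_lookup)
    have "(\<Sum>t\<in>I. Poly_Mapping.lookup (v + ?s k) t) = (\<Sum>t\<in>I. Poly_Mapping.lookup v t)"
      using insert.hyps(2) by (intro sum.cong) (auto simp: lookup_add lookup_single when_def)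
    hence "vsize (v + ?s k) = q"
      using v insert.hyps mem va
      by (simp add: vsize_eq[of "insert a I"] lookup_add vsize_eq[of I, symmetric])
    thus ?case using mem by (simp add: x)
  next
    case (3 v)
    show ?case
      by (auto intro!: poly_mapping_eqI simp: lookup_add lookup_minus lookup_single when_def)
  next
    case (4 v)
    hence v: "v \<in> vecs (insert a I)" "vsize v = q" by auto
    let ?k = "Poly_Mapping.lookup v a"
    have mem: "v - ?s ?k \<in> vecs I"
    proof (rule vecsI)
      fix t assume "t \<notin> I"
      thus "Poly_Mapping.lookup (v - ?s ?k) t = 0"
        using vecs_lookup[OF v(1), of t] by (cases "t = a") (auto simp: lookup_minus lookup_single)
    qed
    have "(\<Sum>t\<in>I. Poly_Mapping.lookup (v - ?s ?k) t) = (\<Sum>t\<in>I. Poly_Mapping.lookup v t)"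
      using insert.hyps(2) by (intro sum.cong) (auto simp: lookup_minus lookup_single when_def)
    hence "?k + vsize (v - ?s ?k) = q"
      using insert.hyps v mem by (simp add: vsize_eq[of I] vsize_eq[of "insert a I"])
    thus ?case using mem by auto
  next
    case (5 x)
    then obtain k v where x: "x = (k, v)" and v: "k \<le> q" "v \<in> vecs I" "vsize v = q - k" by auto
    have va: "Poly_Mapping.lookup v a = 0" using v(2) insert.hyps(2) by (rule vecs_lookup)
    have mem: "v + ?s k \<in> vecs (insert a I)"
      using v(2) by (intro vecsI) (auto simp: lookup_add lookup_single when_def dest: vecs_lookup)
    have eq: "Poly_Mapping.lookup (v + ?s k) t = Poly_Mapping.lookup v t" if "t \<in> I" for t
      using that insert.hyps(2) by (auto simp: lookup_add lookup_single when_def)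
    have sz: "vsize (v + ?s k) = q"
      using v insert.hyps mem va
      by (simp add: vsize_eq[of "insert a I"] lookup_add[of v "?s k" a] eq vsize_eq[of I, symmetric])
    have "vfact (v + ?s k) = fact k * vfact v"
      using insert.hyps mem v(2) va by (simp add: vfact_eq[of "insert a I"] vfact_eq[of I] eq lookup_add[of v "?s k" a])
    moreover have "fact q = (q choose k) * (fact k * fact (q - k))"
      using binomial_fact_lemma[OF v(1)] by (simp add: mult_ac)
    ultimately have "mcoef (v + ?s k) * (fact k * vfact v) = (q choose k) * (fact k * (mcoef v * vfact v))"
      using mcoef_vfact[of "v + ?s k"] mcoef_vfact[of v] sz v(3) by (simp only:)
    hence "mcoef (v + ?s k) * (fact k * vfact v) = ((q choose k) * mcoef v) * (fact k * vfact v)"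
      by (simp only: mult_ac)
    hence "mcoef (v + ?s k) = (q choose k) * mcoef v"
      using vfact_pos[of v] by simp
    thus ?case
      using insert.hyps va by (simp add: x eq lookup_add[of v "?s k" a])
  qed
  finally show ?case .
qed

section \<open>The monomials of \<open>Q\<close>\<close>

type_synonym 'r tuple_idx = "'r mindex \<times> nat \<times> 'r mindex \<times> nat \<times> ('r mindex \<Rightarrow>\<^sub>0 nat)"

definition cpow :: "'r::{finite,linorder} mindex set \<Rightarrow> ('r mindex \<Rightarrow> 'k::comm_ring_1) \<Rightarrow> ('r mindex \<Rightarrow>\<^sub>0 nat) \<Rightarrow> 'k" where
  "cpow I c L = (\<Prod>v\<in>I. c v ^ Poly_Mapping.lookup L v)"

text \<open>The multiplicity of a term in the expansion of (z + x^\<open>\<sigma>\<close> y)^j; it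
  equals j! / (m! L!) by \<open>coeff_factor\<close>.\<close>

definition bcoef :: "'r tuple_idx \<Rightarrow> nat" where
  "bcoef = (\<lambda>(l, m, i, j, L). (j choose m) * mcoef L)"

lemma xmon_0_1: "xmon 0 1 = 1"
  by (simp add: xmon_def)

lemma xmon_mult: "xmon s a * xmon t b = xmon (s + t) (a * b)"
  by (simp add: xmon_def mult_single)

lemma xmon_power: "xmon s a ^ n = xmon (nscale n s) (a ^ n)"
  by (induction n) (simp_all add: xmon_0_1 xmon_mult nscale_Suc)

lemma of_nat_mult_xmon: "of_nat n * xmon s a = xmon s (of_nat n * a)"
  by (induction n) (simp_all add: xmon_def single_add algebra_simps)

lemma prod_xmon: "(\<Prod>x\<in>A. xmon (s x) (a x)) = xmon (\<Sum>x\<in>A. s x) (\<Prod>x\<in>A. a x)"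
  by (induction A rule: infinite_finite_induct) (simp_all add: xmon_0_1 xmon_mult)

lemma G1_eq: "finite I \<Longrightarrow> L \<in> vecs I \<Longrightarrow> G1 L = (\<Sum>v\<in>I. nscale (Poly_Mapping.lookup L v) v)"
  unfolding G1_def by (rule sum.mono_neutral_left) (auto simp: vecs_def in_keys_iff)

lemma zpart_power:
  "zpart f k ^ p = (\<Sum>L | L \<in> vecs (idxs_upto k) \<and> vsize L = p.
     xmon (G1 L) (of_nat (mcoef L) * cpow (idxs_upto k) (mfps_nth f) L))"
  unfolding zpart_def multinomial[OF finite_idxs_upto]
  by (intro sum.cong refl)
     (auto simp: xmon_power prod_xmon of_nat_mult_xmon cpow_def G1_eq[OF finite_idxs_upto])

lemma linear_power_sum:
  "[:a, b:] ^ j = (\<Sum>m\<le>j. monom (of_nat (j choose m) * b ^ m * a ^ (j - m)) m)"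
proof (rule poly_eqI)
  fix n
  have "coeff ([:a, b:] ^ j) n = 0" if "n > j"
    using that degree_power_le[of "[:a, b:]" j] degree_pCons_le[of a "[:b:]"]
    by (intro coeff_eq_0) (auto intro: le_less_trans order_trans[OF _ mult_le_mono1])
  thus "coeff ([:a, b:] ^ j) n = coeff (\<Sum>m\<le>j. monom (of_nat (j choose m) * b ^ m * a ^ (j - m)) m) n"
    by (cases "n \<le> j") (auto simp: coeff_sum coeff_linear_poly_power sum.delta)
qed

lemma pcompose_power: "pcompose (p ^ n) (q :: 'a::comm_ring_1 poly) = pcompose p q ^ n"
  by (induction n) (simp_all add: pcompose_1 pcompose_mult)

lemma smult_sum_right: "smult b (sum f A) = (\<Sum>x\<in>A. smult b (f x))"
  by (induction A rule: infinite_finite_induct) (simp_all add: smult_add_right)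

lemma finite_abox [simp]: "finite (abox dx dy)"
  by (rule finite_subset[of _ "{n. n \<in> Nr \<and> tdeg n \<le> int dx} \<times> {..dy}"])
     (auto simp: abox_def intro: finite_Nr_tdeg_le)

lemma coeff_factor:
  fixes L :: "'r mindex \<Rightarrow>\<^sub>0 nat"
  assumes "m \<le> j" "vsize L = j - m"
  shows "of_nat (bcoef (l, m, i, j, L)) = (fact j / (fact m * of_nat (vfact L)) :: 'a::field_char_0)"
proof -
  have "fact j = fact m * fact (j - m) * (j choose m)"
    using binomial_fact_lemma[OF assms(1)] by simp
  also have "fact (j - m) = mcoef L * vfact L" using mcoef_vfact[of L] assms(2) by simp
  finally have "fact j = bcoef (l, m, i, j, L) * (fact m * vfact L)"
    by (simp add: bcoef_def mult_ac)
  hence "(of_nat (fact j) :: 'a) = of_nat (bcoef (l, m, i, j, L) * (fact m * vfact L))" by (rule arg_cong)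
  thus ?thesis using vfact_pos[of L] by (simp add: field_simps)
qed

text \<open>One index per term of a_{i,j} x^i (z + x^\<open>\<sigma>\<close> y)^j, expanded
  completely. The component l, the exponent of the term minus \<open>u\<close>, is determined by the
  others and may be <= 0.\<close>

definition full_idx ::
  "nat \<Rightarrow> nat \<Rightarrow> 'r::{finite,linorder} mindex \<Rightarrow> 'r mindex \<Rightarrow> 'r tuple_idx set" where
  "full_idx dx dy \<sigma> u = {(l, m, i, j, L). i \<in> Nr \<and> tdeg i \<le> int dx \<and> m \<le> j \<and> j \<le> dy
     \<and> L \<in> vecs (idxs_upto \<sigma>) \<and> vsize L = j - m \<and> l = i + nscale m \<sigma> + G1 L - u}"

definition full_sig where
  "full_sig dx dy \<sigma> = (SIGMA (i, j):abox dx dy. SIGMA m:{..j}. {L. L \<in> vecs (idxs_upto \<sigma>) \<and> vsize L = j - m})"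

lemma finite_full_sig [simp]: "finite (full_sig dx dy \<sigma>)"
  unfolding full_sig_def
  by (intro finite_SigmaI finite_abox) (auto intro!: finite_SigmaI finite_vecs_vsize)

lemma full_idx_image:
  "full_idx dx dy \<sigma> u = (\<lambda>((i, j), m, L). (i + nscale m \<sigma> + G1 L - u, m, i, j, L)) ` full_sig dx dy \<sigma>"
  unfolding full_idx_def full_sig_def abox_def by (auto simp: image_iff)

lemma finite_full_idx [simp]: "finite (full_idx dx dy \<sigma> u)"
  unfolding full_idx_image by simp

lemma Nr_G1: "L \<in> vecs (idxs_upto \<sigma>) \<Longrightarrow> G1 L \<in> Nr"
  unfolding G1_eq[OF finite_idxs_upto]
  using idxs_upto_subset_Nr by (intro Nr_sum Nr_nscale) auto

lemma G1_le: "L \<in> vecs (idxs_upto \<sigma>) \<Longrightarrow> grlex_le (G1 L) (nscale (vsize L) \<sigma>)"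
proof -
  assume L: "L \<in> vecs (idxs_upto \<sigma>)"
  have "grlex_le (\<Sum>v\<in>A. nscale (Poly_Mapping.lookup L v) v) (nscale (\<Sum>v\<in>A. Poly_Mapping.lookup L v) \<sigma>)"
    if "A \<subseteq> idxs_upto \<sigma>" for A
    using finite_subset[OF that finite_idxs_upto] that
  proof (induction A rule: finite_induct)
    case (insert v A)
    hence "grlex_le (nscale (Poly_Mapping.lookup L v) v) (nscale (Poly_Mapping.lookup L v) \<sigma>)"
      by (intro grlex_nscale_mono) (auto simp: idxs_upto_def)
    thus ?case using insert by (simp add: nscale_add_left grlex_add_mono)
  qed simp
  thus ?thesis by (simp add: G1_eq[OF finite_idxs_upto L] vsize_eq[OF finite_idxs_upto L])
qed

text \<open>The first coordinate is compared first, so in a fixed total degree the largest element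
  concentrates everything there.\<close>

lemma le_nscale_e_first:
  assumes "(i :: 'r::{finite,linorder} mindex) \<in> Nr" "tdeg i \<le> int dx"
  shows "grlex_le i (nscale dx e_first)"
proof (cases "tdeg i = int dx")
  case False
  thus ?thesis using assms by (auto simp: grlex_le_def tdeg_nscale e_first_def tdeg_single)
next
  case True
  define c0 :: 'r where "c0 = Min UNIV"
  have e: "Poly_Mapping.lookup (nscale dx (e_first :: 'r mindex)) c = (if c = c0 then int dx else 0)" for c
    by (auto simp: lookup_nscale e_first_def c0_def lookup_single when_def)
  have "i \<le> nscale dx e_first"
  proof (cases "Poly_Mapping.lookup i c0 = int dx")
    case 1: True
    have rest: "(\<Sum>c\<in>UNIV - {c0}. Poly_Mapping.lookup i c) = 0"
      using True 1 sum.remove[of UNIV c0 "Poly_Mapping.lookup i"] by (simp add: tdeg_def)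
    have "\<forall>c\<in>UNIV - {c0}. Poly_Mapping.lookup i c = 0"
      using assms(1) rest by (subst (asm) sum_nonneg_eq_0_iff) (auto simp: Nr_def)
    hence "i = nscale dx e_first" using 1 by (intro poly_mapping_eqI) (auto simp: e)
    thus ?thesis by simp
  next
    case False
    hence "Poly_Mapping.lookup i c0 < int dx" using lookup_le_tdeg[OF assms(1), of c0] True by simp
    moreover have "\<not> c' < c0" for c' unfolding c0_def not_less by (rule Min_le) auto
    ultimately have "i < nscale dx e_first"
      unfolding less_poly_mapping.rep_eq less_fun_def by (intro exI[of _ c0]) (auto simp: e)
    thus ?thesis by simp
  qed
  thus ?thesis using True by (auto simp: grlex_le_def tdeg_nscale e_first_def tdeg_single)
qed

text \<open>The upper bound on l and the bound m <= m_l hold for every term of the expansion: the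
  first because i <= (d_x,0,...,0) and G(L) <= (j - m) S(k), the second because i + G(L) >= 0. What
  remains of the ranges is l > 0.\<close>

lemma idx_set_eq:
  fixes k u :: "'r::{finite,linorder} mindex"
  assumes k: "k \<in> Nr" and u: "u \<in> Nr" and \<sigma>: "0 < tdeg (grlex_succ k)"
  shows "idx_set dx dy k u = {t \<in> full_idx dx dy (grlex_succ k) u. grlex_less 0 (fst t)}"
proof -
  define \<sigma> where "\<sigma> = grlex_succ k"
  have \<sigma>Nr: "\<sigma> \<in> Nr" using grlex_succ(1)[OF k] by (simp add: \<sigma>_def)
  have pos: "grlex_less 0 l \<longleftrightarrow> grlex_less u (l + u)" for l
    using grlex_less_add_right[of 0 u l] by simp
  have "l + u \<in> Nr \<and> grlex_le (l + u) (nscale dy \<sigma> + nscale dx e_first) \<and> m \<le> m_max dy k (l + u)"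
    if t: "(l, m, i, j, L) \<in> full_idx dx dy \<sigma> u" for l m i j L
  proof (intro conjI)
    have *: "i \<in> Nr" "tdeg i \<le> int dx" "m \<le> j" "j \<le> dy" "L \<in> vecs (idxs_upto \<sigma>)" "vsize L = j - m"
      and l: "l + u = i + nscale m \<sigma> + G1 L" using t by (auto simp: full_idx_def)
    show "l + u \<in> Nr"
      unfolding l using *(1) Nr_G1[OF *(5)] \<sigma>Nr by (intro Nr_add Nr_nscale)
    have "grlex_le (nscale m \<sigma> + G1 L) (nscale m \<sigma> + nscale (j - m) \<sigma>)"
      using G1_le[OF *(5)] *(6) by simp
    also have "nscale m \<sigma> + nscale (j - m) \<sigma> = nscale j \<sigma>"
      using *(3) by (simp flip: nscale_add_left)
    also have "grlex_le (nscale j \<sigma>) (nscale dy \<sigma>)"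
      using *(4) Nr_grlex_nonneg[OF \<sigma>Nr] by (intro grlex_nscale_mono_left)
    finally have "grlex_le (nscale m \<sigma> + G1 L) (nscale dy \<sigma>)" .
    from grlex_add_mono[OF this le_nscale_e_first[OF *(1,2)]]
    show "grlex_le (l + u) (nscale dy \<sigma> + nscale dx e_first)" by (simp add: l algebra_simps)
    have "grlex_le (0 + nscale m \<sigma>) ((i + G1 L) + nscale m \<sigma>)"
      unfolding grlex_le_add_right using *(1) Nr_G1[OF *(5)] by (intro Nr_grlex_nonneg Nr_add)
    hence "m \<in> {m. grlex_le (nscale m \<sigma>) (l + u)}" by (simp add: l algebra_simps)
    \<comment> \<open>\<open>Max\<close> is meaningful only for a finite set, which is where S(k)
      must have positive degree.\<close>
    moreover have "{m. grlex_le (nscale m \<sigma>) (l + u)} \<subseteq> {..nat (tdeg (l + u))}"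
    proof
      fix m' assume "m' \<in> {m. grlex_le (nscale m \<sigma>) (l + u)}"
      hence "int m' * tdeg \<sigma> \<le> tdeg (l + u)" by (auto simp: grlex_le_def tdeg_nscale)
      moreover have "int m' * 1 \<le> int m' * tdeg \<sigma>"
        using \<sigma> by (intro mult_left_mono) (auto simp: \<sigma>_def)
      ultimately show "m' \<in> {..nat (tdeg (l + u))}" by auto
    qed
    hence "finite {m. grlex_le (nscale m \<sigma>) (l + u)}" by (rule finite_subset) auto
    ultimately have "m \<le> Max {m. grlex_le (nscale m \<sigma>) (l + u)}" by (intro Max_ge)
    thus "m \<le> m_max dy k (l + u)" using * by (simp add: m_max_def \<sigma>_def)
  qed
  note bounds = this
  show ?thesis
  proof (intro set_eqI, goal_cases)
    case (1 t)
    obtain l m i j L where t: "t = (l, m, i, j, L)" by (cases t) auto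
    have eqv: "G1 L = l + u - nscale m \<sigma> - i \<longleftrightarrow> l = i + nscale m \<sigma> + G1 L - u"
      by (auto simp: algebra_simps)
    have "t \<in> idx_set dx dy k u \<longleftrightarrow> t \<in> full_idx dx dy \<sigma> u \<and> grlex_le (grlex_succ u) (l + u) \<and> l + u \<in> Nr"
      using bounds[of l m i j L]
      unfolding t idx_set_def full_idx_def \<sigma>_def [symmetric] mem_Collect_eq prod.case eqv by blast
    also have "\<dots> \<longleftrightarrow> t \<in> full_idx dx dy \<sigma> u \<and> grlex_less 0 l"
      using bounds[of l m i j L] grlex_succ_le_iff[OF u] pos unfolding t by blast
    finally show ?case by (simp add: t \<sigma>_def)
  qed
qed

section \<open>The coefficients of Q as sums over the index set\<close>

locale root_formula = simple_root_expansion P y0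
  for P :: "('r::{finite,linorder} mindex \<Rightarrow>\<^sub>0 'k::field_char_0) poly" and y0 +
  fixes a :: "'r mindex \<Rightarrow> nat \<Rightarrow> 'k" and dx dy :: nat and k :: "'r mindex"
  assumes P_eq: "P = (\<Sum>(i, j)\<in>abox dx dy. monom (xmon i (a i j)) j)"
    and k_Nr: "k \<in> Nr" and k_large: "grlex_less g (grlex_succ k)"
begin

abbreviation "c \<equiv> mfps_nth y0"

definition \<sigma> where "\<sigma> = grlex_succ k"

definition u where "u = g + \<sigma>"

definition coef :: "'r tuple_idx \<Rightarrow> 'k" where
  "coef = (\<lambda>(l, m, i, j, L). of_nat (bcoef (l, m, i, j, L)) * a i j * cpow (idxs_upto \<sigma>) c L)"

text \<open>This is P_k(x, y + c_{S(k)}), because z_k + c_{S(k)} x^S(k) = z_{S(k)}.\<close>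

definition R where "R = pcompose P [:zpart y0 \<sigma>, xmon \<sigma> 1:]"

lemma \<sigma>_Nr: "\<sigma> \<in> Nr"
  using grlex_succ(1)[OF k_Nr] by (simp add: \<sigma>_def)

lemma u_Nr: "u \<in> Nr"
  using g_Nr \<sigma>_Nr by (simp add: u_def Nr_add)

lemma tdeg_\<sigma>: "0 < tdeg \<sigma>"
proof (rule tdeg_pos[OF _ \<sigma>_Nr])
  show "\<sigma> \<noteq> 0" using k_large Nr_grlex_nonneg[OF g_Nr] unfolding \<sigma>_def by (metis grlex.not_less)
qed

lemma i_sub_eq: "i_sub P y0 k = u"
  using i_sub_large[OF k_Nr k_large] by (simp add: u_def \<sigma>_def)

lemma R_expansion: "R = (\<Sum>t\<in>full_idx dx dy \<sigma> u. monom (xmon (fst t + u) (coef t)) (fst (snd t)))"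
proof -
  have "R = pcompose (\<Sum>(i, j)\<in>abox dx dy. monom (xmon i (a i j)) j) [:zpart y0 \<sigma>, xmon \<sigma> 1:]"
    by (simp only: R_def P_eq [symmetric])
  also have "\<dots> = (\<Sum>(i, j)\<in>abox dx dy. smult (xmon i (a i j)) ([:zpart y0 \<sigma>, xmon \<sigma> 1:] ^ j))"
    unfolding pcompose_sum by (intro sum.cong) (auto simp: monom_altdef pcompose_smult pcompose_power pcompose_pCons)
  also have "\<dots> = (\<Sum>(i, j)\<in>abox dx dy. \<Sum>m\<le>j. \<Sum>L | L \<in> vecs (idxs_upto \<sigma>) \<and> vsize L = j - m.
      monom (xmon (i + nscale m \<sigma> + G1 L) (of_nat ((j choose m) * mcoef L) * a i j * cpow (idxs_upto \<sigma>) c L)) m)"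
  proof (intro sum.cong refl, goal_cases)
    case (1 x)
    obtain i j where x: "x = (i, j)" by (cases x)
    have "smult (xmon i (a i j)) (monom (of_nat (j choose m) * xmon \<sigma> 1 ^ m * zpart y0 \<sigma> ^ (j - m)) m) =
      (\<Sum>L | L \<in> vecs (idxs_upto \<sigma>) \<and> vsize L = j - m.
        monom (xmon (i + nscale m \<sigma> + G1 L) (of_nat ((j choose m) * mcoef L) * a i j * cpow (idxs_upto \<sigma>) c L)) m)" for m
      by (simp add: smult_monom zpart_power xmon_power of_nat_mult_xmon xmon_mult
            sum_distrib_left monom_sum smult_sum_right algebra_simps)
    thus ?case by (simp add: x linear_power_sum smult_sum_right)
  qed
  also have "\<dots> = (\<Sum>((i, j), m, L)\<in>full_sig dx dy \<sigma>.
      monom (xmon (i + nscale m \<sigma> + G1 L) (of_nat ((j choose m) * mcoef L) * a i j * cpow (idxs_upto \<sigma>) c L)) m)"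
    unfolding full_sig_def
    by (subst sum.Sigma [symmetric])
       (auto intro!: sum.cong finite_SigmaI finite_vecs_vsize sum.Sigma)
  also have "\<dots> = (\<Sum>t\<in>full_idx dx dy \<sigma> u. monom (xmon (fst t + u) (coef t)) (fst (snd t)))"
    unfolding full_idx_image
    by (subst sum.reindex) (auto simp: inj_on_def coef_def bcoef_def intro!: sum.cong)
  finally show ?thesis .
qed

lemma lookup_R: "Poly_Mapping.lookup (coeff R m) h = mfps_nth (coeff (expn (z \<sigma>)) m) (h - nscale m \<sigma>)"
  unfolding R_def expn_def by (rule lookup_coeff_pcompose) (rule coeff_P zpart_in_xpolys)+

text \<open>Up to the exponent \<open>u\<close> the only term is \<open>\<omega>\<close> x^u y.
  Division by -\<open>\<omega>\<close> x^u turns it into -y and leaves only exponents > 0 in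
  Q.\<close>

lemma lookup_R_le:
  assumes "grlex_le h u"
  shows "Poly_Mapping.lookup (coeff R m) h = (if h = u \<and> m = 1 then \<omega> else 0)"
proof -
  have *: "mlead (coeff (expn (z \<sigma>)) m) (u - nscale m \<sigma>) (coeff [:0, \<omega>:] m)"
    using plead_at_z_succ_large[OF k_large] by (simp add: plead_def u_def \<sigma>_def)
  show ?thesis
  proof (cases "h = u")
    case True
    thus ?thesis using * by (auto simp: lookup_R mlead_def coeff_pCons split: nat.splits)
  next
    case False
    hence "grlex_less h u" using assms by (simp add: grlex_less_def)
    hence "grlex_less (h - nscale m \<sigma>) (u - nscale m \<sigma>)" by (simp only: grlex_less_diff_right)
    thus ?thesis using * False by (simp add: lookup_R mlead_def)
  qed
qed

lemma zpart_succ: "zpart y0 k + xmon \<sigma> (c \<sigma>) = zpart y0 \<sigma>"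
proof (rule poly_mapping_eqI)
  fix n
  have "grlex_le n \<sigma> \<longleftrightarrow> grlex_le n k \<or> n = \<sigma>" if "n \<in> Nr"
    using grlex_succ[OF k_Nr] that unfolding \<sigma>_def by (meson grlex.le_less_trans grlex.less_imp_le grlex.not_less grlex.order_antisym grlex.order_refl)
  moreover have "\<not> grlex_le \<sigma> k" using grlex_succ(2)[OF k_Nr] by (simp add: \<sigma>_def)
  ultimately show "Poly_Mapping.lookup (zpart y0 k + xmon \<sigma> (c \<sigma>)) n = Poly_Mapping.lookup (zpart y0 \<sigma>) n"
    using y0_ge[of \<sigma>] \<sigma>_Nr
    by (auto simp: lookup_add lookup_zpart xmon_def lookup_single when_def idxs_upto_def)
qed

lemma Q_sub_eq: "Q_sub P y0 k = smult (xmon (- u) (1 / (- \<omega>))) R + [:0, 1:]"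
proof -
  have "pcompose (P_sub P y0 k) [:xmon 0 (c \<sigma>), 1:] = R"
    unfolding P_sub_def R_def pcompose_assoc [symmetric]
    using zpart_succ by (simp add: pcompose_pCons xmon_mult \<sigma>_def)
  thus ?thesis
    using omega0_eq[OF k_Nr k_large] by (simp add: Q_sub_def i_sub_eq \<sigma>_def)
qed

lemma lookup_Q_sub:
  "Poly_Mapping.lookup (coeff (Q_sub P y0 k) m) n =
     (- 1 / \<omega>) * Poly_Mapping.lookup (coeff R m) (n + u) + (if m = 1 \<and> n = 0 then 1 else 0)"
  unfolding Q_sub_eq
  by (auto simp: lookup_add lookup_xmon_mult coeff_pCons lookup_one when_def split: nat.splits)

definition I where "I = idx_set dx dy k u"

definition qcoef where "qcoef t = (- 1 / \<omega>) * coef t"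

lemma I_eq: "I = {t \<in> full_idx dx dy \<sigma> u. grlex_less 0 (fst t)}"
  using idx_set_eq[OF k_Nr u_Nr] tdeg_\<sigma> by (simp add: I_def \<sigma>_def)

lemma finite_I [simp]: "finite I"
  by (simp add: I_eq)

lemma I_pos: "t \<in> I \<Longrightarrow> grlex_less 0 (fst t)"
  by (simp add: I_eq)

lemma lookup_Q_sub_nonpos:
  assumes "\<not> grlex_less 0 n"
  shows "Poly_Mapping.lookup (coeff (Q_sub P y0 k) m) n = 0"
proof -
  have "grlex_le (n + u) (0 + u)" unfolding grlex_le_add_right using assms by simp
  thus ?thesis using \<omega>_nonzero by (simp add: lookup_Q_sub lookup_R_le)
qed

text \<open>Terms with l <= 0 cancel among themselves or against the added y, so the indices with l
  > 0 suffice. Several indices may share one monomial, hence the sum.\<close>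

lemma lookup_Q_sub_eq:
  "Poly_Mapping.lookup (coeff (Q_sub P y0 k) m) n =
     (\<Sum>t | t \<in> I \<and> fst t = n \<and> fst (snd t) = m. qcoef t)"
proof (cases "grlex_less 0 n")
  case False
  hence empty: "{t. t \<in> I \<and> fst t = n \<and> fst (snd t) = m} = {}" using I_pos by auto
  show ?thesis unfolding empty lookup_Q_sub_nonpos[OF False] by simp
next
  case True
  have "Poly_Mapping.lookup (coeff R m) (n + u) =
          (\<Sum>t\<in>full_idx dx dy \<sigma> u. if fst t = n \<and> fst (snd t) = m then coef t else 0)"
    unfolding R_expansion coeff_sum lookup_sum
    by (intro sum.cong) (auto simp: xmon_def lookup_single when_def)
  also have "\<dots> = (\<Sum>t | t \<in> I \<and> fst t = n \<and> fst (snd t) = m. coef t)"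
    using True by (intro sum.mono_neutral_cong_right) (auto simp: I_eq)
  finally show ?thesis
    using True by (auto simp: lookup_Q_sub qcoef_def sum_distrib_left)
qed

end

section \<open>Inversion of \<open>y = Q(x, y)\<close>\<close>

text \<open>The exponents of \<open>Q\<close> may be negative, so \<open>x\<^sup>n\<close> is tagged with a power \<open>t\<^bsup>wgt n\<^esup>\<close>: everything
  then lives in formal power series in \<open>t\<close> over the Laurent polynomials.\<close>

locale weighted_root_formula = root_formula P y0 a dx dy k 
    + weight_hom wgt "Poly_Mapping.single :: 'r mindex \<Rightarrow> 'k \<Rightarrow> 'r mindex \<Rightarrow>\<^sub>0 'k"
  for P :: "('r::{finite,linorder} mindex \<Rightarrow>\<^sub>0 'k::field_char_0) poly" and y0 a dx dy k
    and wgt :: "'r mindex \<Rightarrow> int" +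
  assumes I_wgt: "t \<in> I \<Longrightarrow> 0 < wgt (fst t)"
    and occ_wgt: "(i, j) \<in> occurring (Q_sub P y0 k) \<Longrightarrow> 0 < wgt i"
    and tail_wgt: "n + \<sigma> \<in> Nr \<Longrightarrow> grlex_less 0 n \<Longrightarrow> 0 < wgt n"
begin

section \<open>Laurent polynomials and their infinite sums, tagged by powers of t\<close>

definition tag :: "'r mindex \<Rightarrow> 'k \<Rightarrow> ('r mindex \<Rightarrow>\<^sub>0 'k) fps" where
  "tag s b = fps_const (Poly_Mapping.single s b) * fps_X ^ nat (wgt s)"

text \<open>\<open>F\<close> is the image of the formal sum of the r_n x^n under x^n -> x^n t^(wgt
  n). Equations between series are then proved on coefficient functions. Negative weights are
  excluded because no power of t could carry them.\<close>

definition tagged :: "('r mindex \<Rightarrow>\<^sub>0 'k) fps \<Rightarrow> ('r mindex \<Rightarrow> 'k) \<Rightarrow> bool" where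
  "tagged F r \<longleftrightarrow> (\<forall>N n. Poly_Mapping.lookup (fps_nth F N) n = (if int N = wgt n then r n else 0))
     \<and> (\<forall>n. wgt n < 0 \<longrightarrow> r n = 0)"

lemma tagged_unique: "tagged F r \<Longrightarrow> tagged G r \<Longrightarrow> F = G"
  by (intro fps_ext poly_mapping_eqI) (simp add: tagged_def)

lemma tagged_0: "tagged 0 (\<lambda>_. 0)"
  by (simp add: tagged_def)

lemma tagged_add: "tagged F r \<Longrightarrow> tagged G s \<Longrightarrow> tagged (F + G) (\<lambda>n. r n + s n)"
  by (simp add: tagged_def lookup_add)

lemma tagged_diff: "tagged F r \<Longrightarrow> tagged G s \<Longrightarrow> tagged (F - G) (\<lambda>n. r n - s n)"
  by (simp add: tagged_def lookup_minus)

lemma tagged_sum: "(\<And>x. x \<in> A \<Longrightarrow> tagged (F x) (r x)) \<Longrightarrow> tagged (sum F A) (\<lambda>n. \<Sum>x\<in>A. r x n)"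
  by (induction A rule: infinite_finite_induct) (simp_all add: tagged_0 tagged_add)

lemma tagged_1: "tagged 1 (\<lambda>n. if n = 0 then 1 else 0)"
  unfolding tagged_def by (auto simp: lookup_one when_def)

lemma tagged_hom: "tagged (hom f) (mfps_nth f)"
  unfolding tagged_def
proof (intro conjI allI impI)
  fix N n
  have "Poly_Mapping.lookup (fps_nth (hom f) N) n = (if n \<in> fib N then mfps_nth f n else 0)"
    by (simp add: hom_nth lookup_sum lookup_single when_def sum.delta)
  thus "Poly_Mapping.lookup (fps_nth (hom f) N) n = (if int N = wgt n then mfps_nth f n else 0)"
    using mfps_nth_outside[of n f] by (auto simp: fib_def)
next
  fix n assume "wgt n < 0"
  hence "n \<notin> Nr" using weight_nonneg[of n] by auto
  thus "mfps_nth f n = 0" by (rule mfps_nth_outside)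
qed

lemma fps_nth_tag_mult:
  "fps_nth (tag s b * F) N =
     (if nat (wgt s) \<le> N then Poly_Mapping.single s b * fps_nth F (N - nat (wgt s)) else 0)"
  by (simp add: tag_def mult.assoc fps_X_power_mult_nth)

lemma tagged_tag_mult:
  assumes s: "0 \<le> wgt s" and F: "tagged F r"
  shows "tagged (tag s b * F) (\<lambda>n. b * r (n - s))"
proof -
  have neg: "r (n - s) = 0" if "wgt n < wgt s" for n
    using that F weight_diff[of n s] by (simp add: tagged_def)
  show ?thesis
    unfolding tagged_def
  proof (intro conjI allI impI)
    fix N n
    show "Poly_Mapping.lookup (fps_nth (tag s b * F) N) n = (if int N = wgt n then b * r (n - s) else 0)"
    proof (cases "nat (wgt s) \<le> N")
      case True
      hence "int (N - nat (wgt s)) = wgt (n - s) \<longleftrightarrow> int N = wgt n" using s by (auto simp: weight_diff)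
      thus ?thesis
        using True F lookup_xmon_mult[of s b "fps_nth F (N - nat (wgt s))" n]
        by (simp add: fps_nth_tag_mult tagged_def xmon_def)
    next
      case False
      thus ?thesis using neg[of n] s by (auto simp: fps_nth_tag_mult)
    qed
  next
    fix n assume "wgt n < 0"
    thus "b * r (n - s) = 0" using neg[of n] s by simp
  qed
qed

lemma tagged_tag: "0 \<le> wgt s \<Longrightarrow> tagged (tag s b) (\<lambda>n. if n = s then b else 0)"
  using tagged_tag_mult[OF _ tagged_1, of s b] by (simp add: if_distrib cong: if_cong)

lemma tag_mult: "0 \<le> wgt s \<Longrightarrow> 0 \<le> wgt t \<Longrightarrow> tag s b * tag t d = tag (s + t) (b * d)"
  using fps_const_mult[of "Poly_Mapping.single s b" "Poly_Mapping.single t d"]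
  by (simp add: tag_def weight_add nat_add_distrib power_add mult_single mult_ac fps_const_mult [symmetric]
        del: fps_const_mult)

lemma tag_0_1 [simp]: "tag 0 1 = 1"
  by (simp add: tag_def)

lemma weight_nscale: "wgt (nscale m s) = int m * wgt s"
  by (induction m) (simp_all add: nscale_Suc weight_add algebra_simps)

lemma weight_sum: "wgt (sum f A) = (\<Sum>x\<in>A. wgt (f x))"
  by (induction A rule: infinite_finite_induct) (simp_all add: weight_add)

lemma tag_power: "0 \<le> wgt s \<Longrightarrow> tag s b ^ m = tag (nscale m s) (b ^ m)"
  by (induction m) (simp_all add: tag_mult nscale_Suc weight_nscale)

lemma tag_nonzero: "b \<noteq> 0 \<Longrightarrow> tag s b \<noteq> 0"
proof
  assume "b \<noteq> 0" "tag s b = 0"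
  hence "fps_nth (tag s b * 1) (nat (wgt s)) = 0" by simp
  hence "Poly_Mapping.single s b = 0" by (simp only: fps_nth_tag_mult) simp
  with \<open>b \<noteq> 0\<close> show False by (metis lookup_single_eq lookup_zero)
qed

lemma prod_tag_monom:
  assumes "finite J" "\<And>t. t \<in> J \<Longrightarrow> 0 \<le> wgt (l t)"
  shows "(\<Prod>t\<in>J. monom (tag (l t) (b t)) (m t) ^ v t) =
           monom (tag (\<Sum>t\<in>J. nscale (v t) (l t)) (\<Prod>t\<in>J. b t ^ v t)) (\<Sum>t\<in>J. v t * m t)"
  using assms
proof (induction J rule: finite_induct)
  case empty
  show ?case by (simp add: monom_0 one_pCons)
next
  case (insert x J)
  have "0 \<le> wgt (\<Sum>t\<in>J. nscale (v t) (l t))"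
    using insert.prems by (simp add: weight_sum weight_nscale sum_nonneg)
  thus ?case
    using insert by (simp add: monom_power tag_power mult_monom tag_mult weight_nscale mult.commute)
qed

lemma lookup_coeff_power:
  fixes l :: "'i \<Rightarrow> 'r mindex"
  assumes J: "finite J" "\<And>t. t \<in> J \<Longrightarrow> 0 \<le> wgt (l t)" and n: "0 \<le> wgt n"
  shows "Poly_Mapping.lookup (fps_nth (coeff ((\<Sum>t\<in>J. monom (tag (l t) (b t)) (m t)) ^ q) M) (nat (wgt n))) n =
           (\<Sum>v | v \<in> vecs J \<and> vsize v = q \<and> (\<Sum>t\<in>J. Poly_Mapping.lookup v t * m t) = M
                 \<and> (\<Sum>t\<in>J. nscale (Poly_Mapping.lookup v t) (l t)) = n.
              of_nat (mcoef v) * (\<Prod>t\<in>J. b t ^ Poly_Mapping.lookup v t))"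
proof -
  let ?V = "{v. v \<in> vecs J \<and> vsize v = q}"
  define s where "s v = (\<Sum>t\<in>J. nscale (Poly_Mapping.lookup v t) (l t))" for v
  have s: "0 \<le> wgt (s v)" for v
    using J by (simp add: s_def weight_sum weight_nscale sum_nonneg)
  have *: "Poly_Mapping.lookup (fps_nth (coeff (of_nat d * monom (tag (s v) x) e) M) (nat (wgt n))) n =
          (if e = M \<and> s v = n then of_nat d * x else 0)" for d x e v
  proof -
    have "of_nat d * monom (tag (s v) x) e = monom (of_nat d * tag (s v) x) e"
      by (simp add: of_nat_poly smult_monom)
    also have "of_nat d * tag (s v) x = tag (s v) (of_nat d * x)"
      by (induction d) (simp_all add: tag_def single_add fps_const_add [symmetric] algebra_simps del: fps_const_add)
    finally show ?thesis
      using tagged_tag[OF s[of v], of "of_nat d * x"] n by (auto simp: tagged_def)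
  qed
  have "Poly_Mapping.lookup (fps_nth (coeff ((\<Sum>t\<in>J. monom (tag (l t) (b t)) (m t)) ^ q) M) (nat (wgt n))) n =
          (\<Sum>v\<in>?V. if (\<Sum>t\<in>J. Poly_Mapping.lookup v t * m t) = M \<and> s v = n
             then of_nat (mcoef v) * (\<Prod>t\<in>J. b t ^ Poly_Mapping.lookup v t) else 0)"
    unfolding multinomial[OF J(1)] coeff_sum fps_sum_nth lookup_sum
  proof (rule sum.cong[OF refl])
    fix v
    show "Poly_Mapping.lookup (fps_nth (coeff (of_nat (mcoef v) *
            (\<Prod>t\<in>J. monom (tag (l t) (b t)) (m t) ^ Poly_Mapping.lookup v t)) M) (nat (wgt n))) n =
          (if (\<Sum>t\<in>J. Poly_Mapping.lookup v t * m t) = M \<and> s v = n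
           then of_nat (mcoef v) * (\<Prod>t\<in>J. b t ^ Poly_Mapping.lookup v t) else 0)"
      using prod_tag_monom[of J l b m "Poly_Mapping.lookup v", OF J] * by (simp only: s_def [symmetric])
  qed
  also have "\<dots> = (\<Sum>v | v \<in> ?V \<and> (\<Sum>t\<in>J. Poly_Mapping.lookup v t * m t) = M \<and> s v = n.
              of_nat (mcoef v) * (\<Prod>t\<in>J. b t ^ Poly_Mapping.lookup v t))"
    using finite_vecs_vsize[OF J(1), of q] by (intro sum.mono_neutral_cong_right) auto
  finally show ?thesis by (simp add: s_def conj_assoc)
qed

lemma tagged_coeff_sum:
  assumes J: "finite J" "\<And>t. t \<in> J \<Longrightarrow> 0 \<le> wgt (l t)"
  shows "tagged (coeff (\<Sum>t\<in>J. monom (tag (l t) (b t)) (m t)) M)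
           (\<lambda>n. \<Sum>t | t \<in> J \<and> l t = n \<and> m t = M. b t)"
proof -
  have "tagged (\<Sum>t\<in>J. if m t = M then tag (l t) (b t) else 0)
          (\<lambda>n. \<Sum>t\<in>J. if l t = n \<and> m t = M then b t else 0)"
  proof (rule tagged_sum)
    fix t assume "t \<in> J"
    from tagged_tag[OF J(2)[OF this], of "b t"]
    show "tagged (if m t = M then tag (l t) (b t) else 0) (\<lambda>n. if l t = n \<and> m t = M then b t else 0)"
      by (cases "m t = M") (simp_all add: tagged_0 eq_commute)
  qed
  also have "(\<lambda>n. \<Sum>t\<in>J. if l t = n \<and> m t = M then b t else 0) =
               (\<lambda>n. \<Sum>t | t \<in> J \<and> l t = n \<and> m t = M. b t)"
    using J(1) by (intro ext sum.mono_neutral_cong_right) auto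
  also have "(\<Sum>t\<in>J. if m t = M then tag (l t) (b t) else 0) = coeff (\<Sum>t\<in>J. monom (tag (l t) (b t)) (m t)) M"
    by (simp add: coeff_sum)
  finally show ?thesis .
qed

section \<open>The equation solved by the tail of y_0, and its inversion\<close>

abbreviation "Q \<equiv> Q_sub P y0 k"

definition Qt where "Qt = (\<Sum>t\<in>I. monom (tag (fst t) (qcoef t)) (fst (snd t)))"

lemma I_nonneg: "t \<in> I \<Longrightarrow> 0 \<le> wgt (fst t)"
  using I_wgt[of t] by simp

lemma tagged_Qt: "tagged (coeff Qt m) (\<lambda>n. Poly_Mapping.lookup (coeff Q m) n)"
  unfolding Qt_def lookup_Q_sub_eq by (rule tagged_coeff_sum) (auto intro: I_nonneg)

lemma finite_occurring: "finite (occurring Q)"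
proof (rule finite_subset)
  show "occurring Q \<subseteq> (\<Union>j\<le>degree Q. Poly_Mapping.keys (coeff Q j) \<times> {j})"
    by (auto simp: occurring_def in_keys_iff intro!: le_degree)
qed auto

text \<open>A second presentation with one summand per monomial of Q. The sum over \<open>I\<close>
  leads to the closed formula, this one to the bound mu_n, which is defined by the monomials that
  occur.\<close>

lemma Qt_occurring:
  "Qt = (\<Sum>x\<in>occurring Q. monom (tag (fst x) (Poly_Mapping.lookup (coeff Q (snd x)) (fst x))) (snd x))"
    (is "_ = ?S")
proof (rule poly_eqI)
  fix m
  have "tagged (coeff ?S m) (\<lambda>n. \<Sum>x | x \<in> occurring Q \<and> fst x = n \<and> snd x = m.
          Poly_Mapping.lookup (coeff Q (snd x)) (fst x))"
    using occ_wgt finite_occurring by (intro tagged_coeff_sum) (auto intro: less_imp_le)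
  also have "(\<lambda>n. \<Sum>x | x \<in> occurring Q \<and> fst x = n \<and> snd x = m. Poly_Mapping.lookup (coeff Q (snd x)) (fst x))
               = (\<lambda>n. Poly_Mapping.lookup (coeff Q m) n)"
  proof
    fix n
    have "{x. x \<in> occurring Q \<and> fst x = n \<and> snd x = m} =
            (if Poly_Mapping.lookup (coeff Q m) n = 0 then {} else {(n, m)})"
      by (auto simp: occurring_def)
    thus "(\<Sum>x | x \<in> occurring Q \<and> fst x = n \<and> snd x = m. Poly_Mapping.lookup (coeff Q (snd x)) (fst x)) =
            Poly_Mapping.lookup (coeff Q m) n" by simp
  qed
  finally show "coeff Qt m = coeff ?S m"
    using tagged_Qt tagged_unique by blast
qed

text \<open>The tail y_0 - z_{S(k)} divided by x^S(k). The monomial is inverted among the Laurent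
  polynomials and its tag by a shift in t, which is exact because no tail exponent is lighter than
  S(k).\<close>

definition Yt where
  "Yt = fps_const (Poly_Mapping.single (- \<sigma>) 1) * fps_shift (nat (wgt \<sigma>)) (hom (y0 - z \<sigma>))"

lemma hom_diff_z: "hom (y0 - z \<sigma>) = tag \<sigma> 1 * Yt"
proof -
  have zero: "fps_nth (hom (y0 - z \<sigma>)) N = 0" if "N < nat (wgt \<sigma>)" for N
    unfolding hom_nth
  proof (intro sum.neutral ballI)
    fix n assume "n \<in> fib N"
    hence n: "n \<in> Nr" "wgt n < wgt \<sigma>" using that weight_nonneg[OF \<sigma>_Nr] by (auto simp: fib_def)
    have "\<not> grlex_less (0 + \<sigma>) (n - \<sigma> + \<sigma>)"
    proof
      assume "grlex_less (0 + \<sigma>) (n - \<sigma> + \<sigma>)"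
      hence "grlex_less 0 (n - \<sigma>)" by (simp only: grlex_less_add_right)
      with tail_wgt[of "n - \<sigma>"] n show False by (simp add: weight_diff)
    qed
    hence "mfps_nth (y0 - z \<sigma>) n = 0" unfolding mfps_nth_diff_z by simp
    thus "Poly_Mapping.single n (mfps_nth (y0 - z \<sigma>) n) = 0" by simp
  qed
  have "tag \<sigma> 1 * Yt = fps_const (Poly_Mapping.single \<sigma> 1 * Poly_Mapping.single (- \<sigma>) 1)
          * (fps_X ^ nat (wgt \<sigma>) * fps_shift (nat (wgt \<sigma>)) (hom (y0 - z \<sigma>)))"
    unfolding fps_const_mult [symmetric] tag_def Yt_def by (simp only: mult_ac)
  also have "\<dots> = fps_X ^ nat (wgt \<sigma>) * fps_shift (nat (wgt \<sigma>)) (hom (y0 - z \<sigma>))"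
    by (simp add: mult_single)
  also have "\<dots> = hom (y0 - z \<sigma>)"
    using zero by (intro fps_ext) (simp add: fps_X_power_mult_nth)
  finally show ?thesis by simp
qed

lemma lookup_Yt:
  assumes "n + \<sigma> \<in> Nr" "grlex_less 0 n"
  shows "Poly_Mapping.lookup (fps_nth Yt (nat (wgt n))) n = c (n + \<sigma>)"
proof -
  have pos: "0 < wgt n" using tail_wgt[OF assms] .
  have s: "0 \<le> wgt \<sigma>" using weight_nonneg[OF \<sigma>_Nr] .
  have "Poly_Mapping.lookup (fps_nth Yt (nat (wgt n))) n =
          Poly_Mapping.lookup (fps_nth (hom (y0 - z \<sigma>)) (nat (wgt n) + nat (wgt \<sigma>))) (n + \<sigma>)"
    using lookup_xmon_mult[of "- \<sigma>" 1 "fps_nth (hom (y0 - z \<sigma>)) (nat (wgt n) + nat (wgt \<sigma>))" n]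
    by (simp add: Yt_def xmon_def)
  also have "\<dots> = mfps_nth (y0 - z \<sigma>) (n + \<sigma>)"
    using tagged_hom[of "y0 - z \<sigma>"] pos s by (simp add: tagged_def weight_add)
  also have "\<dots> = c (n + \<sigma>)"
  proof -
    have "\<not> grlex_le (n + \<sigma>) (0 + \<sigma>)" unfolding grlex_le_add_right using assms(2) by simp
    thus ?thesis unfolding mfps_nth_diff_z by simp
  qed
  finally show ?thesis .
qed

lemma pcompose_hom_expn:
  "pcompose (map_poly hom (expn (z \<sigma>))) [:0, tag \<sigma> 1:] = smult (tag u (- \<omega>)) (Qt - [:0, 1:])"
proof (rule poly_eqI)
  fix m
  have s: "0 \<le> wgt \<sigma>" and u: "0 \<le> wgt u"
    using weight_nonneg \<sigma>_Nr u_Nr by auto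
  have "tagged (tag (nscale m \<sigma>) 1 * hom (coeff (expn (z \<sigma>)) m))
          (\<lambda>n. 1 * mfps_nth (coeff (expn (z \<sigma>)) m) (n - nscale m \<sigma>))"
    using s by (intro tagged_tag_mult tagged_hom) (simp add: weight_nscale)
  hence 1: "tagged (coeff (pcompose (map_poly hom (expn (z \<sigma>))) [:0, tag \<sigma> 1:]) m)
          (\<lambda>n. Poly_Mapping.lookup (coeff R m) n)"
    using s by (simp add: coeff_pcompose_linear coeff_map_poly tag_power lookup_R)
  have "tagged (coeff [:0, 1:] m) (\<lambda>n. if m = 1 \<and> n = 0 then 1 else 0)"
    using tagged_0 tagged_1 by (cases "m = 1") (auto simp: coeff_pCons split: nat.splits)
  from tagged_tag_mult[OF u tagged_diff[OF tagged_Qt this], of "- \<omega>"]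
  have "tagged (coeff (smult (tag u (- \<omega>)) (Qt - [:0, 1:])) m)
    (\<lambda>n. - \<omega> * (Poly_Mapping.lookup (coeff Q m) (n - u) - (if m = 1 \<and> n - u = 0 then 1 else 0)))"
    by simp
  also have "(\<lambda>n. - \<omega> * (Poly_Mapping.lookup (coeff Q m) (n - u) - (if m = 1 \<and> n - u = 0 then 1 else 0))) =
     (\<lambda>n. Poly_Mapping.lookup (coeff R m) n)"
    using \<omega>_nonzero by (auto simp: lookup_Q_sub fun_eq_iff)
  finally show "coeff (pcompose (map_poly hom (expn (z \<sigma>))) [:0, tag \<sigma> 1:]) m =
      coeff (smult (tag u (- \<omega>)) (Qt - [:0, 1:])) m"
    using 1 tagged_unique by blast
qed

text \<open>The equation P(x, y_0) = 0 reads -\<open>\<omega>\<close> x^u (Q(x, Y) - Y) = 0, and the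
  factor in front is nonzero in a domain.\<close>

lemma poly_Qt: "poly Qt Yt = Yt"
proof -
  have "poly (expn (z \<sigma>)) (y0 - z \<sigma>) = 0"
    using root by (simp add: expn_def poly_pcompose simple_root_def eval_y_def)
  hence "poly (map_poly hom (expn (z \<sigma>))) (tag \<sigma> 1 * Yt) = 0"
    using hom_poly[of "expn (z \<sigma>)" "y0 - z \<sigma>"] by (simp only: hom_diff_z hom_0)
  hence "poly (pcompose (map_poly hom (expn (z \<sigma>))) [:0, tag \<sigma> 1:]) Yt = 0"
    by (simp add: poly_pcompose mult.commute)
  hence "tag u (- \<omega>) * (poly Qt Yt - Yt) = 0"
    by (simp add: pcompose_hom_expn)
  thus ?thesis using tag_nonzero[of "- \<omega>" u] \<omega>_nonzero by simp
qed

lemma Qt_divisible: "\<exists>Q1. Qt = smult fps_X Q1"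
proof -
  have "tag (fst t) (qcoef t) =
          fps_X * (fps_const (Poly_Mapping.single (fst t) (qcoef t)) * fps_X ^ (nat (wgt (fst t)) - 1))"
    if "t \<in> I" for t
  proof -
    have "nat (wgt (fst t)) = Suc (nat (wgt (fst t)) - 1)" using I_wgt[OF that] by simp
    hence e: "(fps_X :: ('r mindex \<Rightarrow>\<^sub>0 'k) fps) ^ nat (wgt (fst t)) =
        fps_X * fps_X ^ (nat (wgt (fst t)) - 1)" by (metis power_Suc)
    show ?thesis unfolding tag_def e by (rule mult.left_commute)
  qed
  hence "Qt = (\<Sum>t\<in>I. smult fps_X (monom (fps_const (Poly_Mapping.single (fst t) (qcoef t)) *
            fps_X ^ (nat (wgt (fst t)) - 1)) (fst (snd t))))"
    unfolding Qt_def by (intro sum.cong) (simp_all add: smult_monom)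
  thus ?thesis unfolding smult_sum_right [symmetric] by blast
qed

text \<open>The coefficient of x^n y^(q-1) in Q^q.\<close>

definition K :: "'r mindex \<Rightarrow> nat \<Rightarrow> 'k" where
  "K n q = Poly_Mapping.lookup (fps_nth (coeff (Qt ^ q) (q - 1)) (nat (wgt n))) n"

lemma K_nonzeroD:
  assumes n: "0 \<le> wgt n" and q: "q \<ge> 1" and K: "K n q \<noteq> 0"
  shows "\<exists>M \<in> vecs (occurring Q). vsize M = q \<and> vnorm M + 1 = q \<and> G2 M = n"
proof -
  have "\<exists>M. M \<in> vecs (occurring Q) \<and> vsize M = q
          \<and> (\<Sum>x\<in>occurring Q. Poly_Mapping.lookup M x * snd x) = q - 1
          \<and> (\<Sum>x\<in>occurring Q. nscale (Poly_Mapping.lookup M x) (fst x)) = n"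
    using K unfolding K_def Qt_occurring
    by (subst (asm) lookup_coeff_power)
       (use finite_occurring occ_wgt n in \<open>auto intro: less_imp_le elim: sum.not_neutral_contains_not_neutral\<close>)
  then obtain M where M: "M \<in> vecs (occurring Q)" "vsize M = q"
    "(\<Sum>x\<in>occurring Q. Poly_Mapping.lookup M x * snd x) = q - 1"
    "(\<Sum>x\<in>occurring Q. nscale (Poly_Mapping.lookup M x) (fst x)) = n" by blast
  have "vnorm M = (\<Sum>x\<in>occurring Q. Poly_Mapping.lookup M x * snd x)"
    unfolding vnorm_def using M(1) finite_occurring
    by (intro sum.mono_neutral_cong_left) (auto simp: vecs_def in_keys_iff)
  moreover have "G2 M = (\<Sum>x\<in>occurring Q. nscale (Poly_Mapping.lookup M x) (fst x))"
    unfolding G2_def using M(1) finite_occurring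
    by (intro sum.mono_neutral_cong_left) (auto simp: vecs_def in_keys_iff)
  ultimately show ?thesis using M q by (intro bexI[of _ M]) auto
qed

text \<open>Each exponent of Q weighs at least 1. Hence the lengths in the definition of mu_n are
  bounded and \<open>GREATEST\<close> is attained.\<close>

lemma vsize_le_wgt:
  assumes "M \<in> vecs (occurring Q)" "vsize M = q" "G2 M = n"
  shows "int q \<le> wgt n"
proof -
  have "wgt n = (\<Sum>x\<in>Poly_Mapping.keys M. int (Poly_Mapping.lookup M x) * wgt (fst x))"
    unfolding assms(3) [symmetric] G2_def weight_sum
    by (intro sum.cong) (auto simp: weight_nscale)
  also have "\<dots> \<ge> (\<Sum>x\<in>Poly_Mapping.keys M. int (Poly_Mapping.lookup M x) * 1)"
  proof (intro sum_mono mult_left_mono)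
    fix x assume "x \<in> Poly_Mapping.keys M"
    hence "x \<in> occurring Q" using assms(1) by (auto simp: vecs_def)
    thus "1 \<le> wgt (fst x)" using occ_wgt[of "fst x" "snd x"] by simp
  qed simp
  finally show ?thesis using assms(2) by (simp add: vsize_def flip: of_nat_sum)
qed

text \<open>Lagrange inversion gives a sum up to the weight of n. Nonzero terms come from vectors
  \<open>M\<close> of length q as in the definition of mu_n, so the sum stops at mu_n, and the
  weight drops out.\<close>

lemma coefficient_eq_sum_K:
  assumes p: "n + \<sigma> \<in> Nr" "grlex_less 0 n"
  shows "c (n + \<sigma>) = (\<Sum>q = 1..mu_max Q n. 1 / of_nat q * K n q)"
proof -
  define N where "N = nat (wgt n)"
  have pos: "0 < wgt n" using tail_wgt[OF p] .
  hence N: "N > 0" "int N = wgt n" by (auto simp: N_def)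
  obtain Q1 where Q1: "Qt = smult fps_X Q1" using Qt_divisible by blast
  have "c (n + \<sigma>) = Poly_Mapping.lookup (fps_nth Yt N) n"
    using lookup_Yt[OF p] by (simp add: N_def)
  also have "\<dots> = (\<Sum>q = 1..N. 1 / of_nat q * K n q)"
    unfolding K_def N_def [symmetric]
    by (rule lagrange_inversion[OF Q1 poly_Qt N(1)]) (simp add: lookup_add)
  also have "\<dots> = (\<Sum>q = 1..mu_max Q n. 1 / of_nat q * K n q)"
  proof (rule sum.mono_neutral_right)
    let ?ok = "\<lambda>m. \<exists>M \<in> vecs (occurring Q). vsize M = m \<and> vnorm M + 1 = m \<and> G2 M = n"
    have bound: "m \<le> N" if "?ok m" for m
    proof -
      from that obtain M where "M \<in> vecs (occurring Q)" "vsize M = m" "G2 M = n" by blast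
      hence "int m \<le> wgt n" by (rule vsize_le_wgt)
      thus ?thesis using N by simp
    qed
    show "{1..mu_max Q n} \<subseteq> {1..N}"
    proof (cases "\<exists>m. ?ok m")
      case True
      hence "?ok (GREATEST m. ?ok m)" by (rule GreatestI_ex_nat) (rule bound)
      hence "(GREATEST m. ?ok m) \<le> N" by (rule bound)
      hence "mu_max Q n \<le> N" using True by (simp only: mu_max_def Let_def if_True)
      thus ?thesis by auto
    next
      case False
      thus ?thesis by (auto simp: mu_max_def Let_def)
    qed
    show "\<forall>q\<in>{1..N} - {1..mu_max Q n}. 1 / of_nat q * K n q = 0"
    proof
      fix q assume q: "q \<in> {1..N} - {1..mu_max Q n}"
      have "K n q = 0"
      proof (rule ccontr)
        assume "K n q \<noteq> 0"
        hence ok: "?ok q" using K_nonzeroD[of n q] pos q by auto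
        hence "q \<le> (GREATEST m. ?ok m)" by (rule Greatest_le_nat) (rule bound)
        moreover have "\<exists>m. ?ok m" using ok by (rule exI)
        ultimately have "q \<le> mu_max Q n" by (simp only: mu_max_def Let_def if_True)
        thus False using q by auto
      qed
      thus "1 / of_nat q * K n q = 0" by simp
    qed
  qed auto
  finally show ?thesis .
qed

lemma K_eq:
  assumes "0 \<le> wgt n"
  shows "K n q = (\<Sum>v | v \<in> vecs I \<and> vsize v = q \<and> (\<Sum>t\<in>I. Poly_Mapping.lookup v t * fst (snd t)) = q - 1
            \<and> (\<Sum>t\<in>I. nscale (Poly_Mapping.lookup v t) (fst t)) = n.
              of_nat (mcoef v) * (\<Prod>t\<in>I. qcoef t ^ Poly_Mapping.lookup v t))"
  unfolding K_def Qt_def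
  by (rule lookup_coeff_power[of I fst n qcoef "\<lambda>t. fst (snd t)" q "q - 1",
        OF finite_I I_nonneg assms])

end

context root_formula
begin

lemma coefficient_expansion:
  assumes p: "p \<in> Nr" "grlex_less \<sigma> p" and n: "n = p - \<sigma>"
  shows "c p = (\<Sum>q = 1..mu_max (Q_sub P y0 k) n. 1 / of_nat q *
     (\<Sum>v | v \<in> vecs I \<and> vsize v = q \<and> (\<Sum>t\<in>I. Poly_Mapping.lookup v t * fst (snd t)) = q - 1
            \<and> (\<Sum>t\<in>I. nscale (Poly_Mapping.lookup v t) (fst t)) = n.
              of_nat (mcoef v) * (\<Prod>t\<in>I. qcoef t ^ Poly_Mapping.lookup v t)))"
proof -
  let ?Q = "Q_sub P y0 k"
  \<comment> \<open>Both presentations of Q must have positive weights. The tail of y_0 is covered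
    by the second clause of \<open>exists_weights\<close> with the shift
    \<open>\<sigma>\<close>.\<close>
  define F where "F = fst ` I \<union> fst ` occurring ?Q"
  have occ: "finite (occurring ?Q)"
  proof (rule finite_subset)
    show "occurring ?Q \<subseteq> (\<Union>j\<le>degree ?Q. Poly_Mapping.keys (coeff ?Q j) \<times> {j})"
      by (auto simp: occurring_def in_keys_iff intro!: le_degree)
  qed auto
  have "finite F" using occ by (simp add: F_def)
  moreover have "grlex_less 0 x" if "x \<in> F" for x
    using that I_pos lookup_Q_sub_nonpos by (force simp: F_def occurring_def)
  ultimately obtain \<epsilon> \<Lambda>0 where \<epsilon>: "\<forall>c. 0 \<le> \<epsilon> c" and
    \<Lambda>0: "\<And>\<Lambda>. \<Lambda> \<ge> \<Lambda>0 \<Longrightarrow> (\<forall>n\<in>F. 0 < wt \<Lambda> \<epsilon> n) \<and>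
           (\<forall>n. n + \<sigma> \<in> Nr \<longrightarrow> grlex_less 0 n \<longrightarrow> 0 < wt \<Lambda> \<epsilon> n)"
    using exists_weights[of F \<sigma>] by blast
  \<comment> \<open>The 1 ensures that weights dominate the total degree on N^r.\<close>
  define l where "l = wt (max \<Lambda>0 1) \<epsilon>"
  have l: "\<And>n. n \<in> F \<Longrightarrow> 0 < l n" "\<And>n. n + \<sigma> \<in> Nr \<Longrightarrow> grlex_less 0 n \<Longrightarrow> 0 < l n"
    using \<Lambda>0[of "max \<Lambda>0 1"] by (auto simp: l_def)
  have hom: "weight_hom l (Poly_Mapping.single :: _ \<Rightarrow> 'k \<Rightarrow> _)"
    using \<epsilon> by unfold_locales (auto simp: l_def wt_add single_add mult_single intro!: tdeg_le_wt)
  interpret weighted_root_formula P y0 a dx dy k l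
  proof (intro weighted_root_formula.intro root_formula_axioms hom weighted_root_formula_axioms.intro)
    show "0 < l (fst t)" if "t \<in> I" for t using that l(1) by (auto simp: F_def)
    show "0 < l i" if "(i, j) \<in> occurring ?Q" for i j using that l(1) by (force simp: F_def)
  qed (use l(2) in auto)
  have np: "n + \<sigma> = p" using n by simp
  have pos: "grlex_less 0 n"
    using p(2) grlex_less_add_right[of 0 \<sigma> n] unfolding np by simp
  have "0 \<le> l n" using l(2)[OF _ pos] p(1) np by fastforce
  thus ?thesis
    using coefficient_eq_sum_K[of n] p(1) pos unfolding np by (simp only: K_eq)
qed

end

section \<open>Grouping by the exponents of the coefficients of \<open>P\<close> and \<open>y\<^sub>0\<close>\<close>

lemma vsize_add: "vsize (v + w) = vsize v + vsize w"
  unfolding vsize_def by (rule setsum_keys_plus_distrib[of "\<lambda>_ x. x"]) auto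

lemma vnorm_alt: "vnorm v = (\<Sum>x\<in>Poly_Mapping.keys v. Poly_Mapping.lookup v x * snd x)"
  unfolding vnorm_def by (intro sum.cong) auto

lemma vnorm_add: "vnorm (v + w) = vnorm v + vnorm w"
  unfolding vnorm_alt by (rule setsum_keys_plus_distrib[of "\<lambda>t x. x * snd t"]) (auto simp: algebra_simps)

lemma G1_add: "G1 (v + w) = G1 v + G1 w"
  unfolding G1_def by (rule setsum_keys_plus_distrib[of "\<lambda>t x. nscale x t"]) (auto simp: nscale_add_left)

lemma G2_alt: "G2 v = (\<Sum>x\<in>Poly_Mapping.keys v. nscale (Poly_Mapping.lookup v x) (fst x))"
  unfolding G2_def by (intro sum.cong) auto

lemma G2_add: "G2 (v + w) = G2 v + G2 w"
  unfolding G2_alt by (rule setsum_keys_plus_distrib[of "\<lambda>t x. nscale x (fst t)"]) (auto simp: nscale_add_left)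

lemma additive_sum:
  assumes "F 0 = 0" "\<And>x y. F (x + y) = F x + F y"
  shows "F (sum f A) = (\<Sum>x\<in>A. F (f x))"
  by (induction A rule: infinite_finite_induct) (simp_all add: assms)

lemma vsize_0 [simp]: "vsize 0 = 0" and vnorm_0 [simp]: "vnorm 0 = 0"
  and G1_0 [simp]: "G1 0 = 0" and G2_0 [simp]: "G2 0 = 0"
  by (simp_all add: vsize_def vnorm_def G1_def G2_def)

lemmas vsize_sum = additive_sum[of vsize, OF vsize_0 vsize_add]
lemmas vnorm_sum = additive_sum[of vnorm, OF vnorm_0 vnorm_add]
lemmas G1_sum = additive_sum[of G1, OF G1_0 G1_add]
lemmas G2_sum = additive_sum[of G2, OF G2_0 G2_add]

lemma vsize_single: "vsize (Poly_Mapping.single a x) = x"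
  by (simp add: vsize_def)

lemma vnorm_single: "vnorm (Poly_Mapping.single a x) = x * snd a"
  by (simp add: vnorm_alt)

lemma G2_single: "G2 (Poly_Mapping.single a x) = nscale x (fst a)"
  by (simp add: G2_alt)

lemma sum_const_nscale: "(\<Sum>_<(x::nat). n) = nscale x n"
  by (induction x) (simp_all add: nscale_Suc add.commute)

definition vrep :: "nat \<Rightarrow> ('a \<Rightarrow>\<^sub>0 nat) \<Rightarrow> 'a \<Rightarrow>\<^sub>0 nat" where
  "vrep x v = (\<Sum>_<x. v)"

lemma lookup_vrep: "Poly_Mapping.lookup (vrep x v) t = x * Poly_Mapping.lookup v t"
  by (simp add: vrep_def lookup_sum)

lemma vsize_vrep: "vsize (vrep x v) = x * vsize v"
  by (simp add: vrep_def vsize_sum)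

lemma G1_vrep: "G1 (vrep x v) = nscale x (G1 v)"
  by (simp only: vrep_def G1_sum sum_const_nscale)

section \<open>The vectors S and T belonging to a tuple\<close>

context root_formula
begin

definition idxL :: "'r tuple_idx \<Rightarrow> 'r mindex \<Rightarrow>\<^sub>0 nat" where
  "idxL t = snd (snd (snd (snd t)))"

definition idxij :: "'r tuple_idx \<Rightarrow> 'r mindex \<times> nat" where
  "idxij t = (fst (snd (snd t)), fst (snd (snd (snd t))))"

definition SN :: "('r tuple_idx \<Rightarrow>\<^sub>0 nat) \<Rightarrow> 'r mindex \<times> nat \<Rightarrow>\<^sub>0 nat" where
  "SN v = (\<Sum>t\<in>I. Poly_Mapping.single (idxij t) (Poly_Mapping.lookup v t))"

definition TN :: "('r tuple_idx \<Rightarrow>\<^sub>0 nat) \<Rightarrow> 'r mindex \<Rightarrow>\<^sub>0 nat" where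
  "TN v = (\<Sum>t\<in>I. vrep (Poly_Mapping.lookup v t) (idxL t))"

lemma I_props:
  assumes "t \<in> I"
  shows "idxij t \<in> abox dx dy" "fst (snd t) \<le> snd (idxij t)" "idxL t \<in> vecs (idxs_upto \<sigma>)"
    "vsize (idxL t) = snd (idxij t) - fst (snd t)"
    "fst t = fst (idxij t) + nscale (fst (snd t)) \<sigma> + G1 (idxL t) - u"
  using assms by (auto simp: I_eq full_idx_def idxij_def idxL_def abox_def)

lemma lookup_SN: "Poly_Mapping.lookup (SN v) x = (\<Sum>t\<in>I. if idxij t = x then Poly_Mapping.lookup v t else 0)"
  by (simp add: SN_def lookup_sum lookup_single when_def)

lemma lookup_TN: "Poly_Mapping.lookup (TN v) x = (\<Sum>t\<in>I. Poly_Mapping.lookup v t * Poly_Mapping.lookup (idxL t) x)"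
  by (simp add: TN_def lookup_sum lookup_vrep)

lemma SN_vecs: "SN v \<in> vecs (abox dx dy)"
  by (rule vecsI) (auto simp: lookup_SN dest: I_props(1) intro!: sum.neutral)

lemma TN_vecs: "TN v \<in> vecs (idxs_upto \<sigma>)"
  by (rule vecsI) (auto simp: lookup_TN dest: vecs_lookup[OF I_props(3)])

lemma vsize_SN: "v \<in> vecs I \<Longrightarrow> vsize (SN v) = vsize v"
  by (simp add: SN_def vsize_sum vsize_single vsize_eq[of I])

lemma vnorm_SN: "vnorm (SN v) = (\<Sum>t\<in>I. Poly_Mapping.lookup v t * snd (idxij t))"
  by (simp add: SN_def vnorm_sum vnorm_single)

lemma G2_SN: "G2 (SN v) = (\<Sum>t\<in>I. nscale (Poly_Mapping.lookup v t) (fst (idxij t)))"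
  by (simp add: SN_def G2_sum G2_single)

text \<open>Each index satisfies j = |L| + m; summed with multiplicities, ||S|| exceeds |T| by the
  total y-degree.\<close>

lemma vnorm_SN_eq:
  "vnorm (SN v) = vsize (TN v) + (\<Sum>t\<in>I. Poly_Mapping.lookup v t * fst (snd t))"
  unfolding vnorm_SN TN_def vsize_sum sum.distrib [symmetric]
  by (intro sum.cong refl) (simp add: I_props vsize_vrep add_mult_distrib2 [symmetric])

text \<open>The relation l = i + m S(k) + G(L) - i_k, summed with multiplicities and solved for the
  part from L.\<close>

lemma G1_TN:
  assumes "v \<in> vecs I"
  shows "G1 (TN v) = (\<Sum>t\<in>I. nscale (Poly_Mapping.lookup v t) (fst t)) + nscale (vsize v) u
           - nscale (\<Sum>t\<in>I. Poly_Mapping.lookup v t * fst (snd t)) \<sigma> - G2 (SN v)"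
proof -
  have "nscale x (fst t) = nscale x (fst (idxij t)) + nscale (x * fst (snd t)) \<sigma> + nscale x (G1 (idxL t)) - nscale x u"
    if "t \<in> I" for t x
    using I_props(5)[OF that] by (simp add: nscale_add_right nscale_minus_right nscale_mult)
  hence "(\<Sum>t\<in>I. nscale (Poly_Mapping.lookup v t) (fst t)) =
     (\<Sum>t\<in>I. nscale (Poly_Mapping.lookup v t) (fst (idxij t)))
     + (\<Sum>t\<in>I. nscale (Poly_Mapping.lookup v t * fst (snd t)) \<sigma>)
     + (\<Sum>t\<in>I. nscale (Poly_Mapping.lookup v t) (G1 (idxL t)))
     - (\<Sum>t\<in>I. nscale (Poly_Mapping.lookup v t) u)"
    by (simp add: sum.distrib sum_subtractf)
  thus ?thesis
    using assms
    by (simp add: G2_SN TN_def G1_sum G1_vrep nscale_sum_left vsize_eq[of I])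
qed

lemma tuples_iff:
  assumes S: "S \<in> vecs (abox dx dy)" and T: "T \<in> vecs (idxs_upto \<sigma>)"
  shows "v \<in> tuples dx dy k u q S T \<longleftrightarrow> v \<in> vecs I \<and> vsize v = q \<and> SN v = S \<and> TN v = T"
proof -
  have s: "(\<Sum>t \<in> {t \<in> I. \<exists>l m L. t = (l,m,i,j,L)}. Poly_Mapping.lookup v t) = Poly_Mapping.lookup (SN v) (i, j)" for i j
    unfolding lookup_SN by (intro sum.mono_neutral_cong_left) (auto simp: idxij_def)
  have t: "(\<Sum>(l,m,i,j,L) \<in> I. Poly_Mapping.lookup v (l,m,i,j,L) * Poly_Mapping.lookup L x) =
              Poly_Mapping.lookup (TN v) x" for x
    unfolding lookup_TN by (intro sum.cong) (auto simp: idxL_def)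
  have "(\<forall>(i,j)\<in>abox dx dy. Poly_Mapping.lookup (SN v) (i, j) = Poly_Mapping.lookup S (i, j)) \<longleftrightarrow> SN v = S"
    using vecs_lookup[OF S] vecs_lookup[OF SN_vecs[of v]] by (fastforce simp: poly_mapping_eq_iff fun_eq_iff)
  moreover have "(\<forall>x\<in>idxs_upto \<sigma>. Poly_Mapping.lookup (TN v) x = Poly_Mapping.lookup T x) \<longleftrightarrow> TN v = T"
    using vecs_lookup[OF T] vecs_lookup[OF TN_vecs[of v]] by (fastforce simp: poly_mapping_eq_iff fun_eq_iff)
  ultimately show ?thesis
    unfolding tuples_def I_def [symmetric] \<sigma>_def [symmetric] s t mem_Collect_eq
    using vsize_eq[OF finite_I, of v] by auto
qed

definition X :: "'r mindex \<Rightarrow> nat \<Rightarrow> ('r tuple_idx \<Rightarrow>\<^sub>0 nat) set" where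
  "X n q = {v. v \<in> vecs I \<and> vsize v = q \<and> (\<Sum>t\<in>I. Poly_Mapping.lookup v t * fst (snd t)) = q - 1
            \<and> (\<Sum>t\<in>I. nscale (Poly_Mapping.lookup v t) (fst t)) = n}"

text \<open>Total y-degree q - 1 and total exponent n translate into the conditions on |T| and G(T).
  The inequality ||S|| >= q - 1 then follows from |T| >= 0.\<close>

lemma X_iff:
  assumes "v \<in> vecs I" "vsize v = q" "q \<ge> 1"
  shows "v \<in> X n q \<longleftrightarrow> SN v \<in> Svecs dx dy q \<and> TN v \<in> Tvecs k u n q (SN v)"
proof -
  define M where "M = (\<Sum>t\<in>I. Poly_Mapping.lookup v t * fst (snd t))"
  define l where "l = (\<Sum>t\<in>I. nscale (Poly_Mapping.lookup v t) (fst t))"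
  have X: "v \<in> X n q \<longleftrightarrow> M = q - 1 \<and> l = n"
    unfolding X_def mem_Collect_eq M_def [symmetric] l_def [symmetric] using assms(1,2) by blast
  have S: "SN v \<in> Svecs dx dy q \<longleftrightarrow> vnorm (SN v) + 1 \<ge> q"
    using assms by (simp add: Svecs_def SN_vecs vsize_SN)
  have T: "TN v \<in> Tvecs k u n q (SN v) \<longleftrightarrow> vsize (TN v) + q = vnorm (SN v) + 1 \<and>
      G1 (TN v) = n + nscale q u - nscale (q - 1) \<sigma> - G2 (SN v)"
    by (simp add: Tvecs_def \<sigma>_def [symmetric] TN_vecs)
  have 1: "vsize (TN v) + q = vnorm (SN v) + 1 \<longleftrightarrow> M = q - 1"
    and 2: "M = q - 1 \<Longrightarrow> vnorm (SN v) + 1 \<ge> q"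
    using assms(3) vnorm_SN_eq[of v, folded M_def] by linarith+
  have 3: "G1 (TN v) = n + nscale q u - nscale M \<sigma> - G2 (SN v) \<longleftrightarrow> l = n"
    unfolding G1_TN[OF assms(1), folded M_def l_def] assms(2) by simp
  show ?thesis
  proof (cases "M = q - 1")
    case True
    show ?thesis unfolding X S T 1 3 [unfolded True] using True 2[OF True] by blast
  qed (unfold X S T 1, blast)
qed

lemma finite_Svecs: "finite (Svecs dx dy q :: ('r mindex \<times> nat \<Rightarrow>\<^sub>0 nat) set)"
  by (rule finite_subset[OF _ finite_vecs_vsize[OF finite_abox, of dx dy q]]) (auto simp: Svecs_def)

lemma finite_Tvecs: "finite (Tvecs k u n q S)"
  by (rule finite_subset[OF _ finite_vecs_vsize[OF finite_idxs_upto, of "grlex_succ k" "vnorm S + 1 - q"]])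
     (auto simp: Tvecs_def)

lemma finite_tuples: "finite (tuples dx dy k u q S T)"
  by (rule finite_subset[OF _ finite_vecs_vsize[OF finite_I, of q]])
     (auto simp: tuples_def I_def [symmetric] vsize_eq[OF finite_I])

lemma tuples_Svecs_Tvecs:
  assumes "S \<in> Svecs dx dy q" "T \<in> Tvecs k u n q S"
  shows "v \<in> tuples dx dy k u q S T \<longleftrightarrow> v \<in> vecs I \<and> vsize v = q \<and> SN v = S \<and> TN v = T"
  using assms by (intro tuples_iff) (auto simp: Svecs_def Tvecs_def \<sigma>_def)

text \<open>A tuple determines its S and T, so the sets \<open>tuples\<close> partition
  \<open>X\<close>.\<close>

lemma sum_X:
  assumes q: "q \<ge> 1"
  shows "sum h (X n q) = (\<Sum>S\<in>Svecs dx dy q. \<Sum>T\<in>Tvecs k u n q S. \<Sum>v\<in>tuples dx dy k u q S T. h v)"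
proof -
  have "(\<Sum>S\<in>Svecs dx dy q. \<Sum>T\<in>Tvecs k u n q S. \<Sum>v\<in>tuples dx dy k u q S T. h v) =
          (\<Sum>S\<in>Svecs dx dy q. \<Sum>(T, v)\<in>Sigma (Tvecs k u n q S) (tuples dx dy k u q S). h v)"
    by (intro sum.cong refl sum.Sigma finite_Tvecs ballI finite_tuples)
  also have "\<dots> = (\<Sum>(S, T, v)\<in>Sigma (Svecs dx dy q) (\<lambda>S. Sigma (Tvecs k u n q S) (tuples dx dy k u q S)). h v)"
    by (subst sum.Sigma) (auto intro!: finite_Svecs finite_SigmaI finite_Tvecs finite_tuples simp: split_def)
  also have "\<dots> = sum h (X n q)"
  proof (rule sum.reindex_bij_witness[where i = "\<lambda>v. (SN v, TN v, v)" and j = "\<lambda>(S, T, v). v"], goal_cases)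
    case (1 x)
    thus ?case by (auto simp: tuples_Svecs_Tvecs)
  next
    case (2 x)
    thus ?case using q by (auto simp: tuples_Svecs_Tvecs X_iff)
  next
    case (4 v)
    hence "v \<in> vecs I" "vsize v = q" by (auto simp: X_def)
    thus ?case using X_iff[of v q n] 4 q by (auto simp: tuples_Svecs_Tvecs)
  qed auto
  finally show ?thesis ..
qed

section \<open>Integrality of e_T and the product over the indices\<close>

definition eN :: "nat \<Rightarrow> ('r mindex \<times> nat \<Rightarrow>\<^sub>0 nat) \<Rightarrow> ('r mindex \<Rightarrow>\<^sub>0 nat) \<Rightarrow> nat" where
  "eN q S T = (\<Sum>v\<in>tuples dx dy k u q S T. mcoef v * (\<Prod>t\<in>I. bcoef t ^ Poly_Mapping.lookup v t))"

lemma eT_eq: "eT dx dy k u q S T = of_nat (eN q S T)"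
  unfolding eT_def eN_def of_nat_sum I_def [symmetric]
proof (intro sum.cong refl)
  fix v assume "v \<in> tuples dx dy k u q S T"
  hence v: "v \<in> vecs I" "vsize v = q"
    by (auto simp: tuples_def I_def [symmetric] vsize_eq[OF finite_I])
  have "of_nat (fact q) = (of_nat (mcoef v * vfact v) :: rat)" using v by (simp add: mcoef_vfact)
  moreover have "of_nat (vfact v) = (\<Prod>t\<in>I. fact (Poly_Mapping.lookup v t) :: rat)"
    by (simp only: vfact_eq[OF finite_I v(1)] of_nat_prod of_nat_fact)
  moreover have "(of_nat (vfact v) :: rat) \<noteq> 0" using vfact_pos[of v] by simp
  ultimately have 1: "fact q / (\<Prod>t\<in>I. fact (Poly_Mapping.lookup v t)) = (of_nat (mcoef v) :: rat)"
    by (simp add: field_simps)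
  have 2: "(\<Prod>(l,m,i,j,L)\<in>I. (fact j / (fact m * of_nat (vfact L))) ^ Poly_Mapping.lookup v (l,m,i,j,L))
          = (\<Prod>t\<in>I. of_nat (bcoef t) ^ Poly_Mapping.lookup v t :: rat)"
  proof (intro prod.cong refl, goal_cases)
    case (1 t)
    obtain l m i j L where t: "t = (l, m, i, j, L)" by (cases t) auto
    have "m \<le> j" "vsize L = j - m" using I_props[OF 1] by (simp_all add: t idxij_def idxL_def)
    thus ?case by (simp add: t coeff_factor)
  qed
  show "fact q / (\<Prod>t\<in>I. fact (Poly_Mapping.lookup v t)) *
        (\<Prod>(l,m,i,j,L)\<in>I. (fact j / (fact m * of_nat (vfact L))) ^ Poly_Mapping.lookup v (l,m,i,j,L)) =
        (of_nat (mcoef v * (\<Prod>t\<in>I. bcoef t ^ Poly_Mapping.lookup v t)) :: rat)"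
    unfolding 1 2 by simp
qed

lemma prod_a_SN:
  "(\<Prod>t\<in>I. a (fst (idxij t)) (snd (idxij t)) ^ Poly_Mapping.lookup v t) =
     (\<Prod>(i, j)\<in>abox dx dy. a i j ^ Poly_Mapping.lookup (SN v) (i, j))"
proof -
  have "(\<Prod>(i, j)\<in>abox dx dy. a i j ^ Poly_Mapping.lookup (SN v) (i, j)) =
          (\<Prod>x\<in>abox dx dy. \<Prod>t\<in>I. a (fst x) (snd x) ^ (if idxij t = x then Poly_Mapping.lookup v t else 0))"
    by (intro prod.cong) (auto simp: lookup_SN power_sum)
  also have "\<dots> = (\<Prod>t\<in>I. \<Prod>x\<in>abox dx dy. a (fst x) (snd x) ^ (if idxij t = x then Poly_Mapping.lookup v t else 0))"
    by (rule prod.swap)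
  also have "\<dots> = (\<Prod>t\<in>I. \<Prod>x\<in>abox dx dy. if idxij t = x then a (fst x) (snd x) ^ Poly_Mapping.lookup v t else 1)"
    by (intro prod.cong) auto
  also have "\<dots> = (\<Prod>t\<in>I. a (fst (idxij t)) (snd (idxij t)) ^ Poly_Mapping.lookup v t)"
    by (intro prod.cong) (auto simp: prod.delta' dest: I_props(1))
  finally show ?thesis ..
qed

lemma prod_c_TN:
  "(\<Prod>t\<in>I. cpow (idxs_upto \<sigma>) c (idxL t) ^ Poly_Mapping.lookup v t) =
     (\<Prod>x\<in>idxs_upto \<sigma>. c x ^ Poly_Mapping.lookup (TN v) x)"
proof -
  have "(\<Prod>x\<in>idxs_upto \<sigma>. c x ^ Poly_Mapping.lookup (TN v) x) =
          (\<Prod>x\<in>idxs_upto \<sigma>. \<Prod>t\<in>I. (c x ^ Poly_Mapping.lookup (idxL t) x) ^ Poly_Mapping.lookup v t)"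
    by (intro prod.cong) (simp_all add: lookup_TN power_sum power_mult [symmetric] mult.commute)
  also have "\<dots> = (\<Prod>t\<in>I. \<Prod>x\<in>idxs_upto \<sigma>. (c x ^ Poly_Mapping.lookup (idxL t) x) ^ Poly_Mapping.lookup v t)"
    by (rule prod.swap)
  finally show ?thesis by (simp add: cpow_def prod_power_distrib)
qed

lemma prod_qcoef:
  assumes "v \<in> vecs I"
  shows "(\<Prod>t\<in>I. qcoef t ^ Poly_Mapping.lookup v t) =
    (- 1 / \<omega>) ^ vsize v * of_nat (\<Prod>t\<in>I. bcoef t ^ Poly_Mapping.lookup v t) *
    (\<Prod>(i, j)\<in>abox dx dy. a i j ^ Poly_Mapping.lookup (SN v) (i, j)) *
    (\<Prod>x\<in>idxs_upto \<sigma>. c x ^ Poly_Mapping.lookup (TN v) x)"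
proof -
  have "qcoef t = (- 1 / \<omega>) * of_nat (bcoef t) * a (fst (idxij t)) (snd (idxij t)) * cpow (idxs_upto \<sigma>) c (idxL t)" for t
    by (cases t) (simp add: qcoef_def coef_def idxij_def idxL_def)
  thus ?thesis
    by (simp only: power_mult_distrib prod.distrib prod_a_SN prod_c_TN vsize_eq[OF finite_I assms]
          power_sum of_nat_prod of_nat_power)
qed

lemma coefficient_formula:
  assumes p: "p \<in> Nr" "grlex_less \<sigma> p" and n: "n = p - \<sigma>"
  shows "c p = (\<Sum>q = 1..mu_max (Q_sub P y0 k) n. 1 / of_nat q * (- 1 / \<omega>) ^ q *
     (\<Sum>S\<in>Svecs dx dy q. (\<Prod>(i, j)\<in>abox dx dy. a i j ^ Poly_Mapping.lookup S (i, j)) *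
        (\<Sum>T\<in>Tvecs k u n q S. of_nat (eN q S T) * (\<Prod>x\<in>idxs_upto \<sigma>. c x ^ Poly_Mapping.lookup T x))))"
  unfolding coefficient_expansion[OF assms] X_def [symmetric]
proof (intro sum.cong refl, goal_cases)
  case (1 q)
  let ?A = "\<lambda>S. \<Prod>(i, j)\<in>abox dx dy. a i j ^ Poly_Mapping.lookup S (i, j)"
  let ?C = "\<lambda>T. \<Prod>x\<in>idxs_upto \<sigma>. c x ^ Poly_Mapping.lookup T x"
  let ?B = "\<lambda>v. mcoef v * (\<Prod>t\<in>I. bcoef t ^ Poly_Mapping.lookup v t)"
  have "(\<Sum>v\<in>X n q. of_nat (mcoef v) * (\<Prod>t\<in>I. qcoef t ^ Poly_Mapping.lookup v t)) =
          (\<Sum>S\<in>Svecs dx dy q. \<Sum>T\<in>Tvecs k u n q S. \<Sum>v\<in>tuples dx dy k u q S T.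
             of_nat (mcoef v) * (\<Prod>t\<in>I. qcoef t ^ Poly_Mapping.lookup v t))"
    using 1 by (intro sum_X) auto
  also have "\<dots> = (\<Sum>S\<in>Svecs dx dy q. \<Sum>T\<in>Tvecs k u n q S. \<Sum>v\<in>tuples dx dy k u q S T.
             (- 1 / \<omega>) ^ q * (?A S * (of_nat (?B v) * ?C T)))"
  proof (intro sum.cong refl)
    fix S T v
    assume "S \<in> Svecs dx dy q" "T \<in> Tvecs k u n q S" "v \<in> tuples dx dy k u q S T"
    hence "v \<in> vecs I" "vsize v = q" "SN v = S" "TN v = T" by (auto simp: tuples_Svecs_Tvecs)
    thus "of_nat (mcoef v) * (\<Prod>t\<in>I. qcoef t ^ Poly_Mapping.lookup v t) =
            (- 1 / \<omega>) ^ q * (?A S * (of_nat (?B v) * ?C T))"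
      by (simp only: prod_qcoef of_nat_mult) (simp only: mult_ac)
  qed
  also have "\<dots> = (- 1 / \<omega>) ^ q * (\<Sum>S\<in>Svecs dx dy q. ?A S * (\<Sum>T\<in>Tvecs k u n q S. of_nat (eN q S T) * ?C T))"
    by (simp only: eN_def of_nat_sum sum_distrib_left sum_distrib_right)
  finally show ?case by (simp only: mult.assoc)
qed

end


theorem corollary5p7:
  fixes P :: "('r::{finite,linorder} mindex \<Rightarrow>\<^sub>0 'k::field_char_0) poly"
    and a :: "'r mindex \<Rightarrow> nat \<Rightarrow> 'k"
    and y0 :: "('r, 'k) mfps"
    and c :: "'r mindex \<Rightarrow> 'k"
    and dx dy :: nat
    and k p n u :: "'r mindex"
    and w :: 'k
  assumes r: "CARD('r) \<ge> 2"
    and P: "P = (\<Sum>(i,j)\<in>abox dx dy. monom (xmon i (a i j)) j)" "P \<noteq> 0"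
    and c: "c = mfps_nth y0"
    and y0_ge: "\<And>m. \<not> grlex_le e_last m \<Longrightarrow> c m = 0"
    and c_last: "c e_last \<noteq> 0"
    and root: "simple_root P y0"
    and not_poly: "y0 \<notin> mfps_of_xpoly ` xpolys"
    and k: "k \<in> Nr" "tdeg k \<ge> 2 * int dx * int dy + 1"
    and p: "p \<in> Nr" "grlex_less (grlex_succ k) p"
    and n: "n = p - grlex_succ k"
    and u: "u = i_sub P y0 k"
    and w: "w = omega0 P y0"
  shows "(\<forall>q\<in>{1..mu_max (Q_sub P y0 k) n}. \<forall>S\<in>Svecs dx dy q. \<forall>T\<in>Tvecs k u n q S.
            eT dx dy k u q S T \<in> \<nat>)
    \<and> c p = c (grlex_succ k + n)
    \<and> c (grlex_succ k + n) =
        (\<Sum>q = 1..mu_max (Q_sub P y0 k) n. 1 / of_nat q * (-1 / w) ^ q *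
           (\<Sum>S\<in>Svecs dx dy q. (\<Prod>(i,j)\<in>abox dx dy. a i j ^ Poly_Mapping.lookup S (i,j)) *
              (\<Sum>T\<in>Tvecs k u n q S. of_rat (eT dx dy k u q S T) *
                 (\<Prod>i\<in>idxs_upto (grlex_succ k). c i ^ Poly_Mapping.lookup T i))))"
proof -
  have keys: "Poly_Mapping.keys (coeff P j) \<subseteq> {i \<in> Nr. tdeg i \<le> int dx}" for j
  proof -
    have "coeff P j = (\<Sum>(i, j')\<in>abox dx dy. if j' = j then xmon i (a i j') else 0)"
      unfolding P(1) coeff_sum by (intro sum.cong) auto
    also have "Poly_Mapping.keys \<dots> \<subseteq> {i \<in> Nr. tdeg i \<le> int dx}"
      by (rule order_trans[OF keys_sum]) (auto simp: abox_def xmon_def split: if_splits)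
    finally show ?thesis .
  qed
  interpret simple_root_expansion P y0
    using keys y0_ge root by unfold_locales (auto simp: xpolys_def c)
  have "degree P \<le> dy"
    unfolding P(1) by (intro degree_sum_le finite_abox) (auto simp: abox_def intro: order_trans[OF degree_monom_le])
  hence "tdeg g \<le> 2 * int dx * int dy"
    using keys by (intro tdeg_g_le) auto
  \<comment> \<open>The +1 in the bound gives |g| < |k| <= |S(k)|, so the degrees alone decide the
    comparison.\<close>
  hence "grlex_less g (grlex_succ k)"
    using k tdeg_grlex_succ[OF k(1)] by (simp add: grlex_less_iff)
  with P(1) k(1) interpret root_formula P y0 a dx dy k
    by unfold_locales
  have u_eq: "u = root_formula.u P y0 k" and w_eq: "w = \<omega>"
    using i_sub_eq omega0_eq[OF k_Nr k_large] u w by auto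
  have "eT dx dy k u q S T = of_nat (eN q S T)" for q S T
    unfolding u_eq by (rule eT_eq)
  moreover have "c p = (\<Sum>q = 1..mu_max (Q_sub P y0 k) n. 1 / of_nat q * (- 1 / w) ^ q *
     (\<Sum>S\<in>Svecs dx dy q. (\<Prod>(i, j)\<in>abox dx dy. a i j ^ Poly_Mapping.lookup S (i, j)) *
        (\<Sum>T\<in>Tvecs k u n q S. of_nat (eN q S T) * (\<Prod>x\<in>idxs_upto (grlex_succ k). c x ^ Poly_Mapping.lookup T x))))"
    using coefficient_formula[of p n] p n unfolding \<sigma>_def u_eq w_eq c by blast
  ultimately show ?thesis using n by simp
qed

end
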